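(* For each $n\ge1$ let $p_n\in(0,1)$ with $p_n\to0$, $r_n:=1/p_n$, let $X_1,\dots,X_n$ be i.i.d. $\mathrm{Ber}(p_n)$, and let $G_n$ be a simple undirected graph on $n$ vertices, with vertices labelled $\{1,\dots,n\}$ in non-increasing order of the degrees, with adjacency matrix $(a_{uv}(G_n))$. Let $T_n:=\frac12\sum_{1\le u,v\le n}a_{uv}(G_n)X_uX_v$ and suppose $\mathbb E[T_n]=|E(G_n)|p_n^2=\Theta(1)$. For $M>0$ let $X_{u,M}:=X_u\mathbf 1\{d_u\le Mr_n\}$, where $d_u$ is the degree of $u$ in $G_n$, and $T_{n,M}:=\sum_{(u,v)\in E(G_n)}X_{u,M}X_{v,M}$. Let $\lambda\ge0$. Then the following are equivalent: (a) $T_n$ converges in distribution to $\mathrm{Pois}(\lambda)$. (b) $\lim_{M\to\infty}\lim_{n\to\infty}\mathbb E\,T_{n,M}=\lambda$ and $\lim_{M\to\infty}\lim_{n\to\infty}\mathrm{Var}(T_{n,M})=\lambda$. (c) The following three conditions hold: (i) $\lim_{K\to\infty}\lim_{n\to\infty}\frac12\int_K^\infty\int_K^\infty W_{G_n}(x,y)\,dx\,dy=\lambda$; (ii) for all $K>0$ large enough, $\lim_{n\to\infty}\|W_{G_n}\|_{\square([0,K]^2)}=0$; (iii) for all $K,M>0$ large enough, $\lim_{n\to\infty}\int_0^Kd_{W_{G_n}}(x)\mathbf 1\{d_{W_{G_n}}(x)\le M\}\,dx=0$.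
   Context: $\Theta(1)$ means bounded above and below by positive constants for all large $n$. $\mathrm{Pois}(0)$ is the point mass at $0$. Sums over $(u,v)\in E(G_n)$ count each edge once. $W_{G_n}:[0,\infty)^2\to[0,1]$ is $W_{G_n}(x,y)=\mathbf 1\{(\lceil xr_n\rceil,\lceil yr_n\rceil)\in E(G_n)\}$ for $x,y\in[0,n/r_n]$ and $0$ otherwise; $d_{W_{G_n}}(x):=\int_0^\infty W_{G_n}(x,y)\,dy$. $\|U\|_{\square([0,K]^2)}:=\sup_{f,g:[0,K]\to[-1,1]}\left|\int_{[0,K]^2}U(x,y)f(x)g(y)\,dx\,dy\right|$. Double limits: $\lim_{m\to\infty}\lim_{n\to\infty}a_{n,m}=a$ means $\limsup_{m}\limsup_{n}a_{n,m}=\liminf_{m}\liminf_{n}a_{n,m}=a$. *)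

theory Defs
  imports "HOL-Probability.Probability"
begin

text \<open>
  A simple undirected graph with vertex set \<open>{1..n}\<close> is given by its edge set, a set of
  two-element subsets of \<open>{1..n}\<close>; a sum over the edge set therefore counts each edge once.
\<close>

definition simple_graph :: "nat \<Rightarrow> nat set set \<Rightarrow> bool" where
  "simple_graph n E \<longleftrightarrow> E \<subseteq> {e. e \<subseteq> {1..n} \<and> card e = 2}"

definition adj :: "nat set set \<Rightarrow> nat \<Rightarrow> nat \<Rightarrow> real" where
  "adj E u v = of_bool ({u, v} \<in> E)"

definition deg :: "nat set set \<Rightarrow> nat \<Rightarrow> nat" where
  "deg E u = card {v. {u, v} \<in> E}"

definition degree_ordered :: "nat \<Rightarrow> nat set set \<Rightarrow> bool" where
  "degree_ordered n E \<longleftrightarrow> (\<forall>u\<in>{1..n}. \<forall>v\<in>{1..n}. u \<le> v \<longrightarrow> deg E v \<le> deg E u)"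

definition edge_count_stat :: "nat \<Rightarrow> nat set set \<Rightarrow> (nat \<Rightarrow> 'a \<Rightarrow> real) \<Rightarrow> 'a \<Rightarrow> real" where
  "edge_count_stat n E X \<omega> =
     1 / 2 * (\<Sum>u\<in>{1..n}. \<Sum>v\<in>{1..n}. adj E u v * X u \<omega> * X v \<omega>)"

definition trunc_var ::
  "real \<Rightarrow> nat set set \<Rightarrow> real \<Rightarrow> (nat \<Rightarrow> 'a \<Rightarrow> real) \<Rightarrow> nat \<Rightarrow> 'a \<Rightarrow> real" where
  "trunc_var r E M X u \<omega> = X u \<omega> * of_bool (real (deg E u) \<le> M * r)"

text \<open>For an edge \<open>e = {u, v}\<close> the product over \<open>e\<close> is \<open>X\<^sub>u\<^sub>,\<^sub>M X\<^sub>v\<^sub>,\<^sub>M\<close>.\<close>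

definition trunc_edge_stat ::
  "real \<Rightarrow> nat set set \<Rightarrow> real \<Rightarrow> (nat \<Rightarrow> 'a \<Rightarrow> real) \<Rightarrow> 'a \<Rightarrow> real" where
  "trunc_edge_stat r E M X \<omega> = (\<Sum>e\<in>E. \<Prod>u\<in>e. trunc_var r E M X u \<omega>)"

text \<open>For \<open>x = 0\<close> the label \<open>\<lceil>x r\<rceil>\<close> is \<open>0\<close>, which is not a vertex, so the value is \<open>0\<close>.\<close>

definition graphon :: "nat \<Rightarrow> real \<Rightarrow> nat set set \<Rightarrow> real \<Rightarrow> real \<Rightarrow> real" where
  "graphon n r E x y =
     (if x \<in> {0..real n / r} \<and> y \<in> {0..real n / r}
      then of_bool ({nat \<lceil>x * r\<rceil>, nat \<lceil>y * r\<rceil>} \<in> E) else 0)"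

definition graphon_deg :: "(real \<Rightarrow> real \<Rightarrow> real) \<Rightarrow> real \<Rightarrow> real" where
  "graphon_deg W x = (LINT y:{0..}|lborel. W x y)"

text \<open>
  The test functions are the measurable functions from \<open>[0, K]\<close> to \<open>[-1, 1]\<close>; their values
  outside \<open>[0, K]\<close> play no role.
\<close>

definition cut_test :: "real \<Rightarrow> (real \<Rightarrow> real) set" where
  "cut_test K = {f. set_borel_measurable lborel {0..K} f \<and> f ` {0..K} \<subseteq> {-1..1}}"

definition cut_norm :: "real \<Rightarrow> (real \<Rightarrow> real \<Rightarrow> real) \<Rightarrow> real" where
  "cut_norm K U =
     (SUP (f, g) \<in> cut_test K \<times> cut_test K.
        \<bar>LINT (x, y):{0..K} \<times> {0..K}|(lborel \<Otimes>\<^sub>M lborel). U x y * f x * g y\<bar>)"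

text \<open>
  \<open>lim\<^sub>m lim\<^sub>n a m n = l\<close> as a double limit, which does not require the inner limits to exist; the
  upper and lower limits are taken in the extended reals.
\<close>

definition double_lim :: "(real \<Rightarrow> nat \<Rightarrow> real) \<Rightarrow> real \<Rightarrow> bool" where
  "double_lim a l \<longleftrightarrow>
     Limsup at_top (\<lambda>m. limsup (\<lambda>n. ereal (a m n))) = ereal l \<and>
     Liminf at_top (\<lambda>m. liminf (\<lambda>n. ereal (a m n))) = ereal l"

text \<open>The library's \<open>poisson_pmf\<close> is only specified for a positive rate.\<close>

definition poisson_law :: "real \<Rightarrow> real measure" where
  "poisson_law l = (if l = 0 then return borel 0 else distr (measure_pmf (poisson_pmf l)) borel real)"

definition bernoulli_law :: "real \<Rightarrow> real measure" where
  "bernoulli_law q = distr (measure_pmf (bernoulli_pmf q)) borel of_bool"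

end

theory Submission
  imports Defs
begin

text \<open>
  Write \<open>H\<^sub>M\<close> for the edges whose endpoints both have degree at most \<open>M r\<close>, and let \<open>C\<close> bound
  \<open>p\<^sup>2 |E|\<close>. At most \<open>2 C r / M\<close> vertices have degree above \<open>M r\<close>, so \<open>T\<close> and its truncation differ with
  probability at most \<open>2 C / M\<close>. The truncated variance is, up to vanishing terms, \<open>p\<^sup>2 |H\<^sub>M|\<close> plus
  \<open>p\<^sup>3\<close> times the number of ordered pairs of distinct intersecting edges of \<open>H\<^sub>M\<close>, so (b) says that
  \<open>p\<^sup>2 |H\<^sub>M|\<close> tends to \<open>\<lambda>\<close> and that the second term vanishes for every \<open>M\<close>.

  (b) to (a): conditioning on one edge being present gives
  \<open>k P(T = k) \<approx> \<lambda> P(T = k - 1)\<close>, the recursion that characterises the Poisson weights.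

  (a) to (b): for fixed \<open>M\<close> the truncated count has bounded third moment and is dominated by \<open>T\<close>, so
  its first two moments are asymptotically at most those of \<open>Pois(\<lambda>)\<close>; comparing \<open>min T K\<close> with its
  truncated version gives the matching lower bounds as \<open>M\<close> grows.

  (b) and (c): vertices of index above \<open>K r\<close> have degree at most \<open>2 C r / K\<close>, so the integral in (i) and
  \<open>p\<^sup>2 |H\<^sub>M|\<close> differ by at most the integral in (iii), which in turn controls the intersecting pairs and
  is controlled by them through the degree squares. Condition (ii) follows from (iii).
\<close>

text \<open>Only the first moment of the untruncated count is bounded; its second moment may diverge
  (a star does this), so weak convergence gives no moments directly. The cut-off
  \<open>M / p\<close> is the degree at which one edge meets at most \<open>2 M / p\<close> others:
  the factor \<open>p\<close> paid for a new vertex is compensated exactly, and moments up to the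
  third stay bounded in \<open>n\<close> for fixed \<open>M\<close>. The variance detects the
  Poisson law because, beyond the mean, it contains only the nonnegative contribution of
  intersecting pairs: once mean and variance share a limit, nothing is left for these pairs. Their
  contribution grows with \<open>M\<close>, so smallness for large \<open>M\<close> gives smallness
  for each \<open>M\<close>. In graphon terms a vertex is a cell of length \<open>p\<close>, and
  \<open>p\<close> times its degree is the graphon degree. The scaled degrees, weighted by
  \<open>p\<close>, sum to at most \<open>2 C\<close>, so in the degree ordering the
  \<open>u\<close>-th one is at most \<open>2 C / (u p)\<close>. This is the link between truncation
  by degree and truncation by index. All estimates are finite sums over vertex subsets; the random
  variables enter only through the law of their active set.\<close>

section \<open>Expectations over independent Bernoulli variables\<close>

text \<open>
  The expectation of \<open>f\<close> applied to the random set of active elements of \<open>V\<close>, each active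
  independently with probability \<open>q\<close>.
\<close>

definition bern_exp :: "real \<Rightarrow> 'v set \<Rightarrow> ('v set \<Rightarrow> real) \<Rightarrow> real" where
  "bern_exp q V f = (\<Sum>S\<in>Pow V. q ^ card S * (1 - q) ^ card (V - S) * f S)"

lemma bern_exp_cong: "(\<And>S. S \<subseteq> V \<Longrightarrow> f S = g S) \<Longrightarrow> bern_exp q V f = bern_exp q V g"
  unfolding bern_exp_def by (intro sum.cong) auto

lemma bern_exp_add: "bern_exp q V (\<lambda>S. f S + g S) = bern_exp q V f + bern_exp q V g"
  unfolding bern_exp_def by (simp add: sum.distrib ring_distribs)

lemma bern_exp_cmult: "bern_exp q V (\<lambda>S. c * f S) = c * bern_exp q V f"
  unfolding bern_exp_def by (simp add: sum_distrib_left mult_ac)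

lemma bern_exp_diff: "bern_exp q V (\<lambda>S. f S - g S) = bern_exp q V f - bern_exp q V g"
  unfolding bern_exp_def by (simp add: sum_subtractf ring_distribs)

lemma bern_exp_sum: "bern_exp q V (\<lambda>S. \<Sum>i\<in>I. f i S) = (\<Sum>i\<in>I. bern_exp q V (f i))"
  unfolding bern_exp_def by (subst sum.swap) (simp add: sum_distrib_left)

lemma bern_exp_mono:
  assumes "0 \<le> q" "q \<le> 1" "\<And>S. S \<subseteq> V \<Longrightarrow> f S \<le> g S"
  shows "bern_exp q V f \<le> bern_exp q V g"
  unfolding bern_exp_def using assms by (intro sum_mono mult_left_mono) auto

text \<open>Conditioning on whether \<open>x\<close> is active. Total mass one and the independence
  statements below are all derived from this identity.\<close>

lemma bern_exp_insert:
  assumes "finite V" "x \<notin> V"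
  shows "bern_exp q (insert x V) f = q * bern_exp q V (\<lambda>S. f (insert x S)) + (1 - q) * bern_exp q V f"
proof -
  have inj: "inj_on (insert x) (Pow V)"
    using assms(2) by (auto simp: inj_on_def)
  have "bern_exp q (insert x V) f =
      (\<Sum>S\<in>Pow V. q ^ card S * (1 - q) ^ card (insert x V - S) * f S) +
      (\<Sum>S\<in>insert x ` Pow V. q ^ card S * (1 - q) ^ card (insert x V - S) * f S)"
    unfolding bern_exp_def Pow_insert using assms by (intro sum.union_disjoint) auto
  also have "(\<Sum>S\<in>insert x ` Pow V. q ^ card S * (1 - q) ^ card (insert x V - S) * f S)
      = q * bern_exp q V (\<lambda>S. f (insert x S))"
    unfolding bern_exp_def sum.reindex[OF inj] sum_distrib_left
  proof (rule sum.cong, goal_cases)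
    case (2 S)
    then have "card (insert x S) = Suc (card S)" "insert x V - insert x S = V - S"
      using assms finite_subset[of S V] by (auto intro!: card_insert_disjoint)
    then show ?case by simp
  qed simp
  also have "(\<Sum>S\<in>Pow V. q ^ card S * (1 - q) ^ card (insert x V - S) * f S) = (1 - q) * bern_exp q V f"
    unfolding bern_exp_def sum_distrib_left
  proof (rule sum.cong, goal_cases)
    case (2 S)
    then have "insert x V - S = insert x (V - S)" using assms by auto
    then have "card (insert x V - S) = Suc (card (V - S))" using assms by simp
    then show ?case by simp
  qed simp
  finally show ?thesis by simp
qed

lemma bern_exp_const: "finite V \<Longrightarrow> bern_exp q V (\<lambda>_. c) = c"
proof (induction V rule: finite_induct)
  case empty
  then show ?case by (simp add: bern_exp_def)
next
  case (insert x V)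
  then show ?case by (simp add: bern_exp_insert algebra_simps)
qed

lemma bern_exp_abs_diff_le:
  assumes "0 \<le> q" "q \<le> 1" "\<And>S. S \<subseteq> V \<Longrightarrow> \<bar>f S - g S\<bar> \<le> h S"
  shows "\<bar>bern_exp q V f - bern_exp q V g\<bar> \<le> bern_exp q V h"
proof -
  have "bern_exp q V (\<lambda>S. f S - g S) \<le> bern_exp q V h"
    using assms by (intro bern_exp_mono) (auto simp: abs_le_iff)
  moreover have "bern_exp q V (\<lambda>S. g S - f S) \<le> bern_exp q V h"
    using assms by (intro bern_exp_mono) (auto simp: abs_le_iff)
  ultimately show ?thesis by (simp add: bern_exp_diff abs_le_iff)
qed

text \<open>The hypothesis on \<open>h\<close> says that \<open>h\<close> ignores whether
  \<open>a\<close> is active, so this is independence of one vertex from a function of the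
  others.\<close>

lemma bern_exp_mem:
  assumes "finite V" "a \<in> V" and h: "\<And>S. h (insert a S) = h S"
  shows "bern_exp q V (\<lambda>S. of_bool (a \<in> S) * h S) = q * bern_exp q V h"
proof -
  have V: "V = insert a (V - {a})" using assms by auto
  have 1: "bern_exp q (V - {a}) (\<lambda>S. of_bool (a \<in> S) * h S) = 0"
    unfolding bern_exp_def by (intro sum.neutral) auto
  have "bern_exp q (insert a (V - {a})) (\<lambda>S. of_bool (a \<in> S) * h S) = q * bern_exp q (insert a (V - {a})) h"
    using assms(1) by (simp add: bern_exp_insert h 1 del: insert_Diff_single) (simp add: algebra_simps)
  then show ?thesis using V by simp
qed

text \<open>Independence of the vertices in \<open>A\<close> from the remaining ones: deleting
  \<open>A\<close> from the argument makes \<open>f\<close> a function of the rest. The induction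
  peels off one vertex of \<open>A\<close> and hides its indicator in \<open>g\<close>.\<close>

lemma bern_exp_superset:
  assumes "finite V" "A \<subseteq> V"
  shows "bern_exp q V (\<lambda>S. of_bool (A \<subseteq> S) * f (S - A)) = q ^ card A * bern_exp q V (\<lambda>S. f (S - A))"
proof -
  have "finite A" using assms finite_subset by auto
  then show ?thesis using assms(2)
  proof (induction A arbitrary: f rule: finite_induct)
    case empty
    then show ?case by simp
  next
    case (insert a A)
    define g where "g S = of_bool (a \<in> S) * f (S - {a})" for S
    have d: "S - insert a A = S - A - {a}" for S by auto
    have "bern_exp q V (\<lambda>S. of_bool (insert a A \<subseteq> S) * f (S - insert a A)) =
        bern_exp q V (\<lambda>S. of_bool (A \<subseteq> S) * g (S - A))"
      using insert by (intro bern_exp_cong) (auto simp: g_def d)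
    also have "\<dots> = q ^ card A * bern_exp q V (\<lambda>S. g (S - A))"
      using insert by auto
    also have "bern_exp q V (\<lambda>S. g (S - A)) = bern_exp q V (\<lambda>S. of_bool (a \<in> S) * f (S - insert a A))"
      using insert by (intro bern_exp_cong) (auto simp: g_def d)
    also have "\<dots> = q * bern_exp q V (\<lambda>S. f (S - insert a A))"
      using insert assms(1) by (intro bern_exp_mem) (auto simp: insert_Diff_if)
    finally show ?case using insert by simp
  qed
qed

lemma bern_exp_of_bool_superset:
  assumes "finite V" "A \<subseteq> V"
  shows "bern_exp q V (\<lambda>S. of_bool (A \<subseteq> S)) = q ^ card A"
  using bern_exp_superset[OF assms, of q "\<lambda>_. 1"] assms(1) by (simp add: bern_exp_const)


section \<open>Moments of the edge count\<close>

definition edges_in :: "nat set set \<Rightarrow> nat set \<Rightarrow> nat" where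
  "edges_in H S = card {e \<in> H. e \<subseteq> S}"

text \<open>Ordered pairs, so in a simple graph this is twice the number of paths with two edges.
  The ordering matches the double sum over edges in the second moment.\<close>

definition touching_pairs :: "nat set set \<Rightarrow> (nat set \<times> nat set) set" where
  "touching_pairs H = {(e, f) \<in> H \<times> H. e \<noteq> f \<and> e \<inter> f \<noteq> {}}"

lemma simple_graph_finite: "simple_graph n H \<Longrightarrow> finite H"
  unfolding simple_graph_def by (rule finite_subset[of _ "Pow {1..n}"]) auto

lemma simple_graph_edge:
  assumes "simple_graph n H" "e \<in> H"
  shows "e \<subseteq> {1..n}" "card e = 2" "finite e"
  using assms unfolding simple_graph_def by (auto intro: finite_subset)

lemma simple_graph_subset: "simple_graph n E \<Longrightarrow> H \<subseteq> E \<Longrightarrow> simple_graph n H"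
  unfolding simple_graph_def by auto

lemma real_edges_in: "finite H \<Longrightarrow> real (edges_in H S) = (\<Sum>e\<in>H. of_bool (e \<subseteq> S))"
  unfolding edges_in_def by (simp add: of_bool_def sum.If_cases Collect_conj_eq Int_commute)

lemma finite_touching_pairs: "finite H \<Longrightarrow> finite (touching_pairs H)"
  unfolding touching_pairs_def by (rule finite_subset[of _ "H \<times> H"]) auto

lemma card_touching_pairs:
  assumes "finite H"
  shows "real (card (touching_pairs H)) = (\<Sum>e\<in>H. \<Sum>f\<in>H. of_bool (e \<noteq> f \<and> e \<inter> f \<noteq> {}))"
proof -
  have "touching_pairs H = {z \<in> H \<times> H. fst z \<noteq> snd z \<and> fst z \<inter> snd z \<noteq> {}}"
    unfolding touching_pairs_def by auto
  then have "real (card (touching_pairs H)) = (\<Sum>z\<in>H \<times> H. of_bool (fst z \<noteq> snd z \<and> fst z \<inter> snd z \<noteq> {}))"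
    using assms by (simp add: of_bool_def sum.If_cases Collect_conj_eq Int_commute)
  then show ?thesis by (simp add: sum.cartesian_product case_prod_beta)
qed

lemma touching_pairs_mono: "finite E \<Longrightarrow> H \<subseteq> E \<Longrightarrow> card (touching_pairs H) \<le> card (touching_pairs E)"
  by (intro card_mono finite_touching_pairs) (auto simp: touching_pairs_def)

lemma card_two_Un_int: 
  assumes "card e = 2" "card f = 2" "e \<noteq> f" "e \<inter> f \<noteq> {}"
  shows "card (e \<inter> f) = 1" "card (e \<union> f) = 3"
proof -
  have fin: "finite e" "finite f" using assms by (auto intro: card_ge_0_finite)
  have "card (e \<inter> f) \<noteq> 0" using assms fin by auto
  moreover have "card (e \<inter> f) < 2"
    using assms fin by (metis card_mono card_subset_eq inf_le1 inf_le2 le_neq_implies_less)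
  ultimately show 1: "card (e \<inter> f) = 1" by linarith
  show "card (e \<union> f) = 3" using card_Un_Int[OF fin] assms 1 by simp
qed

lemma bern_exp_edges_in:
  assumes "simple_graph n H"
  shows "bern_exp q {1..n} (\<lambda>S. real (edges_in H S)) = q\<^sup>2 * card H"
proof -
  have "bern_exp q {1..n} (\<lambda>S. real (edges_in H S)) = (\<Sum>e\<in>H. bern_exp q {1..n} (\<lambda>S. of_bool (e \<subseteq> S)))"
    using simple_graph_finite[OF assms] by (simp add: real_edges_in bern_exp_sum del: sum_of_bool_eq)
  also have "\<dots> = (\<Sum>e\<in>H. q\<^sup>2)"
    using simple_graph_edge[OF assms] by (intro sum.cong) (auto simp: bern_exp_of_bool_superset)
  finally show ?thesis by simp
qed

text \<open>The square is a sum over ordered pairs of edges, each contributing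
  \<open>q ^ card (e \<union> f)\<close>. The union has 2, 3 or 4 vertices for equal, touching and
  disjoint pairs respectively.\<close>

lemma bern_exp_edges_in_sq:
  assumes "simple_graph n H"
  shows "bern_exp q {1..n} (\<lambda>S. (real (edges_in H S))\<^sup>2) =
    q\<^sup>2 * card H + q ^ 3 * card (touching_pairs H) +
    q ^ 4 * ((real (card H))\<^sup>2 - card H - card (touching_pairs H))"
proof -
  note fin = simple_graph_finite[OF assms] 
  note edge = simple_graph_edge[OF assms]
  have "bern_exp q {1..n} (\<lambda>S. (real (edges_in H S))\<^sup>2) =
      bern_exp q {1..n} (\<lambda>S. \<Sum>e\<in>H. \<Sum>f\<in>H. of_bool (e \<union> f \<subseteq> S))"
    using fin by (intro bern_exp_cong) (simp add: real_edges_in power2_eq_square sum_product del: sum_of_bool_eq flip: of_bool_conj)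
  also have "\<dots> = (\<Sum>e\<in>H. \<Sum>f\<in>H. q ^ card (e \<union> f))"
    unfolding bern_exp_sum using edge by (intro sum.cong refl bern_exp_of_bool_superset) auto
  also have "\<dots> = (\<Sum>e\<in>H. \<Sum>f\<in>H. q ^ 4 + of_bool (e = f) * (q\<^sup>2 - q ^ 4) +
      of_bool (e \<noteq> f \<and> e \<inter> f \<noteq> {}) * (q ^ 3 - q ^ 4))"
  proof (intro sum.cong refl, goal_cases)
    case (1 e f)
    consider "e = f" | "e \<noteq> f" "e \<inter> f = {}" | "e \<noteq> f" "e \<inter> f \<noteq> {}" by blast
    then show ?case
    proof cases
      case 2
      then have "card (e \<union> f) = 4" using 1 edge by (subst card_Un_disjoint) auto
      then show ?thesis using 2 by simp
    next
      case 3
      then show ?thesis using card_two_Un_int(2)[of e f] 1 edge by simp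
    qed (use 1 edge in simp)
  qed
  also have "\<dots> = q ^ 4 * (real (card H))\<^sup>2 + card H * (q\<^sup>2 - q ^ 4) +
      card (touching_pairs H) * (q ^ 3 - q ^ 4)"
    using fin by (simp add: sum.distrib card_touching_pairs flip: sum_distrib_right)
       (simp add: power2_eq_square of_bool_def algebra_simps)
  finally show ?thesis by (simp add: algebra_simps)
qed

text \<open>The square of the mean cancels the \<open>q ^ 4\<close> contribution of all pairs. For
  \<open>0 \<le> q \<le> 1\<close> both remaining terms are nonnegative, which is what lets the
  variance control the touching pairs.\<close>

lemma variance_edges_in:
  assumes "simple_graph n H"
  shows "bern_exp q {1..n} (\<lambda>S. (real (edges_in H S))\<^sup>2) - (bern_exp q {1..n} (\<lambda>S. real (edges_in H S)))\<^sup>2 =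
    (1 - q\<^sup>2) * (q\<^sup>2 * card H) + (1 - q) * (q ^ 3 * card (touching_pairs H))"
  unfolding bern_exp_edges_in[OF assms] bern_exp_edges_in_sq[OF assms]
  by (simp add: algebra_simps power2_eq_square power3_eq_cube power4_eq_xxxx)

text \<open>The edges inside \<open>S\<close> are \<open>e\<close> itself, those touching
  \<open>e\<close>, and those avoiding \<open>e\<close>. The last class depends only on
  \<open>S - e\<close>, hence is independent of \<open>e\<close>.\<close>

lemma edges_in_split:
  assumes H: "simple_graph n H" "e \<in> H" "e \<subseteq> S"
  shows "real (edges_in H S) =
    1 + (\<Sum>f\<in>H. of_bool (e \<noteq> f \<and> e \<inter> f \<noteq> {} \<and> f \<subseteq> S)) + real (edges_in H (S - e))"
proof -
  note fin = simple_graph_finite[OF H(1)]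
  \<comment> \<open>Nonemptiness keeps \<open>e\<close> out of the third class,
    \<open>f \<subseteq> S - e\<close>.\<close>
  have ne: "e \<noteq> {}" using simple_graph_edge(2)[OF H(1,2)] by auto
  have "real (edges_in H S) = (\<Sum>f\<in>H. of_bool (e = f) +
      of_bool (e \<noteq> f \<and> e \<inter> f \<noteq> {} \<and> f \<subseteq> S) + of_bool (f \<subseteq> S - e))"
    unfolding real_edges_in[OF fin] using H(3) ne by (intro sum.cong refl) (auto simp: of_bool_def)
  also have "\<dots> = (\<Sum>f\<in>H. of_bool (e = f)) + (\<Sum>f\<in>H. of_bool (e \<noteq> f \<and> e \<inter> f \<noteq> {} \<and> f \<subseteq> S)) +
      real (edges_in H (S - e))"
    unfolding real_edges_in[OF fin] sum.distrib by (rule refl)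
  also have "(\<Sum>f\<in>H. of_bool (e = f)) = (1::real)"
    using fin H(2) by (simp add: of_bool_def)
  finally show ?thesis .
qed

lemma edges_in_mono: "finite H \<Longrightarrow> S \<subseteq> S' \<Longrightarrow> edges_in H S \<le> edges_in H S'"
  unfolding edges_in_def by (intro card_mono) auto

lemma edges_in_mono_graph: "finite H' \<Longrightarrow> H \<subseteq> H' \<Longrightarrow> edges_in H S \<le> edges_in H' S"
  unfolding edges_in_def by (intro card_mono) auto

lemma edges_in_times:
  "finite H \<Longrightarrow> real (edges_in H S) * x = (\<Sum>e\<in>H. of_bool (e \<subseteq> S) * x)"
  by (simp add: real_edges_in sum_distrib_right del: sum_of_bool_eq)

text \<open>
  Given that \<open>e\<close> is present, the count is one plus the count off \<open>e\<close> unless another edge touching \<open>e\<close>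
  is present; the count off \<open>e\<close> is independent of \<open>e\<close> and agrees with the full count unless some
  edge touching \<open>e\<close> is present.
\<close>

lemma poisson_recursion_error:
  fixes q :: real
  assumes H: "simple_graph n H" and q: "0 \<le> q" "q \<le> 1"
  defines "Q \<equiv> \<lambda>k. bern_exp q {1..n} (\<lambda>S. of_bool (edges_in H S = k))"
  shows "\<bar>real (Suc k) * Q (Suc k) - q\<^sup>2 * card H * Q k\<bar> \<le>
    2 * (q ^ 3 * card (touching_pairs H)) + q ^ 4 * card H"
proof -
  note fin = simple_graph_finite[OF H]
  note edge = simple_graph_edge[OF H]
  define V where "V = {1..n}"
  have V: "finite V" by (simp add: V_def)
  define N :: "nat set \<Rightarrow> real" where "N e = (\<Sum>f\<in>H. of_bool (e \<noteq> f \<and> e \<inter> f \<noteq> {}))" for e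
  define a where "a e = bern_exp q V (\<lambda>S. of_bool (e \<subseteq> S) * of_bool (edges_in H S = Suc k))" for e
  have N0: "N e \<ge> 0" for e unfolding N_def by (intro sum_nonneg) auto
  have Q1: "real (Suc k) * Q (Suc k) = (\<Sum>e\<in>H. a e)"
  proof -
    have "real (Suc k) * Q (Suc k) = bern_exp q V (\<lambda>S. real (edges_in H S) * of_bool (edges_in H S = Suc k))"
      unfolding Q_def V_def bern_exp_cmult[symmetric] by (rule bern_exp_cong) auto
    then show ?thesis unfolding a_def by (simp add: edges_in_times[OF fin] bern_exp_sum)
  qed
  have bound: "\<bar>a e - q\<^sup>2 * Q k\<bar> \<le> q ^ 3 * N e + q ^ 4 * (N e + 1)" if e: "e \<in> H" for e
  proof -
    have eV: "e \<subseteq> V" "card e = 2" using edge[OF e] by (auto simp: V_def)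
    define b where "b = bern_exp q V (\<lambda>S. of_bool (edges_in H (S - e) = k))"
    \<comment> \<open>With \<open>e\<close> present the two indicators differ only if some
      \<open>f\<close> touching \<open>e\<close> is present too; such a union has three vertices,
      whence \<open>q ^ 3\<close>.\<close>
    have "\<bar>a e - bern_exp q V (\<lambda>S. of_bool (e \<subseteq> S) * of_bool (edges_in H (S - e) = k))\<bar>
        \<le> bern_exp q V (\<lambda>S. \<Sum>f\<in>H. of_bool (e \<noteq> f \<and> e \<inter> f \<noteq> {}) * of_bool (e \<union> f \<subseteq> S))"
      unfolding a_def
    proof (rule bern_exp_abs_diff_le[OF q])
      fix S
      show "\<bar>of_bool (e \<subseteq> S) * of_bool (edges_in H S = Suc k) -
          of_bool (e \<subseteq> S) * of_bool (edges_in H (S - e) = k)\<bar>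
        \<le> (\<Sum>f\<in>H. of_bool (e \<noteq> f \<and> e \<inter> f \<noteq> {}) * of_bool (e \<union> f \<subseteq> S) :: real)" (is "?l \<le> ?r")
      proof (cases "e \<subseteq> S")
        case True
        have "?r = (\<Sum>f\<in>H. of_bool (e \<noteq> f \<and> e \<inter> f \<noteq> {} \<and> f \<subseteq> S))"
          using True by (intro sum.cong) auto
        also have "\<dots> = real (card {f \<in> H. e \<noteq> f \<and> e \<inter> f \<noteq> {} \<and> f \<subseteq> S})" (is "_ = real ?m")
          using fin by (simp add: Int_def)
        finally have m: "?r = real ?m" .
        have "real (edges_in H S) = real (1 + ?m + edges_in H (S - e))"
          using edges_in_split[OF H e True] fin by (simp add: Int_def)
        then have "edges_in H S = 1 + ?m + edges_in H (S - e)" unfolding of_nat_eq_iff .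
        then show ?thesis unfolding m by (cases ?m) (auto simp: of_bool_def simp del: card_eq_0_iff)
      next
        case False
        then show ?thesis by (auto intro!: sum_nonneg)
      qed
    qed
    also have "\<dots> = (\<Sum>f\<in>H. of_bool (e \<noteq> f \<and> e \<inter> f \<noteq> {}) * q ^ card (e \<union> f))"
      unfolding bern_exp_sum bern_exp_cmult using e edge V
      by (intro sum.cong refl arg_cong2[of _ _ _ _ "(*)"] bern_exp_of_bool_superset) (auto simp: V_def)
    also have "\<dots> = (\<Sum>f\<in>H. of_bool (e \<noteq> f \<and> e \<inter> f \<noteq> {}) * q ^ 3)"
      using edge[OF e] edge by (intro sum.cong refl) (auto simp: card_two_Un_int of_bool_def)
    also have "\<dots> = q ^ 3 * N e" unfolding N_def by (simp add: sum_distrib_left mult.commute del: sum_of_bool_eq)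
    also have "bern_exp q V (\<lambda>S. of_bool (e \<subseteq> S) * of_bool (edges_in H (S - e) = k)) = q\<^sup>2 * b"
      unfolding b_def using bern_exp_superset[OF V eV(1), of q "\<lambda>S. of_bool (edges_in H S = k)"] eV by simp
    finally have 1: "\<bar>a e - q\<^sup>2 * b\<bar> \<le> q ^ 3 * N e" .
    \<comment> \<open>No edge is forced to be present here, so each edge meeting \<open>e\<close>
      costs only \<open>q\<^sup>2\<close>; \<open>e\<close> is one of them, whence
      \<open>N e + 1\<close>. The factor \<open>q\<^sup>2\<close> for \<open>e\<close> itself then
      brings the order to four.\<close>
    have "\<bar>b - Q k\<bar> \<le> bern_exp q V (\<lambda>S. \<Sum>f\<in>H. of_bool (e \<inter> f \<noteq> {}) * of_bool (f \<subseteq> S))"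
      unfolding b_def Q_def V_def[symmetric]
    proof (rule bern_exp_abs_diff_le[OF q])
      fix S
      have "real (edges_in H S) = (\<Sum>f\<in>H. of_bool (e \<inter> f \<noteq> {}) * of_bool (f \<subseteq> S) + of_bool (f \<subseteq> S - e))"
        unfolding real_edges_in[OF fin] by (intro sum.cong refl) auto
      then have "real (edges_in H S) = (\<Sum>f\<in>H. of_bool (e \<inter> f \<noteq> {}) * of_bool (f \<subseteq> S)) + real (edges_in H (S - e))"
        unfolding real_edges_in[OF fin] sum.distrib .
      moreover have m: "(\<Sum>f\<in>H. of_bool (e \<inter> f \<noteq> {}) * of_bool (f \<subseteq> S)) =
          real (card {f \<in> H. e \<inter> f \<noteq> {} \<and> f \<subseteq> S})" (is "_ = real ?m")
        using fin by (simp add: Int_def flip: of_bool_conj)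
      ultimately have "real (edges_in H S) = real (?m + edges_in H (S - e))"
        by (simp only: of_nat_add)
      then have "edges_in H S = ?m + edges_in H (S - e)" unfolding of_nat_eq_iff .
      then show "\<bar>of_bool (edges_in H (S - e) = k) - of_bool (edges_in H S = k)\<bar>
        \<le> (\<Sum>f\<in>H. of_bool (e \<inter> f \<noteq> {}) * of_bool (f \<subseteq> S) :: real)"
        unfolding m by (cases ?m) (auto simp: of_bool_def simp del: card_eq_0_iff)
    qed
    also have "\<dots> = (\<Sum>f\<in>H. of_bool (e \<inter> f \<noteq> {}) * q\<^sup>2)"
      unfolding bern_exp_sum bern_exp_cmult using edge V
      by (intro sum.cong refl arg_cong2[of _ _ _ _ "(*)"]) (auto simp: V_def bern_exp_of_bool_superset)
    also have "\<dots> = (\<Sum>f\<in>H. q\<^sup>2 * of_bool (e \<noteq> f \<and> e \<inter> f \<noteq> {}) + q\<^sup>2 * of_bool (e = f))"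
      using eV by (intro sum.cong refl) (auto simp: of_bool_def)
    also have "\<dots> = q\<^sup>2 * (N e + 1)"
      using fin e unfolding N_def sum.distrib sum_distrib_left[symmetric]
      by (simp add: ring_distribs of_bool_def del: sum_of_bool_eq)
    finally have "q\<^sup>2 * \<bar>b - Q k\<bar> \<le> q\<^sup>2 * (q\<^sup>2 * (N e + 1))"
      by (rule mult_left_mono) simp
    then have 2: "\<bar>q\<^sup>2 * b - q\<^sup>2 * Q k\<bar> \<le> q ^ 4 * (N e + 1)"
      by (simp add: abs_mult power2_eq_square power4_eq_xxxx mult.assoc flip: right_diff_distrib)
    show ?thesis using 1 2 by linarith
  qed
  have "\<bar>real (Suc k) * Q (Suc k) - q\<^sup>2 * card H * Q k\<bar> = \<bar>\<Sum>e\<in>H. a e - q\<^sup>2 * Q k\<bar>"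
    unfolding Q1 by (simp add: sum_subtractf mult_ac)
  also have "\<dots> \<le> (\<Sum>e\<in>H. \<bar>a e - q\<^sup>2 * Q k\<bar>)" by (rule sum_abs)
  also have "\<dots> \<le> (\<Sum>e\<in>H. q ^ 3 * N e + q ^ 4 * (N e + 1))"
    by (intro sum_mono bound)
  also have "\<dots> \<le> (\<Sum>e\<in>H. 2 * (q ^ 3 * N e) + q ^ 4)"
  proof (rule sum_mono)
    fix e
    have "q ^ 4 * N e \<le> q ^ 3 * N e"
      using q N0 by (intro mult_right_mono power_decreasing) auto
    then show "q ^ 3 * N e + q ^ 4 * (N e + 1) \<le> 2 * (q ^ 3 * N e) + q ^ 4"
      by (simp add: algebra_simps)
  qed
  also have "\<dots> = 2 * (q ^ 3 * card (touching_pairs H)) + q ^ 4 * card H"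
    unfolding card_touching_pairs[OF fin] N_def by (simp add: sum.distrib sum_distrib_left del: sum_of_bool_eq)
  finally show ?thesis .
qed

section \<open>Bounded degrees and the third moment\<close>

lemma touching_edges_bound:
  fixes B :: real
  assumes H: "simple_graph n H" "e \<in> H" and B: "\<And>u. real (card {f \<in> H. u \<in> f}) \<le> B"
  shows "real (card {f \<in> H. e \<noteq> f \<and> e \<inter> f \<noteq> {}}) \<le> 2 * B"
proof -
  have fin: "finite H" "finite e" "card e = 2"
    using simple_graph_finite[OF H(1)] simple_graph_edge[OF H] by auto
  have "card {f \<in> H. e \<noteq> f \<and> e \<inter> f \<noteq> {}} \<le> card (\<Union>u\<in>e. {f \<in> H. u \<in> f})"
    using fin by (intro card_mono) auto
  also have "\<dots> \<le> (\<Sum>u\<in>e. card {f \<in> H. u \<in> f})"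
    using fin by (intro card_UN_le) auto
  finally have "real (card {f \<in> H. e \<noteq> f \<and> e \<inter> f \<noteq> {}}) \<le> (\<Sum>u\<in>e. real (card {f \<in> H. u \<in> f}))"
    by (simp flip: of_nat_sum)
  also have "\<dots> \<le> (\<Sum>u\<in>e. B)" by (intro sum_mono B)
  finally show ?thesis using fin by simp
qed

lemma touching_pairs_bound:
  fixes B :: real
  assumes H: "simple_graph n H" and B: "\<And>u. real (card {f \<in> H. u \<in> f}) \<le> B"
  shows "real (card (touching_pairs H)) \<le> card H * (2 * B)"
proof -
  note fin = simple_graph_finite[OF H]
  have "real (card (touching_pairs H)) = (\<Sum>e\<in>H. real (card {f \<in> H. e \<noteq> f \<and> e \<inter> f \<noteq> {}}))"
    unfolding card_touching_pairs[OF fin]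
    using fin by (intro sum.cong) (auto simp: Int_def)
  also have "\<dots> \<le> (\<Sum>e\<in>H. 2 * B)"
    by (intro sum_mono touching_edges_bound[OF H _ B])
  finally show ?thesis by simp
qed

text \<open>One factor of the cube is expanded into a sum over edges \<open>e\<close>. Given
  \<open>e\<close>, the count is \<open>1 + Z + Y\<close> with \<open>Z\<close> the touching edges
  and \<open>Y\<close> independent of \<open>e\<close>, and the square of this sum is at most three
  times the sum of squares. The term with \<open>Z\<close> is bounded through \<open>B\<close>; only
  \<open>q * B\<close> enters, which is bounded when degrees are of order
  \<open>1 / q\<close>.\<close>

lemma bern_exp_edges_in_cube:
  fixes q B :: real
  assumes H: "simple_graph n H" and q: "0 \<le> q" "q \<le> 1" and B: "\<And>u. real (card {f \<in> H. u \<in> f}) \<le> B"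
  defines "m \<equiv> \<lambda>j. bern_exp q {1..n} (\<lambda>S. real (edges_in H S) ^ j)"
  shows "m 3 \<le> 3 * (q\<^sup>2 * card H) * (1 + 6 * (q * B) + 4 * (q * B)\<^sup>2 + m 2)"
proof -
  note fin = simple_graph_finite[OF H]
  note edge = simple_graph_edge[OF H]
  define V where "V = {1..n}"
  have V: "finite V" by (simp add: V_def)
  have B0: "0 \<le> B" using B[of 0] by (meson of_nat_0_le_iff order_trans)
  have bound: "bern_exp q V (\<lambda>S. of_bool (e \<subseteq> S) * real (edges_in H S) ^ 2) \<le>
      3 * (q\<^sup>2 + q\<^sup>2 * (6 * (q * B) + 4 * (q * B)\<^sup>2) + q\<^sup>2 * m 2)" if e: "e \<in> H" for e
  proof -
    have eV: "e \<subseteq> V" "card e = 2" "finite e" using edge[OF e] by (auto simp: V_def)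
    define F where "F = {f \<in> H. e \<noteq> f \<and> e \<inter> f \<noteq> {}}"
    have F: "finite F" "F \<subseteq> H" using fin by (auto simp: F_def)
    have FV: "f \<subseteq> V" if "f \<in> F" for f using edge(1)[of f] that F by (auto simp: V_def)
    have cF: "real (card F) \<le> 2 * B"
      unfolding F_def by (rule touching_edges_bound[OF H e B])
    define Z :: "nat set \<Rightarrow> real" where "Z S = (\<Sum>f\<in>F. of_bool (f \<subseteq> S))" for S
    have Z: "(\<Sum>f\<in>H. of_bool (e \<noteq> f \<and> e \<inter> f \<noteq> {} \<and> f \<subseteq> S)) = Z S" for S
      unfolding Z_def F_def using fin by (intro sum.mono_neutral_cong_right) auto
    have "bern_exp q V (\<lambda>S. of_bool (e \<subseteq> S) * real (edges_in H S) ^ 2) \<le>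
       bern_exp q V (\<lambda>S. 3 * (of_bool (e \<subseteq> S) + of_bool (e \<subseteq> S) * (Z S)\<^sup>2 +
         of_bool (e \<subseteq> S) * real (edges_in H (S - e)) ^ 2))"
    proof (rule bern_exp_mono[OF q])
      fix S
      \<comment> \<open>The difference of the two sides is the sum of the squares of the three
        pairwise differences of 1, \<open>a\<close> and \<open>b\<close>.\<close>
      have sq: "(1 + a + b)\<^sup>2 \<le> 3 * (1 + a\<^sup>2 + b\<^sup>2)" for a b :: real
        using sum_power2_ge_zero[of "1 - a" "1 - b"] zero_le_power2[of "a - b"]
        by (simp add: power2_eq_square algebra_simps)
      show "of_bool (e \<subseteq> S) * real (edges_in H S) ^ 2 \<le> 3 * (of_bool (e \<subseteq> S) + of_bool (e \<subseteq> S) * (Z S)\<^sup>2 +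
         of_bool (e \<subseteq> S) * real (edges_in H (S - e)) ^ 2)"
        using sq[of "Z S" "real (edges_in H (S - e))"] edges_in_split[OF H e, of S, unfolded Z]
        by (cases "e \<subseteq> S") auto
    qed
    also have "\<dots> = 3 * (q\<^sup>2 + bern_exp q V (\<lambda>S. of_bool (e \<subseteq> S) * (Z S)\<^sup>2) +
        q\<^sup>2 * bern_exp q V (\<lambda>S. real (edges_in H (S - e)) ^ 2))"
      using V eV bern_exp_superset[OF V eV(1), of q "\<lambda>S. real (edges_in H S) ^ 2"]
      by (simp add: bern_exp_add bern_exp_cmult bern_exp_of_bool_superset)
    also have "bern_exp q V (\<lambda>S. real (edges_in H (S - e)) ^ 2) \<le> m 2"
      unfolding m_def V_def[symmetric]
      by (rule bern_exp_mono[OF q]) (use fin in \<open>auto intro!: power_mono edges_in_mono\<close>)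
    also have "bern_exp q V (\<lambda>S. of_bool (e \<subseteq> S) * (Z S)\<^sup>2) =
        bern_exp q V (\<lambda>S. \<Sum>f\<in>F. \<Sum>g\<in>F. of_bool (e \<union> f \<union> g \<subseteq> S))"
      unfolding Z_def power2_eq_square
      by (intro bern_exp_cong) (simp add: sum_product del: sum_of_bool_eq flip: of_bool_conj)
    also have "\<dots> = (\<Sum>f\<in>F. \<Sum>g\<in>F. q ^ card (e \<union> f \<union> g))"
      unfolding bern_exp_sum using eV FV by (intro sum.cong refl bern_exp_of_bool_superset V) auto
    \<comment> \<open>Since \<open>e \<union> f\<close> has three vertices, \<open>g\<close> either
      lies inside it or adds a vertex. The first case occurs for at most three edges
      \<open>g\<close>, the pairs in a three-element set; the second has probability at most
      \<open>q ^ 4\<close>.\<close>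
    also have "\<dots> \<le> (\<Sum>f\<in>F. \<Sum>g\<in>F. q ^ 4 + of_bool (g \<subseteq> e \<union> f) * q ^ 3)"
    proof (intro sum_mono)
      fix f g assume fg: "f \<in> F" "g \<in> F"
      then have f: "card f = 2" "finite f" "finite g" using edge F by auto
      have 3: "card (e \<union> f) = 3" using fg f eV by (intro card_two_Un_int) (auto simp: F_def)
      show "q ^ card (e \<union> f \<union> g) \<le> q ^ 4 + of_bool (g \<subseteq> e \<union> f) * q ^ 3"
      proof (cases "g \<subseteq> e \<union> f")
        case True
        then have "e \<union> f \<union> g = e \<union> f" by auto
        then show ?thesis using 3 True q by simp
      next
        case False
        then have "card (e \<union> f) < card (e \<union> f \<union> g)"
          using f eV by (intro psubset_card_mono) auto
        then show ?thesis using 3 False q by (auto intro: power_decreasing)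
      qed
    qed
    also have "\<dots> = (\<Sum>f\<in>F. card F * q ^ 4 + card {g \<in> F. g \<subseteq> e \<union> f} * q ^ 3)"
      using F by (intro sum.cong refl) (simp add: sum.distrib Int_def flip: sum_distrib_right)
    also have "\<dots> \<le> (\<Sum>f\<in>F. (2 * B) * q ^ 4 + 3 * q ^ 3)"
    proof (intro sum_mono add_mono mult_right_mono cF)
      fix f assume f: "f \<in> F"
      then have fc: "card f = 2" "finite f" using edge F by auto
      have 3: "card (e \<union> f) = 3" using f fc eV by (intro card_two_Un_int) (auto simp: F_def)
      have "card {g \<in> F. g \<subseteq> e \<union> f} \<le> card {g. g \<subseteq> e \<union> f \<and> card g = 2}"
        using F edge fc eV by (intro card_mono) auto
      also have "\<dots> = 3 choose 2" using n_subsets[of "e \<union> f" 2] fc eV 3 by simp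
      also have "\<dots> = 3" by (simp add: choose_two)
      finally show "real (card {g \<in> F. g \<subseteq> e \<union> f}) \<le> 3" by simp
    qed (use q in auto)
    also have "\<dots> = card F * ((2 * B) * q ^ 4 + 3 * q ^ 3)" by simp
    also have "\<dots> \<le> (2 * B) * ((2 * B) * q ^ 4 + 3 * q ^ 3)"
      using q B0 by (intro mult_right_mono cF) auto
    also have "\<dots> = q\<^sup>2 * (6 * (q * B) + 4 * (q * B)\<^sup>2)"
      by (simp add: power2_eq_square power3_eq_cube power4_eq_xxxx algebra_simps)
    finally show ?thesis using q by (simp add: mult_left_mono)
  qed
  have "m 3 = (\<Sum>e\<in>H. bern_exp q V (\<lambda>S. of_bool (e \<subseteq> S) * real (edges_in H S) ^ 2))"
    unfolding m_def V_def[symmetric] bern_exp_sum[symmetric] edges_in_times[OF fin, symmetric]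
    by (simp add: power3_eq_cube power2_eq_square mult_ac)
  also have "\<dots> \<le> (\<Sum>e\<in>H. 3 * (q\<^sup>2 + q\<^sup>2 * (6 * (q * B) + 4 * (q * B)\<^sup>2) + q\<^sup>2 * m 2))"
    by (intro sum_mono bound)
  finally show ?thesis by (simp add: algebra_simps)
qed

section \<open>From Bernoulli variables to active sets\<close>

lemma measure_bernoulli_law:
  assumes "0 \<le> q" "q \<le> 1"
  shows "measure (bernoulli_law q) {1} = q" "measure (bernoulli_law q) (- {1}) = 1 - q"
    "measure (bernoulli_law q) {0, 1} = 1"
proof -
  have *: "measure (bernoulli_law q) B = measure_pmf.prob (bernoulli_pmf q) {b. of_bool b \<in> B}"
    if "B \<in> sets borel" for B
    unfolding bernoulli_law_def using that by (subst measure_distr) (auto simp: vimage_def)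
  have "{b. of_bool b \<in> {1::real}} = {True}" "{b. of_bool b \<in> - {1::real}} = {False}"
      "{b. of_bool b \<in> {0, 1::real}} = UNIV"
    by auto
  then show "measure (bernoulli_law q) {1} = q" "measure (bernoulli_law q) (- {1}) = 1 - q"
    "measure (bernoulli_law q) {0, 1} = 1"
    using assms by (simp_all add: * measure_pmf_single)
qed

context prob_space
begin

text \<open>The events \<open>Ev S\<close> split the space according to the exact active set, and
  each is an intersection of independent events, one per vertex. Inactive is taken to mean different
  from 1 rather than equal to 0, so that the splitting holds everywhere and not just almost
  surely.\<close>

lemma bernoulli_active_expectation:
  assumes V: "finite V" "V \<noteq> {}"
    and indep: "indep_vars (\<lambda>_. borel) X V"
    and law: "\<And>u. u \<in> V \<Longrightarrow> distr M borel (X u) = bernoulli_law q"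
    and q: "0 \<le> q" "q \<le> 1"
  shows "expectation (\<lambda>\<omega>. g {u \<in> V. X u \<omega> = 1}) = bern_exp q V g"
proof -
  have meas[measurable]: "X u \<in> borel_measurable M" if "u \<in> V" for u
    using indep that unfolding indep_vars_def2 by auto
  have prob_X: "prob (X u -` B \<inter> space M) = measure (bernoulli_law q) B" if "u \<in> V" "B \<in> sets borel" for u B
    using measure_distr[OF meas[OF that(1)] that(2)] law[OF that(1)] by simp
  define Ev where "Ev S = {\<omega> \<in> space M. {u \<in> V. X u \<omega> = 1} = S}" for S
  have Ev_sets: "Ev S \<in> events" and prob_Ev: "prob (Ev S) = q ^ card S * (1 - q) ^ card (V - S)"
    if S: "S \<subseteq> V" for S
  proof -
    define A where "A u = X u -` (if u \<in> S then {1} else - {1}) \<inter> space M" for u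
    have Ev: "Ev S = (\<Inter>u\<in>V. A u)"
      using S V unfolding Ev_def A_def by (auto split: if_splits)
    have "A u \<in> events" if "u \<in> V" for u
      unfolding A_def using meas[OF that] by (intro measurable_sets[OF meas[OF that]]) auto
    then show "Ev S \<in> events" unfolding Ev using V by (intro sets.finite_INT) auto
    have "prob (Ev S) = (\<Prod>u\<in>V. prob (A u))"
      unfolding Ev
    proof (rule indep_setsD)
      show "indep_sets (\<lambda>i. { X i -` A \<inter> space M | A. A \<in> sets borel}) V"
        using indep unfolding indep_vars_def2 by auto
      show "\<forall>j\<in>V. A j \<in> {X j -` A \<inter> space M |A. A \<in> sets borel}"
      proof
        fix j
        show "A j \<in> {X j -` A \<inter> space M |A. A \<in> sets borel}"
          unfolding A_def by (rule CollectI, rule exI[of _ "if j \<in> S then {1} else - {1}"]) auto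
      qed
    qed (use V in auto)
    also have "\<dots> = (\<Prod>u\<in>V. if u \<in> S then q else 1 - q)"
      unfolding A_def by (intro prod.cong refl) (auto simp: prob_X measure_bernoulli_law[OF q])
    also have "\<dots> = q ^ card S * (1 - q) ^ card (V - S)"
      using V S by (simp add: prod.If_cases Int_absorb1 Diff_eq)
    finally show "prob (Ev S) = q ^ card S * (1 - q) ^ card (V - S)" .
  qed
  have "expectation (\<lambda>\<omega>. g {u \<in> V. X u \<omega> = 1}) = expectation (\<lambda>\<omega>. \<Sum>S\<in>Pow V. g S * indicator (Ev S) \<omega>)"
  proof (rule Bochner_Integration.integral_cong[OF refl])
    fix \<omega> assume \<omega>: "\<omega> \<in> space M"
    have "(\<Sum>S\<in>Pow V. g S * indicator (Ev S) \<omega>) = (\<Sum>S\<in>Pow V. if {u \<in> V. X u \<omega> = 1} = S then g S else 0)"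
      using \<omega> by (intro sum.cong) (auto simp: Ev_def indicator_def)
    then show "g {u \<in> V. X u \<omega> = 1} = (\<Sum>S\<in>Pow V. g S * indicator (Ev S) \<omega>)"
      using V by simp
  qed
  also have "\<dots> = (\<Sum>S\<in>Pow V. g S * prob (Ev S))"
    using Ev_sets by (subst Bochner_Integration.integral_sum)
      (auto intro!: integrable_mult_right integrable_real_indicator simp: less_top[symmetric] emeasure_finite)
  also have "\<dots> = bern_exp q V g"
    unfolding bern_exp_def by (intro sum.cong) (auto simp: prob_Ev)
  finally show ?thesis .
qed

lemma bernoulli_AE:
  assumes V: "finite V"
    and meas: "\<And>u. u \<in> V \<Longrightarrow> X u \<in> borel_measurable M"
    and law: "\<And>u. u \<in> V \<Longrightarrow> distr M borel (X u) = bernoulli_law q"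
    and q: "0 \<le> q" "q \<le> 1"
  shows "AE \<omega> in M. \<forall>u\<in>V. X u \<omega> \<in> {0, 1}"
proof (rule AE_finite_allI[OF V])
  fix u assume u: "u \<in> V"
  have "prob (X u -` {0, 1} \<inter> space M) = 1"
    using measure_distr[OF meas[OF u], of "{0, 1}"] law[OF u] measure_bernoulli_law(3)[OF q] by simp
  moreover have "X u -` {0, 1} \<inter> space M \<in> events"
    by (rule measurable_sets[OF meas[OF u]]) auto
  ultimately have "AE \<omega> in M. \<omega> \<in> X u -` {0, 1} \<inter> space M"
    by (simp add: prob_eq_1)
  then show "AE \<omega> in M. X u \<omega> \<in> {0, 1}"
    by eventually_elim auto
qed

end

section \<open>Edge sums as double sums over vertices, and the two statistics as edge counts\<close>

lemma sum_adj:
  fixes h :: "nat set \<Rightarrow> real"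
  assumes "simple_graph n E"
  shows "(\<Sum>u\<in>{1..n}. \<Sum>v\<in>{1..n}. adj E u v * h {u, v}) = 2 * (\<Sum>e\<in>E. h e)"
proof -
  note fin = simple_graph_finite[OF assms] 
  have "(\<Sum>u\<in>{1..n}. \<Sum>v\<in>{1..n}. adj E u v * h {u, v}) =
      (\<Sum>u\<in>{1..n}. \<Sum>v\<in>{1..n}. \<Sum>e\<in>E. of_bool (e = {u, v}) * h e)"
  proof (intro sum.cong refl)
    fix u v
    have "(\<Sum>e\<in>E. of_bool (e = {u, v}) * h e) = (\<Sum>e\<in>E. if {u, v} = e then h e else 0)"
      by (intro sum.cong) auto
    then show "adj E u v * h {u, v} = (\<Sum>e\<in>E. of_bool (e = {u, v}) * h e)"
      using fin by (simp add: adj_def)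
  qed
  also have "\<dots> = (\<Sum>e\<in>E. \<Sum>u\<in>{1..n}. \<Sum>v\<in>{1..n}. of_bool (e = {u, v}) * h e)"
    by (subst (2) sum.swap, subst sum.swap) (rule refl)
  also have "\<dots> = (\<Sum>e\<in>E. 2 * h e)"
  proof (intro sum.cong refl)
    fix e assume e: "e \<in> E"
    then obtain a b where ab: "e = {a, b}" "a \<noteq> b"
      using simple_graph_edge(2)[OF assms e] by (auto simp: card_2_iff)
    have ab': "a \<in> {1..n}" "b \<in> {1..n}" using simple_graph_edge(1)[OF assms e] ab by auto
    have "(\<Sum>u\<in>{1..n}. \<Sum>v\<in>{1..n}. of_bool (e = {u, v}) * h e) =
        (\<Sum>u\<in>{1..n}. \<Sum>v\<in>{1..n}. of_bool (u = a) * (of_bool (v = b) * h e) + of_bool (u = b) * (of_bool (v = a) * h e))"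
      using ab by (intro sum.cong refl) (auto simp: of_bool_def doubleton_eq_iff)
    also have "\<dots> = (\<Sum>u\<in>{1..n}. of_bool (u = a) * (\<Sum>v\<in>{1..n}. of_bool (v = b) * h e)) +
        (\<Sum>u\<in>{1..n}. of_bool (u = b) * (\<Sum>v\<in>{1..n}. of_bool (v = a) * h e))"
      by (simp only: sum.distrib sum_distrib_left)
    also have "\<dots> = 2 * h e"
    proof -
      have "(\<Sum>u\<in>{1..n}. of_bool (u = i) * x) = x" if "i \<in> {1..n}" for i and x :: real
      proof -
        have "(\<Sum>u\<in>{1..n}. of_bool (u = i) * x) = (\<Sum>u\<in>{1..n}. if i = u then x else 0)"
          by (intro sum.cong) auto
        then show ?thesis using that by simp
      qed
      then show ?thesis using ab' by simp
    qed
    finally show "(\<Sum>u\<in>{1..n}. \<Sum>v\<in>{1..n}. of_bool (e = {u, v}) * h e) = 2 * h e" .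
  qed
  finally show ?thesis by (simp add: sum_distrib_left)
qed

definition low_edges :: "nat set set \<Rightarrow> real \<Rightarrow> nat set set" where
  "low_edges E t = {e \<in> E. \<forall>u\<in>e. real (deg E u) \<le> t}"

lemma low_edges_subset: "low_edges E t \<subseteq> E"
  unfolding low_edges_def by auto

lemma low_edges_mono: "s \<le> t \<Longrightarrow> low_edges E s \<subseteq> low_edges E t"
  unfolding low_edges_def by force

lemma edge_count_stat_eq:
  assumes E: "simple_graph n E" and x: "\<forall>u\<in>{1..n}. X u \<omega> \<in> {0, 1}"
  shows "edge_count_stat n E X \<omega> = real (edges_in E {u \<in> {1..n}. X u \<omega> = 1})"
proof -
  let ?S = "{u \<in> {1..n}. X u \<omega> = 1}"
  have "(\<Sum>u\<in>{1..n}. \<Sum>v\<in>{1..n}. adj E u v * X u \<omega> * X v \<omega>) =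
      (\<Sum>u\<in>{1..n}. \<Sum>v\<in>{1..n}. adj E u v * of_bool ({u, v} \<subseteq> ?S))"
  proof (intro sum.cong refl, goal_cases)
    case (1 u v)
    then have "X u \<omega> \<in> {0, 1}" "X v \<omega> \<in> {0, 1}" using x by blast+
    then show ?case using 1 by auto
  qed
  also have "\<dots> = 2 * real (edges_in E ?S)"
    unfolding real_edges_in[OF simple_graph_finite[OF E]] by (rule sum_adj[OF E])
  finally show ?thesis by (simp add: edge_count_stat_def)
qed

lemma trunc_edge_stat_eq:
  assumes E: "simple_graph n E" and x: "\<forall>u\<in>{1..n}. X u \<omega> \<in> {0, 1}"
  shows "trunc_edge_stat r E M X \<omega> = real (edges_in (low_edges E (M * r)) {u \<in> {1..n}. X u \<omega> = 1})"
proof -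
  let ?S = "{u \<in> {1..n}. X u \<omega> = 1}"
  note fin = simple_graph_finite[OF E]
  have "(\<Prod>u\<in>e. trunc_var r E M X u \<omega>) = of_bool (e \<in> low_edges E (M * r) \<and> e \<subseteq> ?S)" if e: "e \<in> E" for e
  proof -
    note edge = simple_graph_edge[OF E e]
    have "(\<Prod>u\<in>e. trunc_var r E M X u \<omega>) = (\<Prod>u\<in>e. of_bool (real (deg E u) \<le> M * r \<and> u \<in> ?S))"
    proof (intro prod.cong refl)
      fix u assume "u \<in> e"
      then have "u \<in> {1..n}" using edge by blast
      moreover from this have "X u \<omega> \<in> {0, 1}" using x by blast
      ultimately show "trunc_var r E M X u \<omega> = of_bool (real (deg E u) \<le> M * r \<and> u \<in> ?S)"
        unfolding trunc_var_def by auto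
    qed
    also have "\<dots> = of_bool (\<forall>u\<in>e. real (deg E u) \<le> M * r \<and> u \<in> ?S)"
      using edge(3) by (induction e rule: finite_induct) auto
    also have "\<dots> = of_bool (e \<in> low_edges E (M * r) \<and> e \<subseteq> ?S)"
      using e by (auto simp: low_edges_def intro!: arg_cong[of _ _ of_bool])
    finally show ?thesis .
  qed
  then have "trunc_edge_stat r E M X \<omega> = (\<Sum>e\<in>E. of_bool (e \<in> low_edges E (M * r) \<and> e \<subseteq> ?S))"
    unfolding trunc_edge_stat_def by (intro sum.cong) auto
  also have "\<dots> = (\<Sum>e\<in>low_edges E (M * r). of_bool (e \<subseteq> ?S))"
    using fin low_edges_subset[of E] by (intro sum.mono_neutral_cong_right) auto
  also have "\<dots> = real (edges_in (low_edges E (M * r)) ?S)"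
    using finite_subset[OF low_edges_subset fin] by (simp only: real_edges_in)
  finally show ?thesis .
qed

section \<open>Poisson weights\<close>

text \<open>The explicit formula also covers rate 0, where \<open>0 ^ 0 = 1\<close> makes it the
  point mass at 0.\<close>

definition poisson_weight :: "real \<Rightarrow> nat \<Rightarrow> real" where
  "poisson_weight l k = exp (- l) * (l ^ k / fact k)"

lemma poisson_weight_nonneg: "l \<ge> 0 \<Longrightarrow> poisson_weight l k \<ge> 0"
  unfolding poisson_weight_def by auto

lemma poisson_weight_Suc: "real (Suc k) * poisson_weight l (Suc k) = l * poisson_weight l k"
  unfolding poisson_weight_def fact_Suc power_Suc of_nat_mult by (simp add: field_simps del: of_nat_Suc)

lemma poisson_weight_sums: "poisson_weight l sums 1"
proof -
  have "(\<lambda>k. exp (- l) * (l ^ k / fact k)) sums (exp (- l) * exp l)"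
    using exp_converges[of l] by (intro sums_mult) (simp add: divide_inverse mult.commute)
  then show ?thesis unfolding poisson_weight_def[abs_def] by (simp flip: exp_add)
qed

lemma poisson_weight_sums_mean: "(\<lambda>k. real k * poisson_weight l k) sums l"
proof -
  have "(\<lambda>k. real (Suc k) * poisson_weight l (Suc k)) sums l"
    unfolding poisson_weight_Suc using sums_mult[OF poisson_weight_sums, of l l] by simp
  then show ?thesis by (subst (asm) sums_Suc_iff) simp
qed

text \<open>After a shift of the index one factor \<open>k\<close> is absorbed by the recursion for
  the weights, and the other splits as \<open>k + 1\<close> into mean and total mass.\<close>

lemma poisson_weight_sums_sq: "(\<lambda>k. (real k)\<^sup>2 * poisson_weight l k) sums (l + l\<^sup>2)"
proof -
  have "(\<lambda>k. real (Suc k) * (real (Suc k) * poisson_weight l (Suc k))) sums (l * l + l * 1)"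
    unfolding poisson_weight_Suc
    using sums_add[OF sums_mult[OF poisson_weight_sums_mean, of l l] sums_mult[OF poisson_weight_sums, of l l]]
    by (simp add: algebra_simps)
  then show ?thesis
    by (subst (asm) sums_Suc_iff[of "\<lambda>k. real k * (real k * poisson_weight l k)"]) (simp add: power2_eq_square mult.assoc add.commute)
qed

lemma measure_poisson_law:
  assumes "l \<ge> 0" "B \<in> sets borel" "finite {k. real k \<in> B}"
  shows "measure (poisson_law l) B = (\<Sum>k | real k \<in> B. poisson_weight l k)"
proof (cases "l = 0")
  case True
  have "(\<Sum>k | real k \<in> B. poisson_weight 0 k) = (\<Sum>k | real k \<in> B. of_bool (k = 0))"
    by (intro sum.cong) (auto simp: poisson_weight_def)
  also have "\<dots> = indicator B 0"
    using assms(3) by (simp add: of_bool_def indicator_def)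
  finally show ?thesis using True assms(2) by (simp add: poisson_law_def measure_return)
next
  case False
  then have "measure (poisson_law l) B = measure_pmf.prob (poisson_pmf l) {k. real k \<in> B}"
    using assms by (simp add: poisson_law_def measure_distr vimage_def)
  also have "\<dots> = (\<Sum>k | real k \<in> B. pmf (poisson_pmf l) k)"
    using assms(3) by (rule measure_measure_pmf_finite)
  also have "\<dots> = (\<Sum>k | real k \<in> B. poisson_weight l k)"
    using False assms(1) by (intro sum.cong) (auto simp: poisson_weight_def)
  finally show ?thesis .
qed

lemma finite_real_le: "finite {k. real k \<le> x}"
  by (rule finite_subset[of _ "{..nat \<lfloor>x\<rfloor>}"]) (auto simp: le_nat_floor)

lemma real_distribution_poisson_law: "l \<ge> 0 \<Longrightarrow> real_distribution (poisson_law l)"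
  unfolding poisson_law_def real_distribution_def real_distribution_axioms_def
  by (auto intro!: prob_space_return measure_pmf.prob_space_distr)

text \<open>Half-integers are continuity points of the limit, by parity, and the mass at
  \<open>k\<close> is the difference of the distribution functions at \<open>k + 1/2\<close> and
  \<open>k - 1/2\<close>. Conversely, each value of a distribution function is a finite sum of the
  masses.\<close>

lemma weak_conv_poisson_iff:
  assumes l: "l \<ge> 0"
    and cdf: "\<And>n x. n \<ge> 1 \<Longrightarrow> cdf (\<mu> n) x = (\<Sum>k | real k \<le> x. q n k)"
  shows "weak_conv_m \<mu> (poisson_law l) \<longleftrightarrow> (\<forall>k. (\<lambda>n. q n k) \<longlonglongrightarrow> poisson_weight l k)"
proof -
  interpret L: real_distribution "poisson_law l" by (rule real_distribution_poisson_law[OF l])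
  have cdf_L: "cdf (poisson_law l) x = (\<Sum>k | real k \<le> x. poisson_weight l k)" for x
    unfolding cdf_def2 using measure_poisson_law[OF l, of "{..x}"] finite_real_le by simp
  have ev: "eventually (\<lambda>n::nat. n \<ge> 1) sequentially" by (rule eventually_ge_at_top)
  show ?thesis
  proof (intro iffI allI)
    fix k assume w: "weak_conv_m \<mu> (poisson_law l)"
    have step: "(\<Sum>i | real i \<le> real k + 1/2. w i) - (\<Sum>i | real i \<le> real k - 1/2. w i) = w k" for w :: "nat \<Rightarrow> real"
    proof -
      have "{i. real i \<le> real k + 1/2} = insert k {i. real i \<le> real k - 1/2}"
        by (auto; linarith)
      then show ?thesis using finite_real_le[of "real k - 1/2"] by simp
    qed
    have lim: "(\<lambda>n. cdf (\<mu> n) x) \<longlonglongrightarrow> cdf (poisson_law l) x" if "{i. real i = x} = {}" for x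
    proof -
      have "measure (poisson_law l) {x} = 0"
        using measure_poisson_law[OF l, of "{x}"] that by simp
      then show ?thesis using w L.isCont_cdf unfolding weak_conv_m_def weak_conv_def by auto
    qed
    have "real i \<noteq> real k + 1/2" "real i \<noteq> real k - 1/2" for i
    proof -
      have "real (2 * i) \<noteq> real (2 * k + 1)" "real (2 * i + 1) \<noteq> real (2 * k)"
        unfolding of_nat_eq_iff by presburger+
      then show "real i \<noteq> real k + 1/2" "real i \<noteq> real k - 1/2" by auto
    qed
    then have "{i. real i = real k + 1/2} = {}" "{i. real i = real k - 1/2} = {}" by auto
    then have "(\<lambda>n. cdf (\<mu> n) (real k + 1/2) - cdf (\<mu> n) (real k - 1/2)) \<longlonglongrightarrow> poisson_weight l k"
      using tendsto_diff[OF lim lim, of "real k + 1/2" "real k - 1/2"] by (simp add: cdf_L step)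
    then show "(\<lambda>n. q n k) \<longlonglongrightarrow> poisson_weight l k"
      by (rule Lim_transform_eventually) (use ev in eventually_elim, simp add: cdf step)
  next
    assume q: "\<forall>k. (\<lambda>n. q n k) \<longlonglongrightarrow> poisson_weight l k"
    show "weak_conv_m \<mu> (poisson_law l)"
      unfolding weak_conv_m_def weak_conv_def cdf_L
    proof (intro allI impI)
      fix x
      have "(\<lambda>n. \<Sum>k | real k \<le> x. q n k) \<longlonglongrightarrow> (\<Sum>k | real k \<le> x. poisson_weight l k)"
        using q by (intro tendsto_sum) auto
      then show "(\<lambda>n. cdf (\<mu> n) x) \<longlonglongrightarrow> (\<Sum>k | real k \<le> x. poisson_weight l k)"
        by (rule Lim_transform_eventually) (use ev in eventually_elim, simp add: cdf)
    qed
  qed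
qed

text \<open>The recursion fixes all \<open>q n k\<close> asymptotically as multiples of
  \<open>q n 0\<close>. The partial sums, within \<open>C / K\<close> of 1, then force
  \<open>q n 0\<close> towards \<open>exp (- l)\<close>: without such a tail bound mass could escape
  to infinity.\<close>

lemma poisson_recursion_limit:
  fixes q :: "nat \<Rightarrow> nat \<Rightarrow> real"
  assumes l: "l \<ge> 0"
    and rec: "\<And>k. (\<lambda>n. real (Suc k) * q n (Suc k) - l * q n k) \<longlonglongrightarrow> 0"
    and q0: "eventually (\<lambda>n. \<bar>q n 0\<bar> \<le> 1) sequentially"
    and tight: "\<And>K. K > 0 \<Longrightarrow> eventually (\<lambda>n. \<bar>(\<Sum>k<K. q n k) - 1\<bar> \<le> C / real K) sequentially"
  shows "(\<lambda>n. q n k) \<longlonglongrightarrow> poisson_weight l k"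
proof -
  have d: "(\<lambda>n. q n k - q n 0 * (l ^ k / fact k)) \<longlonglongrightarrow> 0" for k
  proof (induction k)
    case 0
    then show ?case by simp
  next
    case (Suc k)
    have "(\<lambda>n. (1 / real (Suc k)) * (real (Suc k) * q n (Suc k) - l * q n k) +
        (l / real (Suc k)) * (q n k - q n 0 * (l ^ k / fact k))) \<longlonglongrightarrow>
        1 / real (Suc k) * 0 + l / real (Suc k) * 0"
      by (intro tendsto_intros rec Suc)
    moreover have "(1 / real (Suc k)) * (real (Suc k) * q n (Suc k) - l * q n k) +
        (l / real (Suc k)) * (q n k - q n 0 * (l ^ k / fact k)) =
        q n (Suc k) - q n 0 * (l ^ Suc k / fact (Suc k))" for n
      unfolding fact_Suc power_Suc of_nat_mult by (simp add: field_simps del: of_nat_Suc)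
    ultimately show ?case by simp
  qed
  have exp_sums: "(\<lambda>k. l ^ k / fact k) sums exp l"
    using exp_converges[of l] by (simp add: divide_inverse mult.commute)
  have "(\<lambda>n. q n 0) \<longlonglongrightarrow> exp (- l)"
  proof (rule tendstoI)
    fix \<epsilon> :: real assume \<epsilon>: "\<epsilon> > 0"
    have "(\<lambda>K. \<Sum>k<K. l ^ k / fact k) \<longlonglongrightarrow> exp l" using exp_sums by (simp add: sums_def)
    then have 1: "eventually (\<lambda>K. dist (\<Sum>k<K. l ^ k / fact k) (exp l) < \<epsilon> / 3) sequentially"
      using \<epsilon> by (intro tendstoD) auto
    have "(\<lambda>K. C / real K) \<longlonglongrightarrow> 0" by (rule lim_const_over_n)
    then have 2: "eventually (\<lambda>K. C / real K < \<epsilon> / 3) sequentially"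
      using \<epsilon> by (intro order_tendstoD) auto
    obtain K where K: "\<bar>(\<Sum>k<K. l ^ k / fact k) - exp l\<bar> < \<epsilon> / 3" "C / real K < \<epsilon> / 3" "K > 0"
      using eventually_happens[OF eventually_conj[OF 1 eventually_conj[OF 2 eventually_gt_at_top[of 0]]]]
      by (auto simp: dist_real_def)
    have "(\<lambda>n. \<Sum>k<K. q n k - q n 0 * (l ^ k / fact k)) \<longlonglongrightarrow> (\<Sum>k<K. 0)"
      by (intro tendsto_sum d)
    then have "eventually (\<lambda>n. dist (\<Sum>k<K. q n k - q n 0 * (l ^ k / fact k)) 0 < \<epsilon> / 3) sequentially"
      using \<epsilon> by (intro tendstoD) auto
    with q0 tight[OF K(3)] show "eventually (\<lambda>n. dist (q n 0) (exp (- l)) < \<epsilon>) sequentially"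
    proof eventually_elim
      case (elim n)
      define s where "s = (\<Sum>k<K. l ^ k / fact k)"
      have near: "\<bar>(\<Sum>k<K. q n k) - q n 0 * s\<bar> < \<epsilon> / 3"
        using elim(3) by (simp add: s_def sum_subtractf sum_distrib_left)
      have tail: "\<bar>q n 0 * (s - exp l)\<bar> \<le> 1 * \<bar>s - exp l\<bar>"
        unfolding abs_mult using elim(1) by (intro mult_right_mono) auto
      have triangle: "\<bar>a - b - c\<bar> \<le> \<bar>a\<bar> + \<bar>b\<bar> + \<bar>c\<bar>" for a b c :: real by linarith
      have eq: "q n 0 * exp l - 1 = ((\<Sum>k<K. q n k) - 1) - ((\<Sum>k<K. q n k) - q n 0 * s) - q n 0 * (s - exp l)"
        by (simp add: algebra_simps)
      have "\<bar>q n 0 * exp l - 1\<bar> < \<epsilon>"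
        using triangle[of "(\<Sum>k<K. q n k) - 1" "(\<Sum>k<K. q n k) - q n 0 * s" "q n 0 * (s - exp l)"]
          near tail elim(2) K(1,2) unfolding eq s_def[symmetric] by linarith
      moreover have "q n 0 - exp (- l) = exp (- l) * (q n 0 * exp l - 1)"
        by (simp add: algebra_simps flip: exp_add)
      then have "\<bar>q n 0 - exp (- l)\<bar> \<le> 1 * \<bar>q n 0 * exp l - 1\<bar>"
        using l by (simp only: abs_mult) (intro mult_right_mono, auto)
      ultimately show ?case by (simp add: dist_real_def)
    qed
  qed
  then have "(\<lambda>n. (q n k - q n 0 * (l ^ k / fact k)) + q n 0 * (l ^ k / fact k)) \<longlonglongrightarrow>
      0 + exp (- l) * (l ^ k / fact k)"
    by (intro tendsto_add d tendsto_mult_right)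
  then show ?thesis by (simp add: poisson_weight_def)
qed

section \<open>Double limits\<close>

definition nested_lim :: "(real \<Rightarrow> nat \<Rightarrow> real) \<Rightarrow> real \<Rightarrow> bool" where
  "nested_lim a l \<longleftrightarrow> (\<forall>\<epsilon>>0. \<forall>\<^sub>F M in at_top. \<forall>\<^sub>F n in sequentially. \<bar>a M n - l\<bar> < \<epsilon>)"

text \<open>Replaces extended-real upper and lower limits by an epsilon form; inner limits still
  need not exist. Backwards, the epsilon form bounds the upper limit above and the lower limit below
  by \<open>l\<close>, and the lower limit never exceeds the upper one.\<close>

lemma double_lim_iff_nested_lim: "double_lim a l \<longleftrightarrow> nested_lim a l"
proof
  assume d: "double_lim a l"
  show "nested_lim a l"
    unfolding nested_lim_def
  proof (intro allI impI)
    fix \<epsilon> :: real assume \<epsilon>: "\<epsilon> > 0"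
    have "Limsup at_top (\<lambda>m. limsup (\<lambda>n. ereal (a m n))) < ereal (l + \<epsilon>)"
      "ereal (l - \<epsilon>) < Liminf at_top (\<lambda>m. liminf (\<lambda>n. ereal (a m n)))"
      using d \<epsilon> unfolding double_lim_def by auto
    then have "\<forall>\<^sub>F m in at_top. limsup (\<lambda>n. ereal (a m n)) < ereal (l + \<epsilon>)"
      "\<forall>\<^sub>F m in at_top. ereal (l - \<epsilon>) < liminf (\<lambda>n. ereal (a m n))"
      by (auto dest: Limsup_lessD less_LiminfD)
    then show "\<forall>\<^sub>F M in at_top. \<forall>\<^sub>F n in sequentially. \<bar>a M n - l\<bar> < \<epsilon>"
    proof eventually_elim
      case (elim m)
      have "\<forall>\<^sub>F n in sequentially. ereal (a m n) < ereal (l + \<epsilon>)"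
        "\<forall>\<^sub>F n in sequentially. ereal (l - \<epsilon>) < ereal (a m n)"
        using elim by (auto dest: Limsup_lessD less_LiminfD)
      then show ?case by eventually_elim auto
    qed
  qed
next
  assume n: "nested_lim a l"
  have "Limsup at_top (\<lambda>m. limsup (\<lambda>n. ereal (a m n))) \<le> ereal l"
  proof (rule ereal_le_epsilon2)
    fix \<epsilon> :: real assume "\<epsilon> > 0"
    then have "\<forall>\<^sub>F M in at_top. \<forall>\<^sub>F n in sequentially. \<bar>a M n - l\<bar> < \<epsilon>"
      using n by (auto simp: nested_lim_def)
    then have "\<forall>\<^sub>F M in at_top. limsup (\<lambda>n. ereal (a M n)) \<le> ereal (l + \<epsilon>)"
    proof eventually_elim
      case (elim M)
      then show ?case by (intro Limsup_bounded) (auto elim!: eventually_mono)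
    qed
    then show "Limsup at_top (\<lambda>m. limsup (\<lambda>n. ereal (a m n))) \<le> ereal l + ereal \<epsilon>"
      by (auto intro: Limsup_bounded)
  qed
  moreover have "ereal l \<le> Liminf at_top (\<lambda>m. liminf (\<lambda>n. ereal (a m n)))"
  proof (rule ereal_le_epsilon2)
    fix \<epsilon> :: real assume "\<epsilon> > 0"
    then have "\<forall>\<^sub>F M in at_top. \<forall>\<^sub>F n in sequentially. \<bar>a M n - l\<bar> < \<epsilon>"
      using n by (auto simp: nested_lim_def)
    then have "\<forall>\<^sub>F M in at_top. ereal (l - \<epsilon>) \<le> liminf (\<lambda>n. ereal (a M n))"
    proof eventually_elim
      case (elim M)
      then show ?case by (intro Liminf_bounded) (auto elim!: eventually_mono)
    qed
    then have "ereal (l - \<epsilon>) \<le> Liminf at_top (\<lambda>m. liminf (\<lambda>n. ereal (a m n)))"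
      by (rule Liminf_bounded)
    then have "ereal (l - \<epsilon>) + ereal \<epsilon> \<le> Liminf at_top (\<lambda>m. liminf (\<lambda>n. ereal (a m n))) + ereal \<epsilon>"
      by (rule add_right_mono)
    then show "ereal l \<le> Liminf at_top (\<lambda>m. liminf (\<lambda>n. ereal (a m n))) + ereal \<epsilon>" by simp
  qed
  moreover have "Liminf at_top (\<lambda>m. liminf (\<lambda>n. ereal (a m n))) \<le> Limsup at_top (\<lambda>m. limsup (\<lambda>n. ereal (a m n)))"
    by (rule order_trans[OF Liminf_le_Limsup Limsup_mono]) (auto intro!: always_eventually Liminf_le_Limsup)
  ultimately show "double_lim a l" unfolding double_lim_def by auto
qed

lemma nested_lim_cong:
  assumes "\<forall>\<^sub>F M in at_top. \<forall>\<^sub>F n in sequentially. a M n = b M n"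
  shows "nested_lim a l \<longleftrightarrow> nested_lim b l"
proof -
  have "nested_lim b l" if "nested_lim a l" "\<forall>\<^sub>F M in at_top. \<forall>\<^sub>F n in sequentially. a M n = b M n" for a b
    unfolding nested_lim_def
  proof (intro allI impI)
    fix \<epsilon> :: real assume "\<epsilon> > 0"
    then have "\<forall>\<^sub>F M in at_top. \<forall>\<^sub>F n in sequentially. \<bar>a M n - l\<bar> < \<epsilon>"
      using that(1) by (auto simp: nested_lim_def)
    with that(2) show "\<forall>\<^sub>F M in at_top. \<forall>\<^sub>F n in sequentially. \<bar>b M n - l\<bar> < \<epsilon>"
    proof eventually_elim
      case (elim M)
      from elim show ?case by eventually_elim auto
    qed
  qed
  from this[of a b] this[of b a] show ?thesis using assms by (auto simp: eq_commute)
qed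

lemma nested_lim_diff_square:
  assumes a: "nested_lim a x" and b: "nested_lim b y"
  shows "nested_lim (\<lambda>M n. b M n - (a M n)\<^sup>2) (y - x\<^sup>2)"
  unfolding nested_lim_def
proof (intro allI impI)
  fix \<epsilon> :: real assume \<epsilon>: "\<epsilon> > 0"
  \<comment> \<open>The bound 1 gives
    \<open>\<bar>a M n + x\<bar> \<le> 1 + 2 * \<bar>x\<bar>\<close>, the cofactor in the difference
    of squares; the other bound makes the product at most \<open>\<epsilon> / 2\<close>.\<close>
  define \<delta> where "\<delta> = min 1 (\<epsilon> / 2 / (1 + 2 * \<bar>x\<bar>))"
  have \<delta>: "\<delta> > 0" "\<delta> \<le> 1" "\<delta> \<le> \<epsilon> / 2 / (1 + 2 * \<bar>x\<bar>)"
    unfolding \<delta>_def using \<epsilon> by (auto simp: add_pos_nonneg)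
  then have \<delta>': "\<delta> * (1 + 2 * \<bar>x\<bar>) \<le> \<epsilon> / 2"
    by (subst (asm) pos_le_divide_eq) auto
  have "\<forall>\<^sub>F M in at_top. \<forall>\<^sub>F n in sequentially. \<bar>a M n - x\<bar> < \<delta>"
      "\<forall>\<^sub>F M in at_top. \<forall>\<^sub>F n in sequentially. \<bar>b M n - y\<bar> < \<epsilon> / 2"
    using a[unfolded nested_lim_def, rule_format, OF \<delta>(1)] b[unfolded nested_lim_def, rule_format, of "\<epsilon> / 2"] \<epsilon> by auto
  then show "\<forall>\<^sub>F M in at_top. \<forall>\<^sub>F n in sequentially. \<bar>b M n - (a M n)\<^sup>2 - (y - x\<^sup>2)\<bar> < \<epsilon>"
  proof eventually_elim
    case (elim M)
    from elim show ?case
    proof eventually_elim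
      case (elim n)
      have "(a M n)\<^sup>2 - x\<^sup>2 = (a M n - x) * (a M n + x)"
        by (simp add: power2_eq_square algebra_simps)
      then have "\<bar>(a M n)\<^sup>2 - x\<^sup>2\<bar> \<le> \<delta> * (1 + 2 * \<bar>x\<bar>)"
        unfolding abs_mult using elim \<delta> by (simp only: abs_mult) (intro mult_mono, auto)
      then show ?case using elim \<delta>' by linarith
    qed
  qed
qed

section \<open>Degrees\<close>

lemma deg_eq_card_edges:
  assumes "simple_graph n E"
  shows "deg E u = card {e \<in> E. u \<in> e}"
proof -
  have "inj_on (\<lambda>v. {u, v}) {v. {u, v} \<in> E}" by (auto simp: inj_on_def doubleton_eq_iff)
  moreover have "(\<lambda>v. {u, v}) ` {v. {u, v} \<in> E} = {e \<in> E. u \<in> e}"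
  proof (intro equalityI subsetI)
    fix e assume e: "e \<in> {e \<in> E. u \<in> e}"
    then obtain a b where "e = {a, b}" using simple_graph_edge(2)[OF assms, of e] by (auto simp: card_2_iff)
    then have "e = {u, if u = a then b else a}" using e by auto
    then show "e \<in> (\<lambda>v. {u, v}) ` {v. {u, v} \<in> E}" using e by blast
  qed auto
  ultimately show ?thesis unfolding deg_def using card_image by fastforce
qed

lemma sum_adj_deg:
  assumes "simple_graph n E"
  shows "(\<Sum>v\<in>{1..n}. adj E u v) = real (deg E u)"
proof -
  have "{v. {u, v} \<in> E} \<subseteq> {1..n}" using simple_graph_edge(1)[OF assms] by auto
  then have "{1..n} \<inter> {v. {u, v} \<in> E} = {v. {u, v} \<in> E}" by auto
  then show ?thesis unfolding adj_def deg_def by simp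
qed

lemma sum_deg:
  assumes "simple_graph n E"
  shows "(\<Sum>u\<in>{1..n}. real (deg E u)) = 2 * real (card E)"
  using sum_adj[OF assms, of "\<lambda>_. 1"] by (simp flip: sum_adj_deg[OF assms])

text \<open>Both sides count vertices shared by an ordered pair of edges: two if the edges agree,
  one if they touch. This turns degree squares into touching pairs and back.\<close>

lemma sum_deg_sq:
  assumes "simple_graph n E"
  shows "(\<Sum>u\<in>{1..n}. (real (deg E u))\<^sup>2) = 2 * real (card E) + real (card (touching_pairs E))"
proof -
  note fin = simple_graph_finite[OF assms]
  note edge = simple_graph_edge[OF assms]
  have deg: "real (deg E u) = (\<Sum>e\<in>E. of_bool (u \<in> e))" for u
    using fin by (simp add: deg_eq_card_edges[OF assms] Int_def)
  have "(\<Sum>u\<in>{1..n}. (real (deg E u))\<^sup>2) = (\<Sum>u\<in>{1..n}. \<Sum>e\<in>E. \<Sum>f\<in>E. of_bool (u \<in> e \<inter> f))"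
    unfolding deg power2_eq_square sum_product Int_iff of_bool_conj by (rule refl)
  also have "\<dots> = (\<Sum>e\<in>E. \<Sum>f\<in>E. \<Sum>u\<in>{1..n}. of_bool (u \<in> e \<inter> f))"
    by (subst sum.swap, rule sum.cong[OF refl], rule sum.swap)
  also have "\<dots> = (\<Sum>e\<in>E. \<Sum>f\<in>E. 2 * of_bool (e = f) + of_bool (e \<noteq> f \<and> e \<inter> f \<noteq> {}))"
  proof (intro sum.cong refl)
    fix e f assume ef: "e \<in> E" "f \<in> E"
    have "{1..n} \<inter> {u. u \<in> e \<and> u \<in> f} = e \<inter> f" using edge(1)[OF ef(1)] by auto
    then have "(\<Sum>u\<in>{1..n}. of_bool (u \<in> e \<inter> f)) = real (card (e \<inter> f))"
      by simp
    also have "\<dots> = 2 * of_bool (e = f) + of_bool (e \<noteq> f \<and> e \<inter> f \<noteq> {})"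
      using edge[OF ef(1)] edge[OF ef(2)] card_two_Un_int(1)[of e f] by (auto simp: of_bool_def)
    finally show "(\<Sum>u\<in>{1..n}. of_bool (u \<in> e \<inter> f)) =
      (2 * of_bool (e = f) + of_bool (e \<noteq> f \<and> e \<inter> f \<noteq> {}) :: real)" .
  qed
  also have "\<dots> = 2 * real (card E) + real (card (touching_pairs E))"
    using fin by (simp add: sum.distrib card_touching_pairs of_bool_def flip: sum_distrib_left)
  finally show ?thesis .
qed

lemma deg_mono:
  assumes "simple_graph n E" "H \<subseteq> E"
  shows "deg H u \<le> deg E u"
  unfolding deg_eq_card_edges[OF assms(1)] deg_eq_card_edges[OF simple_graph_subset[OF assms]]
  using simple_graph_finite[OF assms(1)] assms(2) by (intro card_mono) auto

lemma simple_graph_low_edges: "simple_graph n E \<Longrightarrow> simple_graph n (low_edges E t)"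
  using low_edges_subset by (rule simple_graph_subset[rotated])

text \<open>A vertex above the cut-off is isolated in the truncated graph, and the other degrees can
  only decrease.\<close>

lemma deg_low_edges:
  assumes "simple_graph n E"
  shows "real (deg (low_edges E t) u) \<le> of_bool (real (deg E u) \<le> t) * real (deg E u)"
proof (cases "real (deg E u) \<le> t")
  case True
  then show ?thesis using deg_mono[OF assms low_edges_subset] by simp
next
  case False
  then have "{e \<in> low_edges E t. u \<in> e} = {}" by (auto simp: low_edges_def)
  then have "deg (low_edges E t) u = 0"
    unfolding deg_eq_card_edges[OF simple_graph_low_edges[OF assms]] by (simp only: card.empty)
  then show ?thesis by simp
qed

lemma deg_low_edges_le:
  assumes "simple_graph n E" "t \<ge> 0"
  shows "real (card {e \<in> low_edges E t. u \<in> e}) \<le> t"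
  using deg_low_edges[OF assms(1), of t u] assms(2)
  unfolding deg_eq_card_edges[OF simple_graph_low_edges[OF assms(1)], symmetric]
  by (auto simp: of_bool_def split: if_splits)

text \<open>Markov's inequality for the degree sequence, whose sum is twice the number of
  edges.\<close>

lemma card_high_deg:
  assumes "simple_graph n E" "t > 0"
  shows "real (card {u \<in> {1..n}. real (deg E u) > t}) \<le> 2 * real (card E) / t"
proof -
  have "real (card {u \<in> {1..n}. real (deg E u) > t}) * t = (\<Sum>u | u \<in> {1..n} \<and> real (deg E u) > t. t)" by simp
  also have "\<dots> \<le> (\<Sum>u | u \<in> {1..n} \<and> real (deg E u) > t. real (deg E u))" by (intro sum_mono) auto
  also have "\<dots> \<le> (\<Sum>u\<in>{1..n}. real (deg E u))" by (intro sum_mono2) auto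
  finally show ?thesis unfolding sum_deg[OF assms(1)] using assms(2) by (simp add: field_simps)
qed

lemma edges_in_low_edges_eq:
  assumes "\<And>u. u \<in> S \<Longrightarrow> real (deg E u) \<le> t"
  shows "edges_in (low_edges E t) S = edges_in E S"
  unfolding edges_in_def low_edges_def using assms by (intro arg_cong[of _ _ card]) auto

text \<open>The two counts agree unless some vertex of degree above \<open>M / q\<close> is active.
  There are at most \<open>2 * q * card E / M\<close> such vertices, each active with probability
  \<open>q\<close>, and \<open>B\<close> bounds the difference of two values of
  \<open>f\<close>.\<close>

lemma bern_exp_low_edges_diff:
  assumes E: "simple_graph n E" and q: "0 < q" "q \<le> 1" and M: "M > 0"
    and f: "\<And>k. 0 \<le> f k" "\<And>k. f k \<le> (B :: real)"
  shows "\<bar>bern_exp q {1..n} (\<lambda>S. f (edges_in E S)) - bern_exp q {1..n} (\<lambda>S. f (edges_in (low_edges E (M / q)) S))\<bar>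
    \<le> B * (2 * (q\<^sup>2 * card E) / M)"
proof -
  define A where "A = {u \<in> {1..n}. real (deg E u) > M / q}"
  have B: "B \<ge> 0" using f order_trans by blast
  have "\<bar>bern_exp q {1..n} (\<lambda>S. f (edges_in E S)) - bern_exp q {1..n} (\<lambda>S. f (edges_in (low_edges E (M / q)) S))\<bar>
    \<le> bern_exp q {1..n} (\<lambda>S. \<Sum>u\<in>A. B * of_bool ({u} \<subseteq> S))"
  proof (rule bern_exp_abs_diff_le)
    fix S assume S: "S \<subseteq> {1..n}"
    show "\<bar>f (edges_in E S) - f (edges_in (low_edges E (M / q)) S)\<bar> \<le> (\<Sum>u\<in>A. B * of_bool ({u} \<subseteq> S))"
    proof (cases "\<exists>u\<in>S. real (deg E u) > M / q")
      case True
      then obtain u where "u \<in> S" "real (deg E u) > M / q" by blast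
      then have u: "u \<in> A" "u \<in> S" using S by (auto simp: A_def)
      have "\<bar>f (edges_in E S) - f (edges_in (low_edges E (M / q)) S)\<bar> \<le> B"
        using f[of "edges_in E S"] f[of "edges_in (low_edges E (M / q)) S"] by linarith
      also have "\<dots> = (\<Sum>v\<in>{u}. B * of_bool ({v} \<subseteq> S))" using u by simp
      also have "\<dots> \<le> (\<Sum>u\<in>A. B * of_bool ({u} \<subseteq> S))"
        using u B by (intro sum_mono2) (auto simp: A_def)
      finally show ?thesis .
    next
      case False
      then have "edges_in (low_edges E (M / q)) S = edges_in E S"
        by (intro edges_in_low_edges_eq) (auto simp: not_less)
      then show ?thesis using B by (auto intro!: sum_nonneg)
    qed
  qed (use q in auto)
  also have "\<dots> = (\<Sum>u\<in>A. B * q)"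
    unfolding bern_exp_sum bern_exp_cmult
    by (intro sum.cong refl, subst bern_exp_of_bool_superset) (auto simp: A_def)
  also have "\<dots> = B * q * real (card A)" by simp
  also have "\<dots> \<le> B * q * (2 * real (card E) / (M / q))"
    unfolding A_def using B q M by (intro mult_left_mono card_high_deg[OF E]) auto
  also have "\<dots> = B * (2 * (q\<^sup>2 * card E) / M)" using q by (simp add: power2_eq_square)
  finally show ?thesis .
qed

section \<open>The second-moment phenomenon\<close>

locale bernoulli_graphs =
  fixes p :: "nat \<Rightarrow> real" and E :: "nat \<Rightarrow> nat set set" and C :: real
  assumes p: "\<And>n. n \<ge> 1 \<Longrightarrow> 0 < p n \<and> p n < 1"
    and p_lim: "p \<longlonglongrightarrow> 0"
    and graph: "\<And>n. n \<ge> 1 \<Longrightarrow> simple_graph n (E n)"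
    and C_pos: "C > 0"
    and edges_le: "eventually (\<lambda>n. (p n)\<^sup>2 * card (E n) \<le> C) sequentially"
begin

definition low :: "real \<Rightarrow> nat \<Rightarrow> nat set set" where
  "low M n = low_edges (E n) (M / p n)"

definition edge_mass :: "real \<Rightarrow> nat \<Rightarrow> real" where
  "edge_mass M n = (p n)\<^sup>2 * card (low M n)"

text \<open>For \<open>n \<ge> 1\<close>, the expected number of ordered pairs of distinct touching
  edges that are both present in the truncated graph: such a pair has three vertices.\<close>

definition path_mass :: "real \<Rightarrow> nat \<Rightarrow> real" where
  "path_mass M n = p n ^ 3 * card (touching_pairs (low M n))"

definition moment :: "nat \<Rightarrow> real \<Rightarrow> nat \<Rightarrow> real" where
  "moment j M n = bern_exp (p n) {1..n} (\<lambda>S. real (edges_in (low M n) S) ^ j)"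

definition count_prob :: "nat \<Rightarrow> nat \<Rightarrow> real" where
  "count_prob n k = bern_exp (p n) {1..n} (\<lambda>S. of_bool (edges_in (E n) S = k))"

definition good :: "nat \<Rightarrow> bool" where
  "good n \<longleftrightarrow> n \<ge> 1 \<and> (p n)\<^sup>2 * card (E n) \<le> C"

lemma eventually_good: "eventually good sequentially"
  using edges_le eventually_ge_at_top[of 1] unfolding good_def by eventually_elim auto

lemma goodD:
  assumes "good n"
  shows "n \<ge> 1" "0 < p n" "p n < 1" "simple_graph n (E n)" "(p n)\<^sup>2 * card (E n) \<le> C"
    "simple_graph n (low M n)" "finite (E n)"
  using assms p[of n] graph[of n] simple_graph_low_edges[OF graph[of n]] simple_graph_finite[OF graph[of n]]
  unfolding good_def low_def by auto

lemma edge_mass_bounds: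
  assumes "good n"
  shows "0 \<le> edge_mass M n" "edge_mass M n \<le> C"
proof -
  have "card (low M n) \<le> card (E n)"
    unfolding low_def using goodD[OF assms] low_edges_subset by (intro card_mono) auto
  then have "edge_mass M n \<le> (p n)\<^sup>2 * card (E n)"
    unfolding edge_mass_def by (intro mult_left_mono) auto
  then show "edge_mass M n \<le> C" using goodD(5)[OF assms] by simp
qed (simp add: edge_mass_def)

lemma path_mass_nonneg: "good n \<Longrightarrow> 0 \<le> path_mass M n"
  unfolding path_mass_def using goodD(2)[of n] by simp

lemma low_mono: "good n \<Longrightarrow> M \<le> M' \<Longrightarrow> low M n \<subseteq> low M' n"
  unfolding low_def using goodD(2)[of n] by (intro low_edges_mono divide_right_mono) auto

lemma path_mass_mono:
  assumes "good n" "M \<le> M'"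
  shows "path_mass M n \<le> path_mass M' n"
  unfolding path_mass_def using goodD[OF assms(1)] simple_graph_finite low_mono[OF assms]
  by (intro mult_left_mono) (auto intro!: touching_pairs_mono)

text \<open>Each edge touches at most \<open>2 * M / p n\<close> others, which uses up one of the
  three factors \<open>p n\<close>. For fixed \<open>M\<close> the mass is therefore bounded, though
  it need not vanish.\<close>

lemma path_mass_le:
  assumes "good n" "M \<ge> 0"
  shows "path_mass M n \<le> 2 * M * edge_mass M n"
proof -
  note g = goodD[OF assms(1)]
  have "real (card (touching_pairs (low M n))) \<le> card (low M n) * (2 * (M / p n))"
  proof (rule touching_pairs_bound[OF g(6)])
    show "real (card {f \<in> low M n. u \<in> f}) \<le> M / p n" for u
      unfolding low_def using g assms(2) by (intro deg_low_edges_le[OF g(4)]) auto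
  qed
  then have "path_mass M n \<le> p n ^ 3 * (card (low M n) * (2 * (M / p n)))"
    unfolding path_mass_def using g by (intro mult_left_mono) auto
  also have "\<dots> = 2 * M * edge_mass M n"
    using g unfolding edge_mass_def by (simp add: power2_eq_square power3_eq_cube)
  finally show ?thesis .
qed

lemma moment_1: "good n \<Longrightarrow> moment 1 M n = edge_mass M n"
  unfolding moment_def edge_mass_def using bern_exp_edges_in[OF goodD(6)] by simp

lemma variance_eq:
  "good n \<Longrightarrow> moment 2 M n - (moment 1 M n)\<^sup>2 = (1 - (p n)\<^sup>2) * edge_mass M n + (1 - p n) * path_mass M n"
  unfolding moment_def edge_mass_def path_mass_def using variance_edges_in[OF goodD(6), of n "p n" M] by simp

lemma moment_2_le:
  assumes "good n"
  shows "moment 2 M n \<le> edge_mass M n + path_mass M n + (edge_mass M n)\<^sup>2"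
proof -
  have "(1 - (p n)\<^sup>2) * edge_mass M n \<le> 1 * edge_mass M n" "(1 - p n) * path_mass M n \<le> 1 * path_mass M n"
    using goodD[OF assms] edge_mass_bounds[OF assms] path_mass_nonneg[OF assms]
    by (intro mult_right_mono; simp)+
  then show ?thesis using variance_eq[OF assms, of M] moment_1[OF assms, of M] by simp
qed

text \<open>The point is uniformity in \<open>n\<close> for fixed \<open>M\<close>: it makes the
  squares of the truncated count uniformly integrable. The bracket ending in
  \<open>C\<^sup>2\<close> bounds the second moment, and \<open>M\<close> is the product of
  \<open>p n\<close> with the degree bound.\<close>

lemma moment_3_le:
  assumes "good n" "M \<ge> 0"
  shows "moment 3 M n \<le> 3 * C * (1 + 6 * M + 4 * M\<^sup>2 + (C + 2 * M * C + C\<^sup>2))"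
proof -
  note g = goodD[OF assms(1)]
  have "moment 3 M n \<le> 3 * edge_mass M n * (1 + 6 * (p n * (M / p n)) + 4 * (p n * (M / p n))\<^sup>2 + moment 2 M n)"
    unfolding moment_def edge_mass_def
  proof (rule bern_exp_edges_in_cube[OF g(6)])
    show "real (card {f \<in> low M n. u \<in> f}) \<le> M / p n" for u
      unfolding low_def using g assms(2) by (intro deg_low_edges_le[OF g(4)]) auto
  qed (use g in auto)
  also have "\<dots> = 3 * edge_mass M n * (1 + 6 * M + 4 * M\<^sup>2 + moment 2 M n)" using g by simp
  also have "\<dots> \<le> 3 * C * (1 + 6 * M + 4 * M\<^sup>2 + (C + 2 * M * C + C\<^sup>2))"
  proof (intro mult_mono add_left_mono)
    have "path_mass M n \<le> 2 * M * C"
      using path_mass_le[OF assms] mult_left_mono[OF edge_mass_bounds(2)[OF assms(1), of M], of "2 * M"] assms by simp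
    moreover have "(edge_mass M n)\<^sup>2 \<le> C\<^sup>2"
      using edge_mass_bounds[OF assms(1)] by (intro power_mono) auto
    ultimately show "moment 2 M n \<le> C + 2 * M * C + C\<^sup>2"
      using moment_2_le[OF assms(1), of M] edge_mass_bounds(2)[OF assms(1), of M] by linarith
    have "0 \<le> moment 2 M n"
      unfolding moment_def bern_exp_def using g by (intro sum_nonneg) auto
    then show "0 \<le> 1 + 6 * M + 4 * M\<^sup>2 + moment 2 M n" using assms by simp
  qed (use edge_mass_bounds[OF assms(1)] C_pos in auto)
  finally show ?thesis .
qed

text \<open>By \<open>variance_eq\<close>, variance minus mean is the path mass up to the factor
  \<open>1 - p n\<close> and an error of at most \<open>(p n)\<^sup>2 * C\<close>.\<close>

lemma moments_iff_masses:
  "nested_lim (moment 1) l \<and> nested_lim (\<lambda>M n. moment 2 M n - (moment 1 M n)\<^sup>2) l \<longleftrightarrow>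
    nested_lim edge_mass l \<and> (\<forall>M. path_mass M \<longlonglongrightarrow> 0)"
proof -
  have m1: "nested_lim (moment 1) l \<longleftrightarrow> nested_lim edge_mass l"
    by (intro nested_lim_cong always_eventually allI eventually_mono[OF eventually_good moment_1])
  have p2: "\<forall>\<^sub>F n in sequentially. (p n)\<^sup>2 * C < \<epsilon>" if "\<epsilon> > 0" for \<epsilon>
  proof -
    have "(\<lambda>n. (p n)\<^sup>2 * C) \<longlonglongrightarrow> 0\<^sup>2 * C" by (intro tendsto_intros p_lim)
    then show ?thesis using that by (intro order_tendstoD(2)) auto
  qed
  \<comment> \<open>Dividing by \<open>1 - p n\<close> then costs at most a factor 2, so three
    errors of \<open>\<epsilon> / 8\<close> leave less than \<open>\<epsilon>\<close>.\<close>
  have p12: "\<forall>\<^sub>F n in sequentially. p n < 1 / 2" 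
    using p_lim by (rule order_tendstoD) simp
  have err: "(p n)\<^sup>2 * edge_mass M n \<le> (p n)\<^sup>2 * C" if "good n" for n M
    using edge_mass_bounds[OF that] by (intro mult_left_mono) auto
  show ?thesis
  proof (intro iffI conjI allI; elim conjE)
    assume m: "nested_lim (moment 1) l" and v: "nested_lim (\<lambda>M n. moment 2 M n - (moment 1 M n)\<^sup>2) l"
    show e: "nested_lim edge_mass l" using m unfolding m1 .
    fix M
    show "path_mass M \<longlonglongrightarrow> 0"
    proof (rule tendstoI)
      fix \<epsilon> :: real assume \<epsilon>: "\<epsilon> > 0"
      have "\<forall>\<^sub>F M' in at_top. \<forall>\<^sub>F n in sequentially. \<bar>edge_mass M' n - l\<bar> < \<epsilon> / 8"
        "\<forall>\<^sub>F M' in at_top. \<forall>\<^sub>F n in sequentially. \<bar>moment 2 M' n - (moment 1 M' n)\<^sup>2 - l\<bar> < \<epsilon> / 8"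
        using e[unfolded nested_lim_def, rule_format, of "\<epsilon> / 8"] v[unfolded nested_lim_def, rule_format, of "\<epsilon> / 8"] \<epsilon>
        by auto
      \<comment> \<open>The path mass grows with the cut-off, so its smallness at one
        \<open>M' \<ge> M\<close> settles the given \<open>M\<close>.\<close>
      from eventually_happens[OF eventually_conj[OF eventually_conj[OF this] eventually_ge_at_top[of M]]]
      obtain M' where M': "M' \<ge> M" "\<forall>\<^sub>F n in sequentially. \<bar>edge_mass M' n - l\<bar> < \<epsilon> / 8"
        "\<forall>\<^sub>F n in sequentially. \<bar>moment 2 M' n - (moment 1 M' n)\<^sup>2 - l\<bar> < \<epsilon> / 8" by auto
      have "\<epsilon> / 8 > 0" using \<epsilon> by simp
      from M'(2,3) p2[OF this] p12 eventually_good
      show "\<forall>\<^sub>F n in sequentially. dist (path_mass M n) 0 < \<epsilon>"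
      proof eventually_elim
        case (elim n)
        have "1 / 2 * path_mass M' n \<le> (1 - p n) * path_mass M' n"
          using elim path_mass_nonneg[OF elim(5)] by (intro mult_right_mono) auto
        moreover have "(1 - p n) * path_mass M' n = moment 2 M' n - (moment 1 M' n)\<^sup>2 - edge_mass M' n + (p n)\<^sup>2 * edge_mass M' n"
          using variance_eq[OF elim(5), of M'] by (simp add: algebra_simps)
        ultimately have "path_mass M n < \<epsilon>"
          using elim(1,2,3) err[OF elim(5), of M'] path_mass_mono[OF elim(5) M'(1)] \<epsilon> by linarith
        then show ?case using path_mass_nonneg[OF elim(5), of M] by (simp add: dist_real_def)
      qed
    qed
  next
    assume e: "nested_lim edge_mass l" and d: "\<forall>M. path_mass M \<longlonglongrightarrow> 0"
    show "nested_lim (moment 1) l" using e unfolding m1 .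
    show "nested_lim (\<lambda>M n. moment 2 M n - (moment 1 M n)\<^sup>2) l"
      unfolding nested_lim_def
    proof (intro allI impI)
      fix \<epsilon> :: real assume \<epsilon>: "\<epsilon> > 0"
      then have \<epsilon>3: "\<epsilon> / 3 > 0" by simp
      from e[unfolded nested_lim_def, rule_format, OF \<epsilon>3]
      show "\<forall>\<^sub>F M in at_top. \<forall>\<^sub>F n in sequentially. \<bar>moment 2 M n - (moment 1 M n)\<^sup>2 - l\<bar> < \<epsilon>"
      proof eventually_elim
        case (elim M)
        have "\<forall>\<^sub>F n in sequentially. path_mass M n < \<epsilon> / 3"
          using order_tendstoD(2)[OF d[rule_format, of M] \<epsilon>3] .
        with elim p2[OF \<epsilon>3] eventually_good show ?case
        proof eventually_elim
          case (elim n)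
          have "(1 - p n) * path_mass M n \<le> 1 * path_mass M n"
            using goodD[OF elim(3)] path_mass_nonneg[OF elim(3)] by (intro mult_right_mono) auto
          moreover have "0 \<le> (1 - p n) * path_mass M n"
            using goodD[OF elim(3)] path_mass_nonneg[OF elim(3)] by (intro mult_nonneg_nonneg) auto
          moreover have "(1 - (p n)\<^sup>2) * edge_mass M n = edge_mass M n - (p n)\<^sup>2 * edge_mass M n"
            by (simp add: algebra_simps)
          moreover have "0 \<le> (p n)\<^sup>2 * edge_mass M n" using edge_mass_bounds(1)[OF elim(3)] by simp
          ultimately show ?case
            unfolding variance_eq[OF elim(3)] using elim(1,2,4) err[OF elim(3), of M] by linarith
        qed
      qed
    qed
  qed
qed

section \<open>From the masses to Poisson probabilities and back to moments\<close>

lemma count_prob_low_diff: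
  assumes "good n" "M > 0"
  shows "\<bar>count_prob n k - bern_exp (p n) {1..n} (\<lambda>S. of_bool (edges_in (low M n) S = k))\<bar> \<le> 2 * C / M"
proof -
  note g = goodD[OF assms(1)]
  have "\<bar>count_prob n k - bern_exp (p n) {1..n} (\<lambda>S. of_bool (edges_in (low M n) S = k))\<bar> \<le>
      1 * (2 * ((p n)\<^sup>2 * card (E n)) / M)"
    unfolding count_prob_def low_def
    using g assms(2) by (intro bern_exp_low_edges_diff[where f = "\<lambda>i. of_bool (i = k)"]) auto
  also have "\<dots> \<le> 2 * C / M" using g assms(2) by (auto intro: divide_right_mono)
  finally show ?thesis .
qed

lemma bern_exp_01:
  assumes "good n" "\<And>S. 0 \<le> f S" "\<And>S. f S \<le> 1"
  shows "0 \<le> bern_exp (p n) {1..n} f" "bern_exp (p n) {1..n} f \<le> 1"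
  using bern_exp_mono[of "p n" "{1..n}" "\<lambda>_. 0" f] bern_exp_mono[of "p n" "{1..n}" f "\<lambda>_. 1"] goodD[OF assms(1)] assms(2,3)
  by (auto simp: bern_exp_const)

text \<open>Markov's inequality for the full count; the tightness needed for the Poisson limit thus
  comes from the first moment alone.\<close>

lemma count_prob_partial_sum:
  assumes "good n" "K > 0"
  shows "\<bar>(\<Sum>k<K. count_prob n k) - 1\<bar> \<le> C / real K"
proof -
  note g = goodD[OF assms(1)]
  have fin: "finite {1..n}" by simp
  have "(\<Sum>k<K. count_prob n k) = bern_exp (p n) {1..n} (\<lambda>S. of_bool (edges_in (E n) S < K))"
    unfolding count_prob_def bern_exp_sum[symmetric] by (intro bern_exp_cong) (simp add: of_bool_def)
  then have "\<bar>(\<Sum>k<K. count_prob n k) - 1\<bar> =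
      \<bar>bern_exp (p n) {1..n} (\<lambda>S. of_bool (edges_in (E n) S < K)) - bern_exp (p n) {1..n} (\<lambda>_. 1)\<bar>"
    by (simp add: bern_exp_const)
  also have "\<dots> \<le> bern_exp (p n) {1..n} (\<lambda>S. (1 / real K) * real (edges_in (E n) S))"
    using g assms(2) by (intro bern_exp_abs_diff_le) (auto simp: field_simps)
  also have "\<dots> = (p n)\<^sup>2 * card (E n) / real K"
    unfolding bern_exp_cmult using bern_exp_edges_in[OF g(4)] by simp
  also have "\<dots> \<le> C / real K" using g assms(2) by (intro divide_right_mono) auto
  finally show ?thesis .
qed

text \<open>For fixed \<open>M\<close> the recursion holds for the truncated count with error at
  most \<open>2 * path_mass M n + (p n)\<^sup>2 * C\<close>. Passing to the full count changes each
  probability by at most \<open>2 * C / M\<close>, so \<open>M\<close> is chosen first, depending on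
  \<open>k\<close> and \<open>l\<close>, and then \<open>n\<close> tends to infinity.\<close>

lemma count_prob_poisson_if_masses:
  assumes l: "l \<ge> 0" and e: "nested_lim edge_mass l" and d: "\<And>M. path_mass M \<longlonglongrightarrow> 0"
  shows "(\<lambda>n. count_prob n k) \<longlonglongrightarrow> poisson_weight l k"
proof (rule poisson_recursion_limit[OF l])
  show "\<forall>\<^sub>F n in sequentially. \<bar>count_prob n 0\<bar> \<le> 1"
    using eventually_good
  proof eventually_elim
    case (elim n)
    show ?case unfolding count_prob_def
      using bern_exp_01[OF elim, of "\<lambda>S. of_bool (edges_in (E n) S = 0)"] by auto
  qed
  show "\<forall>\<^sub>F n in sequentially. \<bar>(\<Sum>k<K. count_prob n k) - 1\<bar> \<le> C / real K" if "K > 0" for K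
    using eventually_good by eventually_elim (rule count_prob_partial_sum[OF _ that])
  show "(\<lambda>n. real (Suc k) * count_prob n (Suc k) - l * count_prob n k) \<longlonglongrightarrow> 0" for k
  proof (rule tendstoI)
    fix \<epsilon> :: real assume \<epsilon>: "\<epsilon> > 0"
    then have \<epsilon>4: "\<epsilon> / 4 > 0" by simp
    have "((\<lambda>M. (real (Suc k) + l) * (2 * C) * inverse M) \<longlongrightarrow> (real (Suc k) + l) * (2 * C) * 0) at_top"
      by (intro tendsto_intros tendsto_inverse_0_at_top filterlim_ident)
    then have "\<forall>\<^sub>F M in at_top. (real (Suc k) + l) * (2 * C) * inverse M < \<epsilon> / 4"
      using \<epsilon>4 by (intro order_tendstoD(2)) auto
    from eventually_happens'[OF trivial_limit_at_top_linorder eventually_conj[OF eventually_conj[OF this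
      eventually_gt_at_top[of 0]] e[unfolded nested_lim_def, rule_format, OF \<epsilon>4]]]
    obtain M where "(real (Suc k) + l) * (2 * C) * inverse M < \<epsilon> / 4" and M2: "M > 0"
      "\<forall>\<^sub>F n in sequentially. \<bar>edge_mass M n - l\<bar> < \<epsilon> / 4" by blast
    then have M: "(real (Suc k) + l) * (2 * C / M) < \<epsilon> / 4" "M > 0"
      "\<forall>\<^sub>F n in sequentially. \<bar>edge_mass M n - l\<bar> < \<epsilon> / 4"
      by (simp_all only: divide_inverse mult.assoc)
    have "(\<lambda>n. 2 * path_mass M n + (p n)\<^sup>2 * C) \<longlonglongrightarrow> 2 * 0 + 0\<^sup>2 * C"
      by (intro tendsto_intros d p_lim)
    then have "\<forall>\<^sub>F n in sequentially. 2 * path_mass M n + (p n)\<^sup>2 * C < \<epsilon> / 4"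
      using \<epsilon>4 by (intro order_tendstoD(2)) auto
    with M(3) eventually_good
    show "\<forall>\<^sub>F n in sequentially. dist (real (Suc k) * count_prob n (Suc k) - l * count_prob n k) 0 < \<epsilon>"
    proof eventually_elim
      case (elim n)
      note g = goodD[OF elim(2)]
      define R where "R k = bern_exp (p n) {1..n} (\<lambda>S. of_bool (edges_in (low M n) S = k))" for k
      have 1: "\<bar>count_prob n i - R i\<bar> \<le> 2 * C / M" for i
        unfolding R_def by (rule count_prob_low_diff[OF elim(2) M(2)])
      have R01: "0 \<le> R i" "R i \<le> 1" for i
        unfolding R_def by (rule bern_exp_01[OF elim(2)]; simp)+
      have "\<bar>real (Suc k) * R (Suc k) - edge_mass M n * R k\<bar> \<le>
          2 * path_mass M n + p n ^ 4 * card (low M n)"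
        unfolding R_def edge_mass_def path_mass_def using g
        by (intro poisson_recursion_error) auto
      also have "p n ^ 4 * card (low M n) = (p n)\<^sup>2 * edge_mass M n"
        by (simp add: edge_mass_def power2_eq_square power4_eq_xxxx)
      also have "\<dots> \<le> (p n)\<^sup>2 * C"
        using edge_mass_bounds[OF elim(2)] by (intro mult_left_mono) auto
      finally have 2: "\<bar>real (Suc k) * R (Suc k) - edge_mass M n * R k\<bar> < \<epsilon> / 4"
        using elim(3) by linarith
      have "\<bar>(edge_mass M n - l) * R k\<bar> \<le> \<epsilon> / 4 * 1"
        unfolding abs_mult using elim(1) R01[of k] \<epsilon> by (intro mult_mono) auto
      then have 3: "\<bar>edge_mass M n * R k - l * R k\<bar> \<le> \<epsilon> / 4" by (simp add: left_diff_distrib)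
      have 4: "\<bar>real (Suc k) * count_prob n (Suc k) - real (Suc k) * R (Suc k)\<bar> \<le> real (Suc k) * (2 * C / M)"
        using mult_left_mono[OF 1[of "Suc k"], of "real (Suc k)"]
        by (simp add: abs_mult flip: right_diff_distrib)
      have 5: "\<bar>l * R k - l * count_prob n k\<bar> \<le> l * (2 * C / M)"
        using mult_left_mono[OF 1[of k], of l] l
        by (simp add: abs_mult abs_minus_commute flip: right_diff_distrib)
      have "(real (Suc k) + l) * (2 * C / M) = real (Suc k) * (2 * C / M) + l * (2 * C / M)"
        by (rule distrib_right)
      then have "\<bar>real (Suc k) * count_prob n (Suc k) - l * count_prob n k\<bar> < \<epsilon>"
        using 2 3 4 5 M(1) by linarith
      then show ?case by (simp add: dist_real_def)
    qed
  qed
qed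

text \<open>The capped power \<open>f K\<close> is bounded, so truncating the graph changes its
  expectation by at most \<open>K ^ j * (2 * C / M)\<close>; this yields the lower bound. For the
  upper bound the truncated count is dominated by the full one, and what exceeds the cap is paid for
  by the third moment.\<close>

lemma moment_lim_if_count_prob_poisson:
  assumes l: "l \<ge> 0" and q: "\<And>k. (\<lambda>n. count_prob n k) \<longlonglongrightarrow> poisson_weight l k"
    and j: "1 \<le> j" "j \<le> 2" and m: "(\<lambda>k. real k ^ j * poisson_weight l k) sums m"
  shows "nested_lim (moment j) m"
proof -
  define f where "f K k = real (min k K) ^ j" for K k
  define F where "F K n = bern_exp (p n) {1..n} (\<lambda>S. f K (edges_in (E n) S))" for K n
  \<comment> \<open>The Poisson expectation of \<open>f K\<close>, rewritten with total mass one.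
    Since \<open>K ^ j - f K k\<close> vanishes for \<open>k \<ge> K\<close>, only finitely many
    weights occur, and pointwise convergence of the probabilities gives
    \<open>F_lim\<close>.\<close>
  define L where "L K = real K ^ j - (\<Sum>k<K. (real K ^ j - real k ^ j) * poisson_weight l k)" for K
  have F_lim: "F K \<longlonglongrightarrow> L K" for K
  proof -
    have f: "f K k = real K ^ j - (\<Sum>i<K. (real K ^ j - real i ^ j) * of_bool (k = i))" for k
    proof -
      have "(\<Sum>i<K. (real K ^ j - real i ^ j) * of_bool (k = i)) =
          (\<Sum>i<K. if k = i then real K ^ j - real i ^ j else 0)"
        by (intro sum.cong) auto
      also have "\<dots> = (if k < K then real K ^ j - real k ^ j else 0)" by simp
      finally show ?thesis by (simp add: f_def min_def)
    qed
    have F: "F K n = real K ^ j - (\<Sum>k<K. (real K ^ j - real k ^ j) * count_prob n k)" for n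
      unfolding F_def f bern_exp_diff bern_exp_sum bern_exp_cmult count_prob_def
      by (subst bern_exp_const) auto
    show ?thesis unfolding F[abs_def] L_def by (intro tendsto_intros q)
  qed
  have L_le: "L K \<le> m" for K
  proof -
    have s: "(\<lambda>k. real k ^ j * poisson_weight l k - real K ^ j * poisson_weight l k) sums (m - real K ^ j * 1)"
      by (intro sums_diff m sums_mult poisson_weight_sums)
    have "(\<Sum>k<K. real k ^ j * poisson_weight l k - real K ^ j * poisson_weight l k) \<le> m - real K ^ j * 1"
      unfolding sums_unique[OF s]
    proof (rule sum_le_suminf[OF sums_summable[OF s]])
      fix k assume "k \<in> - {..<K}"
      then show "0 \<le> real k ^ j * poisson_weight l k - real K ^ j * poisson_weight l k"
        using poisson_weight_nonneg[OF l] by (auto intro!: mult_right_mono power_mono)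
    qed auto
    then show ?thesis by (simp add: L_def sum_subtractf algebra_simps)
  qed
  have L_ge: "(\<Sum>k<K. real k ^ j * poisson_weight l k) \<le> L K" for K
  proof -
    have "(\<Sum>k<K. poisson_weight l k) \<le> 1"
      unfolding sums_unique[OF poisson_weight_sums[of l]]
      using poisson_weight_nonneg[OF l] by (intro sum_le_suminf sums_summable[OF poisson_weight_sums]) auto
    then have "real K ^ j * (\<Sum>k<K. poisson_weight l k) \<le> real K ^ j * 1"
      by (intro mult_left_mono) auto
    then show ?thesis by (simp add: L_def sum_subtractf left_diff_distrib sum_distrib_left)
  qed
  show ?thesis
    unfolding nested_lim_def
  proof (intro allI impI)
    fix \<epsilon> :: real assume \<epsilon>: "\<epsilon> > 0"
    then have \<epsilon>3: "\<epsilon> / 3 > 0" by simp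
    have "(\<lambda>K. \<Sum>k<K. real k ^ j * poisson_weight l k) \<longlonglongrightarrow> m" using m by (simp add: sums_def)
    then have "\<forall>\<^sub>F K in sequentially. m - \<epsilon> / 3 < (\<Sum>k<K. real k ^ j * poisson_weight l k)"
      using \<epsilon>3 by (intro order_tendstoD(1)) auto
    then obtain K where "m - \<epsilon> / 3 < (\<Sum>k<K. real k ^ j * poisson_weight l k)"
      by (auto dest: eventually_happens)
    with L_ge[of K] have K: "m - \<epsilon> / 3 < L K" by linarith
    have "((\<lambda>M. real K ^ j * (2 * C) * inverse M) \<longlongrightarrow> real K ^ j * (2 * C) * 0) at_top"
      by (intro tendsto_intros tendsto_inverse_0_at_top filterlim_ident)
    then have "\<forall>\<^sub>F M in at_top. real K ^ j * (2 * C) * inverse M < \<epsilon> / 3"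
      using \<epsilon>3 by (intro order_tendstoD(2)) auto
    then show "\<forall>\<^sub>F M in at_top. \<forall>\<^sub>F n in sequentially. \<bar>moment j M n - m\<bar> < \<epsilon>"
      using eventually_gt_at_top[of 0]
    proof eventually_elim
      case (elim M)
      \<comment> \<open>The third-moment bound depends on \<open>M\<close>, so the cap
        \<open>K'\<close> for the upper estimate is chosen after \<open>M\<close>, whereas the cap
        \<open>K\<close> for the lower estimate was chosen before it.\<close>
      define B where "B = 3 * C * (1 + 6 * M + 4 * M\<^sup>2 + (C + 2 * M * C + C\<^sup>2))"
      have "(\<lambda>K. B / real K) \<longlonglongrightarrow> 0" by (rule lim_const_over_n)
      then have "\<forall>\<^sub>F K in sequentially. B / real K < \<epsilon> / 3"
        using \<epsilon>3 by (intro order_tendstoD) auto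
      from eventually_happens[OF eventually_conj[OF this eventually_gt_at_top[of 0]]]
      obtain K' where K': "B / real K' < \<epsilon> / 3" "K' > 0" by auto
      have "\<forall>\<^sub>F n in sequentially. F K' n < L K' + \<epsilon> / 3" "\<forall>\<^sub>F n in sequentially. L K - \<epsilon> / 3 < F K n"
        using \<epsilon>3 order_tendstoD[OF F_lim] by auto
      with eventually_good show ?case
      proof eventually_elim
        case (elim n)
        note g = goodD[OF elim(1)]
        have M: "M > 0" "real K ^ j * (2 * C) * inverse M < \<epsilon> / 3" by fact+
        have "moment j M n \<le> bern_exp (p n) {1..n} (\<lambda>S. f K' (edges_in (E n) S) + (1 / real K') * real (edges_in (low M n) S) ^ 3)"
          unfolding moment_def
        proof (rule bern_exp_mono)
          fix S
          let ?t = "edges_in (low M n) S"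
          have t: "?t \<le> edges_in (E n) S"
            unfolding low_def using g low_edges_subset by (intro edges_in_mono_graph) auto
          show "real ?t ^ j \<le> f K' (edges_in (E n) S) + (1 / real K') * real ?t ^ 3"
          proof (cases "?t \<le> K'")
            case True
            then have "real ?t ^ j \<le> f K' (edges_in (E n) S)"
              unfolding f_def using t by (intro power_mono) auto
            then show ?thesis by (simp add: add_increasing2)
          next
            case False
            \<comment> \<open>Above the cap the factor \<open>?t / K'\<close> exceeds 1, and
              \<open>j + 1 \<le> 3\<close> allows the power to be raised to the third.\<close>
            have "real K' * real ?t ^ j \<le> real ?t * real ?t ^ j"
              using False by (intro mult_right_mono) auto
            also have "\<dots> = real ?t ^ Suc j" by simp
            also have "\<dots> \<le> real ?t ^ 3"
              using False j by (intro power_increasing) auto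
            finally have "real ?t ^ j \<le> (1 / real K') * real ?t ^ 3"
              using K' by (simp add: field_simps)
            moreover have "0 \<le> f K' (edges_in (E n) S)" by (simp add: f_def)
            ultimately show ?thesis by linarith
          qed
        qed (use g in auto)
        also have "\<dots> = F K' n + (1 / real K') * moment 3 M n"
          unfolding bern_exp_add bern_exp_cmult F_def moment_def by (rule refl)
        finally have "moment j M n \<le> F K' n + (1 / real K') * moment 3 M n" .
        moreover have "(1 / real K') * moment 3 M n \<le> B / real K'"
          using moment_3_le[OF elim(1), of M] M K' by (simp add: B_def divide_right_mono)
        ultimately have upper: "moment j M n < m + \<epsilon>"
          using elim(2) K' L_le[of K'] \<epsilon> by linarith
        have "\<bar>F K n - bern_exp (p n) {1..n} (\<lambda>S. f K (edges_in (low M n) S))\<bar> \<le>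
            real K ^ j * (2 * ((p n)\<^sup>2 * card (E n)) / M)"
          unfolding F_def low_def using g M
          by (intro bern_exp_low_edges_diff) (auto simp: f_def intro!: power_mono)
        also have "\<dots> \<le> real K ^ j * (2 * C / M)"
          using g M by (intro mult_left_mono divide_right_mono) auto
        also have "\<dots> < \<epsilon> / 3" using M by (simp add: field_simps)
        finally have "\<bar>F K n - bern_exp (p n) {1..n} (\<lambda>S. f K (edges_in (low M n) S))\<bar> < \<epsilon> / 3" .
        moreover have "bern_exp (p n) {1..n} (\<lambda>S. f K (edges_in (low M n) S)) \<le> moment j M n"
          unfolding moment_def using g by (intro bern_exp_mono) (auto simp: f_def intro!: power_mono)
        ultimately have "m - \<epsilon> < moment j M n" using elim(3) K by linarith
        with upper show ?case by (simp add: abs_less_iff)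
      qed
    qed
  qed
qed

lemma count_prob_poisson_iff_moments:
  assumes l: "l \<ge> 0"
  shows "(\<forall>k. (\<lambda>n. count_prob n k) \<longlonglongrightarrow> poisson_weight l k) \<longleftrightarrow>
    nested_lim (moment 1) l \<and> nested_lim (\<lambda>M n. moment 2 M n - (moment 1 M n)\<^sup>2) l"
proof
  assume q: "\<forall>k. (\<lambda>n. count_prob n k) \<longlonglongrightarrow> poisson_weight l k"
  have 1: "nested_lim (moment 1) l"
    by (rule moment_lim_if_count_prob_poisson[OF l]) (use q poisson_weight_sums_mean[of l] in auto)
  have 2: "nested_lim (moment 2) (l + l\<^sup>2)"
    by (rule moment_lim_if_count_prob_poisson[OF l]) (use q poisson_weight_sums_sq[of l] in auto)
  show "nested_lim (moment 1) l \<and> nested_lim (\<lambda>M n. moment 2 M n - (moment 1 M n)\<^sup>2) l"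
    using 1 nested_lim_diff_square[OF 1 2] by simp
next
  assume "nested_lim (moment 1) l \<and> nested_lim (\<lambda>M n. moment 2 M n - (moment 1 M n)\<^sup>2) l"
  then show "\<forall>k. (\<lambda>n. count_prob n k) \<longlonglongrightarrow> poisson_weight l k"
    unfolding moments_iff_masses using count_prob_poisson_if_masses[OF l] by auto
qed

end

section \<open>The graphon as a step function\<close>

text \<open>Open on the left because the graphon labels points by a ceiling: for
  \<open>r > 0\<close> this is the set where \<open>\<lceil>x * r\<rceil>\<close> equals
  \<open>u\<close>.\<close>

definition cell :: "real \<Rightarrow> nat \<Rightarrow> real set" where
  "cell r u = {(real u - 1) / r <.. real u / r}"

text \<open>The length of the part of the \<open>u\<close>-th cell below \<open>K\<close>, when \<open>K\<close> is nonnegative and \<open>u\<close> positive.\<close>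

definition cell_low :: "real \<Rightarrow> real \<Rightarrow> nat \<Rightarrow> real" where
  "cell_low r K u = min K (real u / r) - min K ((real u - 1) / r)"

lemma cell_sets [measurable]: "cell r u \<in> sets borel"
  unfolding cell_def by simp

lemma emeasure_cell_finite: "emeasure lborel (B \<inter> cell r u) < \<infinity>"
  by (intro emeasure_bounded_finite bounded_subset[OF bounded_closed_interval[of "(real u - 1) / r" "real u / r"]])
    (auto simp: cell_def)

lemma measure_cell_low:
  assumes "r > 0" "K \<ge> 0" "u \<ge> 1"
  shows "measure lborel ({0..K} \<inter> cell r u) = cell_low r K u"
proof -
  have "(real u - 1) / r \<ge> 0" "(real u - 1) / r \<le> real u / r"
    using assms by (auto simp: divide_right_mono)
  moreover from this have "{0..K} \<inter> cell r u = (if (real u - 1) / r \<le> K then {(real u - 1) / r <.. min K (real u / r)} else {})"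
    unfolding cell_def by auto
  ultimately show ?thesis unfolding cell_low_def by (auto simp: min_def)
qed

lemma measure_cell_high:
  assumes "r > 0" "K \<ge> 0" "u \<ge> 1"
  shows "measure lborel ({K..} \<inter> cell r u) = 1 / r - cell_low r K u"
proof -
  have *: "(real u - 1) / r = real u / r - 1 / r" by (simp add: diff_divide_distrib)
  have le: "(real u - 1) / r \<le> real u / r" using assms by (auto simp: divide_right_mono)
  consider "K \<le> (real u - 1) / r" | "(real u - 1) / r < K" "K \<le> real u / r" | "real u / r < K" by linarith
  then show ?thesis
  proof cases
    case 1
    then have "{K..} \<inter> cell r u = {(real u - 1) / r <.. real u / r}" unfolding cell_def by auto
    then have "measure lborel ({K..} \<inter> cell r u) = real u / r - (real u - 1) / r"
      using le by simp
    then show ?thesis using 1 le * unfolding cell_low_def by linarith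
  next
    case 2
    then have "{K..} \<inter> cell r u = {K .. real u / r}" unfolding cell_def by auto
    then have "measure lborel ({K..} \<inter> cell r u) = real u / r - K" using 2 by simp
    then show ?thesis using 2 le * unfolding cell_low_def by linarith
  next
    case 3
    then have "{K..} \<inter> cell r u = {}" unfolding cell_def by auto
    then have "measure lborel ({K..} \<inter> cell r u) = 0" by simp
    then show ?thesis using 3 le * unfolding cell_low_def by linarith
  qed
qed

text \<open>The points of \<open>{0..n / r}\<close> are covered by exactly one cell each, except
  \<open>x = 0\<close>, whose label 0 lies outside \<open>{1..n}\<close>; the condition on
  \<open>g 0\<close> takes care of that point.\<close>

lemma sum_cells:
  fixes g :: "nat \<Rightarrow> real"
  assumes r: "r > 0" and g: "g 0 = 0"
  shows "(if x \<in> {0..real n / r} then g (nat \<lceil>x * r\<rceil>) else 0) = (\<Sum>u\<in>{1..n}. g u * indicator (cell r u) x)"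
proof (cases "x \<in> {0..real n / r}")
  case True
  define m where "m = nat \<lceil>x * r\<rceil>"
  have xr: "0 \<le> x * r" "x * r \<le> real n" using True r by (auto simp: field_simps)
  have m: "m \<le> n" unfolding m_def using xr by (simp add: ceiling_le_iff nat_le_iff)
  have "x \<in> cell r u \<longleftrightarrow> m = u" if "u \<in> {1..n}" for u
  proof -
    have "x \<in> cell r u \<longleftrightarrow> real_of_int (int u) - 1 < x * r \<and> x * r \<le> real_of_int (int u)"
      unfolding cell_def using r by (simp add: field_simps)
    also have "\<dots> \<longleftrightarrow> \<lceil>x * r\<rceil> = int u" by (auto simp: ceiling_eq_iff)
    also have "\<dots> \<longleftrightarrow> m = u" unfolding m_def using xr by auto
    finally show ?thesis .
  qed
  then have "(\<Sum>u\<in>{1..n}. g u * indicator (cell r u) x) = (\<Sum>u\<in>{1..n}. if m = u then g u else 0)"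
    by (intro sum.cong) (auto simp: indicator_def)
  also have "\<dots> = g m" using m g by (cases "m = 0") auto
  finally show ?thesis using True by (simp add: m_def)
next
  case False
  have "x \<notin> cell r u" if "u \<in> {1..n}" for u
  proof
    assume "x \<in> cell r u"
    then have "(real u - 1) / r < x" "x \<le> real u / r" by (auto simp: cell_def)
    moreover have "0 \<le> (real u - 1) / r" "real u / r \<le> real n / r"
      using that r by (auto intro: divide_right_mono)
    ultimately show False using False by auto
  qed
  then have "(\<Sum>u\<in>{1..n}. g u * indicator (cell r u) x) = 0" by (intro sum.neutral) (auto simp: indicator_def)
  with False show ?thesis by (simp only: if_False)
qed

lemma set_integral_cells:
  assumes "B \<in> sets borel"
  shows "(LINT x:B|lborel. (\<Sum>u\<in>I. c u * indicator (cell r u) x)) = (\<Sum>u\<in>I. c u * measure lborel (B \<inter> cell r u))"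
proof -
  have "(LINT x:B|lborel. (\<Sum>u\<in>I. c u * indicator (cell r u) x)) =
      (LINT x|lborel. (\<Sum>u\<in>I. c u * indicator (B \<inter> cell r u) x))"
    unfolding set_lebesgue_integral_def
    by (intro Bochner_Integration.integral_cong refl) (auto simp: sum_distrib_left indicator_def intro!: sum.cong)
  also have "\<dots> = (\<Sum>u\<in>I. c u * measure lborel (B \<inter> cell r u))"
    using assms emeasure_cell_finite
    by (subst Bochner_Integration.integral_sum) (auto intro!: integrable_mult_right integrable_real_indicator)
  finally show ?thesis .
qed

lemma simple_graph_no_zero:
  assumes "simple_graph n E"
  shows "{0, v} \<notin> E" "{v, 0} \<notin> E"
  using simple_graph_edge(1)[OF assms] by force+

lemma graphon_eq_sum:
  assumes "simple_graph n E" "r > 0"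
  shows "graphon n r E x y = (\<Sum>u\<in>{1..n}. (\<Sum>v\<in>{1..n}. adj E u v * indicator (cell r v) y) * indicator (cell r u) x)"
proof -
  have in_y: "(if y \<in> {0..real n / r} then adj E u (nat \<lceil>y * r\<rceil>) else 0) =
      (\<Sum>v\<in>{1..n}. adj E u v * indicator (cell r v) y)" for u
    using simple_graph_no_zero[OF assms(1)] by (intro sum_cells assms(2)) (simp add: adj_def)
  have "graphon n r E x y = (if x \<in> {0..real n / r} then
      (if y \<in> {0..real n / r} then adj E (nat \<lceil>x * r\<rceil>) (nat \<lceil>y * r\<rceil>) else 0) else 0)"
    by (simp add: graphon_def adj_def)
  also have "\<dots> = (\<Sum>u\<in>{1..n}. (if y \<in> {0..real n / r} then adj E u (nat \<lceil>y * r\<rceil>) else 0) * indicator (cell r u) x)"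
    using simple_graph_no_zero[OF assms(1)] 
    by (intro sum_cells[where g = "\<lambda>u. if y \<in> {0..real n / r} then adj E u (nat \<lceil>y * r\<rceil>) else 0"] assms(2)) (simp add: adj_def)
  finally show ?thesis unfolding in_y .
qed

lemma graphon_sym: "graphon n r E x y = graphon n r E y x"
  unfolding graphon_def by (auto simp: insert_commute)

lemma graphon_integral_high:
  assumes E: "simple_graph n E" and r: "r > 0" and K: "K \<ge> 0"
  shows "(LINT y:{K..}|lborel. LINT x:{K..}|lborel. graphon n r E x y) =
    (\<Sum>u\<in>{1..n}. \<Sum>v\<in>{1..n}. adj E u v * (1 / r - cell_low r K u) * (1 / r - cell_low r K v))"
proof -
  have "(LINT x:{K..}|lborel. graphon n r E x y) =
      (\<Sum>v\<in>{1..n}. (\<Sum>u\<in>{1..n}. adj E u v * measure lborel ({K..} \<inter> cell r u)) * indicator (cell r v) y)" for y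
  proof -
    have "(LINT x:{K..}|lborel. graphon n r E x y) =
        (\<Sum>u\<in>{1..n}. (\<Sum>v\<in>{1..n}. adj E u v * indicator (cell r v) y) * measure lborel ({K..} \<inter> cell r u))"
      unfolding graphon_eq_sum[OF E r] by (rule set_integral_cells) simp
    also have "\<dots> = (\<Sum>u\<in>{1..n}. \<Sum>v\<in>{1..n}. adj E u v * measure lborel ({K..} \<inter> cell r u) * indicator (cell r v) y)"
      by (simp only: sum_distrib_left sum_distrib_right mult_ac)
    also have "\<dots> = (\<Sum>v\<in>{1..n}. \<Sum>u\<in>{1..n}. adj E u v * measure lborel ({K..} \<inter> cell r u) * indicator (cell r v) y)"
      by (rule sum.swap)
    finally show ?thesis by (simp only: sum_distrib_right)
  qed
  then have "(LINT y:{K..}|lborel. LINT x:{K..}|lborel. graphon n r E x y) =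
      (LINT y:{K..}|lborel. (\<Sum>v\<in>{1..n}. (\<Sum>u\<in>{1..n}. adj E u v * measure lborel ({K..} \<inter> cell r u)) * indicator (cell r v) y))"
    by (simp only:)
  also have "\<dots> = (\<Sum>v\<in>{1..n}. (\<Sum>u\<in>{1..n}. adj E u v * measure lborel ({K..} \<inter> cell r u)) * measure lborel ({K..} \<inter> cell r v))"
    by (rule set_integral_cells) simp
  also have "\<dots> = (\<Sum>v\<in>{1..n}. \<Sum>u\<in>{1..n}. adj E u v * (1 / r - cell_low r K u) * (1 / r - cell_low r K v))"
    unfolding sum_distrib_right using r K by (intro sum.cong refl) (simp add: measure_cell_high)
  also have "\<dots> = (\<Sum>u\<in>{1..n}. \<Sum>v\<in>{1..n}. adj E u v * (1 / r - cell_low r K u) * (1 / r - cell_low r K v))"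
    by (rule sum.swap)
  finally show ?thesis .
qed

text \<open>Every neighbour contributes a whole cell of length \<open>1 / r\<close>.\<close>

lemma graphon_deg_eq:
  assumes E: "simple_graph n E" and r: "r > 0"
  shows "graphon_deg (graphon n r E) x = (if x \<in> {0..real n / r} then real (deg E (nat \<lceil>x * r\<rceil>)) / r else 0)"
proof -
  have deg0: "deg E 0 = 0" unfolding deg_def using simple_graph_no_zero[OF E] by simp
  have cell0: "measure lborel ({0..} \<inter> cell r v) = 1 / r" if "v \<in> {1..n}" for v
  proof -
    have "cell_low r 0 v = 0" unfolding cell_low_def using that r by (simp add: min_def)
    then show ?thesis using measure_cell_high[OF r, of 0 v] that by simp
  qed
  have "graphon n r E x y = (\<Sum>v\<in>{1..n}. (\<Sum>u\<in>{1..n}. adj E v u * indicator (cell r u) x) * indicator (cell r v) y)" for y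
    using graphon_eq_sum[OF E r, of y x] graphon_sym[of n r E x y] by (simp only:)
  then have "graphon_deg (graphon n r E) x =
      (LINT y:{0..}|lborel. (\<Sum>v\<in>{1..n}. (\<Sum>u\<in>{1..n}. adj E v u * indicator (cell r u) x) * indicator (cell r v) y))"
    unfolding graphon_deg_def set_lebesgue_integral_def by (simp only:)
  also have "\<dots> = (\<Sum>v\<in>{1..n}. (\<Sum>u\<in>{1..n}. adj E v u * indicator (cell r u) x) * (1 / r))"
    by (subst set_integral_cells) (auto intro!: sum.cong simp: cell0)
  also have "\<dots> = (\<Sum>u\<in>{1..n}. \<Sum>v\<in>{1..n}. adj E u v * indicator (cell r u) x / r)"
    unfolding sum_distrib_right
    by (subst sum.swap, intro sum.cong refl) (simp add: adj_def insert_commute)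
  also have "\<dots> = (\<Sum>u\<in>{1..n}. real (deg E u) / r * indicator (cell r u) x)"
    unfolding sum_adj_deg[OF E, symmetric] sum_distrib_right sum_divide_distrib
    by (intro sum.cong refl) simp
  also have "\<dots> = (if x \<in> {0..real n / r} then real (deg E (nat \<lceil>x * r\<rceil>)) / r else 0)"
    by (rule sum_cells[OF r, symmetric]) (simp add: deg0)
  finally show ?thesis .
qed

lemma graphon_deg_integral_low:
  assumes E: "simple_graph n E" and r: "r > 0" and K: "K \<ge> 0"
  shows "(LINT x:{0..K}|lborel. graphon_deg (graphon n r E) x * of_bool (graphon_deg (graphon n r E) x \<le> M)) =
    (\<Sum>u\<in>{1..n}. real (deg E u) / r * of_bool (real (deg E u) / r \<le> M) * cell_low r K u)"
proof -
  have deg0: "deg E 0 = 0" unfolding deg_def using simple_graph_no_zero[OF E] by simp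
  define g where "g u = real (deg E u) / r * of_bool (real (deg E u) / r \<le> M)" for u
  have "graphon_deg (graphon n r E) x * of_bool (graphon_deg (graphon n r E) x \<le> M) =
      (\<Sum>u\<in>{1..n}. g u * indicator (cell r u) x)" for x
  proof -
    have "graphon_deg (graphon n r E) x * of_bool (graphon_deg (graphon n r E) x \<le> M) =
        (if x \<in> {0..real n / r} then g (nat \<lceil>x * r\<rceil>) else 0)"
      by (simp add: graphon_deg_eq[OF E r] g_def)
    also have "\<dots> = (\<Sum>u\<in>{1..n}. g u * indicator (cell r u) x)"
      by (rule sum_cells[OF r]) (simp add: g_def deg0)
    finally show ?thesis .
  qed
  then have "(LINT x:{0..K}|lborel. graphon_deg (graphon n r E) x * of_bool (graphon_deg (graphon n r E) x \<le> M)) =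
      (LINT x:{0..K}|lborel. (\<Sum>u\<in>{1..n}. g u * indicator (cell r u) x))"
    by (simp only:)
  also have "\<dots> = (\<Sum>u\<in>{1..n}. g u * measure lborel ({0..K} \<inter> cell r u))"
    by (rule set_integral_cells) simp
  also have "\<dots> = (\<Sum>u\<in>{1..n}. g u * cell_low r K u)"
    using r K by (intro sum.cong) (auto simp: measure_cell_low)
  finally show ?thesis unfolding g_def .
qed

section \<open>The cut norm of the graphon\<close>

lemma measure_lborel_Times:
  assumes "A \<in> sets borel" "B \<in> sets borel"
  shows "measure (lborel \<Otimes>\<^sub>M lborel) (A \<times> B) = measure lborel A * measure lborel B"
  unfolding measure_def using assms by (simp add: lborel.emeasure_pair_measure_Times enn2real_mult)

text \<open>Test functions are bounded by 1 and the graphon is nonnegative, so each test integral is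
  dominated by the integral of the graphon over the square, a finite sum over pairs of
  cells.\<close>

lemma cut_norm_graphon_bounds:
  assumes E: "simple_graph n E" and r: "r > 0" and K: "K \<ge> 0"
  shows "0 \<le> cut_norm K (graphon n r E)"
    "cut_norm K (graphon n r E) \<le> (\<Sum>u\<in>{1..n}. \<Sum>v\<in>{1..n}. adj E u v * cell_low r K u * cell_low r K v)"
proof -
  define B where "B = (\<Sum>u\<in>{1..n}. \<Sum>v\<in>{1..n}. adj E u v * cell_low r K u * cell_low r K v)"
  define I where "I f g = \<bar>LINT (x, y):{0..K} \<times> {0..K}|(lborel \<Otimes>\<^sub>M lborel). graphon n r E x y * f x * g y\<bar>" for f g
  define h :: "real \<times> real \<Rightarrow> real" where
    "h z = (\<Sum>u\<in>{1..n}. \<Sum>v\<in>{1..n}. adj E u v * indicator (({0..K} \<inter> cell r u) \<times> ({0..K} \<inter> cell r v)) z)" for z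
  let ?c = "\<lambda>u. {0..K} \<inter> cell r u"
  have fin: "emeasure (lborel \<Otimes>\<^sub>M lborel) (?c u \<times> ?c v) < \<infinity>" for u v
    using emeasure_cell_finite by (simp add: lborel.emeasure_pair_measure_Times ennreal_mult_less_top)
  have ind: "integrable (lborel \<Otimes>\<^sub>M lborel) (\<lambda>z. adj E u v * indicator (?c u \<times> ?c v) z :: real)" for u v
    using fin by (intro integrable_mult_right integrable_real_indicator) auto
  have h_int: "integrable (lborel \<Otimes>\<^sub>M lborel) h"
    unfolding h_def by (intro Bochner_Integration.integrable_sum ind)
  have h_eq: "integral\<^sup>L (lborel \<Otimes>\<^sub>M lborel) h = B"
  proof -
    have "integral\<^sup>L (lborel \<Otimes>\<^sub>M lborel) h =
        (\<Sum>u\<in>{1..n}. \<Sum>v\<in>{1..n}. adj E u v * measure (lborel \<Otimes>\<^sub>M lborel) (?c u \<times> ?c v))"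
      unfolding h_def
      by (subst Bochner_Integration.integral_sum, intro Bochner_Integration.integrable_sum ind,
          intro sum.cong refl, subst Bochner_Integration.integral_sum, rule ind, intro sum.cong refl)
        (simp add: space_pair_measure)
    also have "\<dots> = B"
      unfolding B_def using r K by (intro sum.cong refl) (simp add: measure_lborel_Times measure_cell_low)
    finally show ?thesis .
  qed
  have h_nonneg: "0 \<le> h z" for z unfolding h_def adj_def by (intro sum_nonneg) auto
  have le: "I f g \<le> B" if "f \<in> cut_test K" "g \<in> cut_test K" for f g
  proof -
    let ?F = "\<lambda>z. indicat_real ({0..K} \<times> {0..K}) z *\<^sub>R (case z of (x, y) \<Rightarrow> graphon n r E x y * f x * g y)"
    have "I f g = \<bar>integral\<^sup>L (lborel \<Otimes>\<^sub>M lborel) ?F\<bar>" unfolding I_def set_lebesgue_integral_def ..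
    also have "\<dots> \<le> integral\<^sup>L (lborel \<Otimes>\<^sub>M lborel) (\<lambda>z. \<bar>?F z\<bar>)" by (rule integral_abs_bound)
    also have "\<dots> \<le> integral\<^sup>L (lborel \<Otimes>\<^sub>M lborel) h"
    proof (rule integral_mono'[OF h_int _ h_nonneg])
      fix z :: "real \<times> real"
      obtain x y where z: "z = (x, y)" by (cases z)
      show "\<bar>?F z\<bar> \<le> h z"
      proof (cases "x \<in> {0..K} \<and> y \<in> {0..K}")
        case True
        then have fg: "\<bar>f x\<bar> \<le> 1" "\<bar>g y\<bar> \<le> 1"
          using that unfolding cut_test_def by (auto simp: image_subset_iff abs_le_iff)
        have W: "graphon n r E x y = h z"
          unfolding graphon_eq_sum[OF E r] h_def z sum_distrib_right using True
          by (intro sum.cong refl) (auto simp: indicator_def)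
        have "\<bar>?F z\<bar> = h z * (\<bar>f x\<bar> * \<bar>g y\<bar>)"
          using True h_nonneg[of z] by (simp add: z abs_mult W[unfolded z])
        also have "\<dots> \<le> h z * (1 * 1)"
          using fg h_nonneg by (intro mult_left_mono mult_mono) auto
        finally show ?thesis by simp
      next
        case False
        then have F0: "?F z = 0" by (auto simp: z)
        show ?thesis unfolding F0 using h_nonneg[of z] by simp
      qed
    qed
    finally show ?thesis unfolding h_eq .
  qed
  have cn: "cut_norm K (graphon n r E) = (SUP (f, g) \<in> cut_test K \<times> cut_test K. I f g)"
    unfolding cut_norm_def I_def ..
  have zero: "(\<lambda>_. 0) \<in> cut_test K"
    unfolding cut_test_def set_borel_measurable_def by auto
  \<comment> \<open>A real supremum dominates its members only for a set bounded above; without this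
    the zero test functions would not give the lower bound.\<close>
  have bdd: "bdd_above ((\<lambda>(f, g). I f g) ` (cut_test K \<times> cut_test K))"
    by (rule bdd_aboveI2[of _ _ B]) (use le in auto)
  show "cut_norm K (graphon n r E) \<le> (\<Sum>u\<in>{1..n}. \<Sum>v\<in>{1..n}. adj E u v * cell_low r K u * cell_low r K v)"
    unfolding cn B_def[symmetric] using zero le by (intro cSUP_least) auto
  have "0 \<le> (\<lambda>(f, g). I f g) (\<lambda>_. 0, \<lambda>_. 0)" by (simp add: I_def)
  also have "\<dots> \<le> (SUP (f, g) \<in> cut_test K \<times> cut_test K. I f g)"
    using zero bdd by (intro cSUP_upper) auto
  finally show "0 \<le> cut_norm K (graphon n r E)" unfolding cn .
qed

lemma cell_low_bounds:
  assumes "r > 0"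
  shows "0 \<le> cell_low r K u" "cell_low r K u \<le> 1 / r"
proof -
  have "(real u - 1) / r = real u / r - 1 / r" by (simp add: diff_divide_distrib)
  moreover have "1 / r > 0" using assms by simp
  ultimately show "0 \<le> cell_low r K u" "cell_low r K u \<le> 1 / r" unfolding cell_low_def by linarith+
qed

lemma cell_low_eq:
  assumes "real u / r \<le> K" "r > 0"
  shows "cell_low r K u = 1 / r"
proof -
  have "(real u - 1) / r = real u / r - 1 / r" by (simp add: diff_divide_distrib)
  moreover have "1 / r > 0" using assms by simp
  ultimately show ?thesis using assms(1) unfolding cell_low_def by linarith
qed

lemma sum_cell_low_le:
  assumes "r > 0" "K \<ge> 0"
  shows "(\<Sum>u\<in>{1..n}. cell_low r K u) \<le> K"
proof -
  have "(\<Sum>u\<in>{1..n}. cell_low r K u) = min K (real n / r)"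
  proof (induction n)
    case 0
    then show ?case using assms by simp
  next
    case (Suc n)
    then show ?case by (simp add: cell_low_def)
  qed
  then show ?thesis by simp
qed

section \<open>Truncation by degree and truncation by index\<close>

locale ordered_bernoulli_graphs = bernoulli_graphs +
  assumes ordered: "\<And>n. n \<ge> 1 \<Longrightarrow> degree_ordered n (E n)"
begin

text \<open>A continuous version of \<open>p n\<close> times the indicator of
  \<open>u \<le> K / p n\<close>: the length of the \<open>u\<close>-th cell below \<open>K\<close>,
  which is fractional only for the cell containing \<open>K\<close>.\<close>

definition wt :: "real \<Rightarrow> nat \<Rightarrow> nat \<Rightarrow> real" where
  "wt K n u = cell_low (1 / p n) K u"

text \<open>The value of the graphon degree on the \<open>u\<close>-th cell.\<close>

definition sdeg :: "nat \<Rightarrow> nat \<Rightarrow> real" where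
  "sdeg n u = real (deg (E n) u) * p n"

text \<open>The three masses below are the integrals of (c): (i), (iii), and the integral of the graphon over \<open>[0, K]\<^sup>2\<close>, which bounds the cut norm in (ii).\<close>

definition high_index_mass :: "real \<Rightarrow> nat \<Rightarrow> real" where
  "high_index_mass K n = 1 / 2 * (\<Sum>u\<in>{1..n}. \<Sum>v\<in>{1..n}. adj (E n) u v * (p n - wt K n u) * (p n - wt K n v))"

definition low_deg_mass :: "real \<Rightarrow> real \<Rightarrow> nat \<Rightarrow> real" where
  "low_deg_mass K M n = (\<Sum>u\<in>{1..n}. sdeg n u * of_bool (sdeg n u \<le> M) * wt K n u)"

definition corner_mass :: "real \<Rightarrow> nat \<Rightarrow> real" where
  "corner_mass K n = (\<Sum>u\<in>{1..n}. \<Sum>v\<in>{1..n}. adj (E n) u v * wt K n u * wt K n v)"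

lemma wt_bounds:
  assumes "good n"
  shows "0 \<le> wt K n u" "wt K n u \<le> p n"
  using cell_low_bounds[of "1 / p n" K u] goodD(2)[OF assms] by (auto simp: wt_def)

lemma sum_wt_le: "good n \<Longrightarrow> K \<ge> 0 \<Longrightarrow> (\<Sum>u\<in>{1..n}. wt K n u) \<le> K"
  unfolding wt_def using goodD(2) by (intro sum_cell_low_le) auto

lemma sdeg_nonneg: "good n \<Longrightarrow> 0 \<le> sdeg n u"
  using goodD(2)[of n] unfolding sdeg_def by simp

lemma adj_nonneg: "0 \<le> adj E' u v"
  unfolding adj_def by simp

lemma sum_adj_scaled: "good n \<Longrightarrow> (\<Sum>v\<in>{1..n}. adj (E n) u v * p n) = sdeg n u"
  unfolding sdeg_def sum_adj_deg[OF goodD(4), symmetric] sum_distrib_right ..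

lemma sum_sdeg_le:
  assumes "good n"
  shows "(\<Sum>u\<in>{1..n}. sdeg n u * p n) \<le> 2 * C"
proof -
  have "(\<Sum>u\<in>{1..n}. sdeg n u * p n) = 2 * ((p n)\<^sup>2 * card (E n))"
    unfolding sdeg_def using sum_deg[OF goodD(4)[OF assms]]
    by (simp add: power2_eq_square mult.assoc flip: sum_distrib_right)
  then show ?thesis using goodD(5)[OF assms] by simp
qed

text \<open>This is where the ordering by degree enters. A cell not entirely below \<open>K\<close>
  has \<open>u * p n > K\<close>; the first \<open>u\<close> vertices all have at least the degree
  of \<open>u\<close>, and the scaled degrees times \<open>p n\<close> sum to at most
  \<open>2 * C\<close>.\<close>

lemma sdeg_le_of_large_index:
  assumes g: "good n" and u: "u \<in> {1..n}" and w: "wt K n u < p n" and K: "K > 0"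
  shows "sdeg n u \<le> 2 * C / K"
proof -
  note gd = goodD[OF g]
  have uK: "K < real u * p n"
  proof (rule ccontr)
    assume "\<not> K < real u * p n"
    then have "wt K n u = p n" unfolding wt_def using gd by (subst cell_low_eq) auto
    then show False using w by simp
  qed
  have "real u * sdeg n u = (\<Sum>v\<in>{1..u}. sdeg n u)" by simp
  also have "\<dots> \<le> (\<Sum>v\<in>{1..u}. sdeg n v)"
    using ordered[OF gd(1)] u gd(2) unfolding degree_ordered_def sdeg_def
    by (intro sum_mono mult_right_mono) auto
  also have "\<dots> \<le> (\<Sum>v\<in>{1..n}. sdeg n v)"
    using u sdeg_nonneg[OF g] by (intro sum_mono2) auto
  finally have "real u * sdeg n u * p n \<le> (\<Sum>v\<in>{1..n}. sdeg n v) * p n"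
    using gd(2) by (intro mult_right_mono) auto
  also have "\<dots> \<le> 2 * C" using sum_sdeg_le[OF g] by (simp add: sum_distrib_right)
  finally have "real u * p n * sdeg n u \<le> 2 * C" by (simp add: mult_ac)
  moreover have "K * sdeg n u \<le> real u * p n * sdeg n u"
    using uK sdeg_nonneg[OF g] by (intro mult_right_mono) auto
  ultimately show ?thesis using K by (simp add: field_simps)
qed

lemma low_edge_iff:
  assumes "good n"
  shows "{u, v} \<in> low M n \<longleftrightarrow> {u, v} \<in> E n \<and> sdeg n u \<le> M \<and> sdeg n v \<le> M"
  using goodD(2)[OF assms] unfolding low_def low_edges_def sdeg_def by (auto simp: field_simps)

lemma edge_mass_eq:
  assumes "good n"
  shows "edge_mass M n = 1 / 2 * (\<Sum>u\<in>{1..n}. \<Sum>v\<in>{1..n}. adj (E n) u v *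
    (p n * of_bool (sdeg n u \<le> M)) * (p n * of_bool (sdeg n v \<le> M)))"
proof -
  have "2 * (\<Sum>e\<in>low M n. 1) = (\<Sum>u\<in>{1..n}. \<Sum>v\<in>{1..n}. adj (low M n) u v * 1)"
    by (rule sum_adj[OF goodD(6)[OF assms], symmetric])
  then have "real (card (low M n)) = 1 / 2 * (\<Sum>u\<in>{1..n}. \<Sum>v\<in>{1..n}. adj (low M n) u v)" by simp
  then have "edge_mass M n = 1 / 2 * (\<Sum>u\<in>{1..n}. \<Sum>v\<in>{1..n}. (p n)\<^sup>2 * adj (low M n) u v)"
    unfolding edge_mass_def by (simp add: sum_distrib_left)
  also have "(\<Sum>u\<in>{1..n}. \<Sum>v\<in>{1..n}. (p n)\<^sup>2 * adj (low M n) u v) = (\<Sum>u\<in>{1..n}. \<Sum>v\<in>{1..n}. adj (E n) u v *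
    (p n * of_bool (sdeg n u \<le> M)) * (p n * of_bool (sdeg n v \<le> M)))"
    by (intro sum.cong refl) (auto simp: adj_def low_edge_iff[OF assms] power2_eq_square)
  finally show ?thesis .
qed

lemma sum_adj_le:
  assumes "good n"
  shows "(\<Sum>u\<in>{1..n}. \<Sum>v\<in>{1..n}. adj (E n) u v * (p n * a u)) = (\<Sum>u\<in>{1..n}. sdeg n u * a u)"
  unfolding sum_adj_scaled[OF assms, symmetric] sum_distrib_right by (intro sum.cong refl) simp

text \<open>Both masses are the same quadratic form in the adjacency matrix, at the vertex weights
  \<open>a\<close> and \<open>w\<close>. The condition \<open>2 * C \<le> K * M\<close> makes every
  vertex with \<open>w u > 0\<close> a low-degree vertex, so \<open>w \<le> a\<close>; the excess
  \<open>a - w\<close> is supported by low-degree vertices of small index.\<close>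

lemma edge_mass_high_index_mass:
  assumes g: "good n" and KM: "K > 0" "2 * C \<le> K * M"
  shows "high_index_mass K n \<le> edge_mass M n" "edge_mass M n \<le> high_index_mass K n + low_deg_mass K M n"
proof -
  note gd = goodD[OF g]
  define a where "a u = p n * of_bool (sdeg n u \<le> M)" for u
  define w where "w u = p n - wt K n u" for u
  have CM: "2 * C / K \<le> M" using KM by (simp add: field_simps)
  have w0: "0 \<le> w u" "w u \<le> p n" for u using wt_bounds[OF g, of K u] by (auto simp: w_def)
  have wa: "w u \<le> a u" if "u \<in> {1..n}" for u
  proof (cases "wt K n u < p n")
    case True
    then have "sdeg n u \<le> M" using sdeg_le_of_large_index[OF g that True KM(1)] CM by linarith
    then show ?thesis using w0 by (simp add: a_def)
  next
    case False
    then have "w u \<le> 0" by (simp add: w_def)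
    then show ?thesis using gd(2) unfolding a_def by (cases "sdeg n u \<le> M") auto
  qed
  have a: "0 \<le> a u" "a u \<le> p n" for u using gd(2) by (auto simp: a_def)
  show "high_index_mass K n \<le> edge_mass M n"
    unfolding high_index_mass_def edge_mass_eq[OF g] w_def[symmetric] a_def[symmetric]
    using wa w0 a adj_nonneg by (intro mult_left_mono sum_mono mult_mono) auto
  define b where "b u = of_bool (sdeg n u \<le> M) * wt K n u" for u
  have ab: "a u - w u \<le> b u" for u
    using wt_bounds[OF g, of K u] by (auto simp: a_def w_def b_def)
  have b0: "0 \<le> b u" for u using wt_bounds[OF g, of K u] by (simp add: b_def)
  \<comment> \<open>The two factors are exchanged one at a time. Each exchange sums to
    \<open>low_deg_mass\<close>, and the two together cancel the factor 1/2 of the masses. Writing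
    the second with \<open>adj (E n) v u\<close> lets the same row sum be used after
    swapping.\<close>
  have pair: "adj (E n) u v * a u * a v \<le> adj (E n) u v * w u * w v + (adj (E n) u v * (p n * b u) + adj (E n) v u * (p n * b v))"
    if uv: "u \<in> {1..n}" "v \<in> {1..n}" for u v
  proof -
    have "a u * a v - w u * w v = a u * (a v - w v) + w v * (a u - w u)" by (simp add: algebra_simps)
    also have "\<dots> \<le> p n * b v + p n * b u"
      using a w0 ab b0 wa[OF uv(1)] wa[OF uv(2)] gd(2) by (intro add_mono mult_mono) auto
    finally have "adj (E n) u v * (a u * a v - w u * w v) \<le> adj (E n) u v * (p n * b v + p n * b u)"
      by (rule mult_left_mono) (rule adj_nonneg)
    moreover have "adj (E n) v u = adj (E n) u v" by (simp add: adj_def insert_commute)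
    ultimately show ?thesis by (simp add: algebra_simps)
  qed
  have "(\<Sum>u\<in>{1..n}. \<Sum>v\<in>{1..n}. adj (E n) u v * a u * a v) \<le>
      (\<Sum>u\<in>{1..n}. \<Sum>v\<in>{1..n}. adj (E n) u v * w u * w v + (adj (E n) u v * (p n * b u) + adj (E n) v u * (p n * b v)))"
    by (intro sum_mono pair)
  also have "\<dots> = (\<Sum>u\<in>{1..n}. \<Sum>v\<in>{1..n}. adj (E n) u v * w u * w v) +
      ((\<Sum>u\<in>{1..n}. sdeg n u * b u) + (\<Sum>u\<in>{1..n}. \<Sum>v\<in>{1..n}. adj (E n) v u * (p n * b v)))"
    by (simp only: sum.distrib sum_adj_le[OF g])
  also have "(\<Sum>u\<in>{1..n}. \<Sum>v\<in>{1..n}. adj (E n) v u * (p n * b v)) = (\<Sum>u\<in>{1..n}. sdeg n u * b u)"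
    by (subst sum.swap) (rule sum_adj_le[OF g])
  finally show "edge_mass M n \<le> high_index_mass K n + low_deg_mass K M n"
    unfolding high_index_mass_def edge_mass_eq[OF g] w_def[symmetric] a_def[symmetric] low_deg_mass_def
    by (simp add: b_def mult.assoc)
qed

lemma card_high_sdeg:
  assumes g: "good n" and M: "M > 0"
  shows "p n * real (card {u \<in> {1..n}. sdeg n u > M}) \<le> 2 * C / M"
proof -
  note gd = goodD[OF g]
  have "{u \<in> {1..n}. sdeg n u > M} = {u \<in> {1..n}. real (deg (E n) u) > M / p n}"
    using gd(2) by (auto simp: sdeg_def field_simps)
  then have "real (card {u \<in> {1..n}. sdeg n u > M}) \<le> 2 * real (card (E n)) / (M / p n)"
    using card_high_deg[OF gd(4), of "M / p n"] gd(2) M by simp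
  then have "p n * real (card {u \<in> {1..n}. sdeg n u > M}) \<le> p n * (2 * real (card (E n)) / (M / p n))"
    using gd(2) by (intro mult_left_mono) auto
  also have "\<dots> = 2 * ((p n)\<^sup>2 * card (E n)) / M" by (simp add: power2_eq_square)
  also have "\<dots> \<le> 2 * C / M" using gd(5) M by (intro divide_right_mono) auto
  finally show ?thesis .
qed

text \<open>Rows of low degree: replacing \<open>wt K n v\<close> by \<open>p n\<close> leaves the
  summand of \<open>low_deg_mass\<close>. Rows of high degree contribute at most
  \<open>p n * K\<close> each, and there are at most \<open>2 * C / (M * p n)\<close> of
  them.\<close>

lemma corner_mass_le:
  assumes g: "good n" and K: "K \<ge> 0" and M: "M > 0"
  shows "corner_mass K n \<le> low_deg_mass K M n + K * (2 * C / M)"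
proof -
  note gd = goodD[OF g]
  have "corner_mass K n \<le> (\<Sum>u\<in>{1..n}. sdeg n u * of_bool (sdeg n u \<le> M) * wt K n u + K * (p n * of_bool (sdeg n u > M)))"
    unfolding corner_mass_def
  proof (rule sum_mono)
    fix u
    show "(\<Sum>v\<in>{1..n}. adj (E n) u v * wt K n u * wt K n v) \<le>
      sdeg n u * of_bool (sdeg n u \<le> M) * wt K n u + K * (p n * of_bool (sdeg n u > M))"
    proof (cases "sdeg n u \<le> M")
      case True
      have "(\<Sum>v\<in>{1..n}. adj (E n) u v * wt K n u * wt K n v) \<le> (\<Sum>v\<in>{1..n}. adj (E n) u v * wt K n u * p n)"
        using wt_bounds[OF g] adj_nonneg by (intro sum_mono mult_left_mono mult_nonneg_nonneg) auto
      also have "\<dots> = sdeg n u * wt K n u"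
        unfolding sum_adj_scaled[OF g, symmetric] sum_distrib_right by (intro sum.cong) auto
      finally show ?thesis using True by simp
    next
      case False
      have "(\<Sum>v\<in>{1..n}. adj (E n) u v * wt K n u * wt K n v) \<le> (\<Sum>v\<in>{1..n}. 1 * p n * wt K n v)"
        using wt_bounds[OF g] gd(2) by (intro sum_mono mult_right_mono mult_mono) (auto simp: adj_def)
      also have "\<dots> = p n * (\<Sum>v\<in>{1..n}. wt K n v)" by (simp add: sum_distrib_left)
      also have "\<dots> \<le> p n * K" using sum_wt_le[OF g K] gd(2) by (intro mult_left_mono) auto
      finally show ?thesis using False by (simp add: mult.commute)
    qed
  qed
  also have "\<dots> = low_deg_mass K M n + K * (p n * real (card {u \<in> {1..n}. sdeg n u > M}))"
    unfolding low_deg_mass_def by (simp add: sum.distrib Int_def flip: sum_distrib_left)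
  also have "\<dots> \<le> low_deg_mass K M n + K * (2 * C / M)"
    using card_high_sdeg[OF g M] K by (intro add_left_mono mult_left_mono)
  finally show ?thesis .
qed

lemma sum_low_deg_sq:
  assumes g: "good n"
  shows "(\<Sum>u\<in>{1..n}. p n ^ 3 * (real (deg (low M n) u))\<^sup>2) = path_mass M n + 2 * p n * edge_mass M n"
  unfolding sum_distrib_left[symmetric] sum_deg_sq[OF goodD(6)[OF g]] path_mass_def edge_mass_def
  by (simp add: algebra_simps power2_eq_square power3_eq_cube)

text \<open>The path mass is at most a sum of \<open>p n\<close> times squared scaled degrees. The
  weight \<open>p n\<close> is split at \<open>K\<close>: below, one degree factor is at most
  \<open>M\<close>; above, one factor is at most \<open>2 * C / K\<close> by the ordering, and the
  other sums to at most \<open>2 * C\<close>.\<close>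

lemma path_mass_le_low_deg_mass:
  assumes g: "good n" and K: "K > 0" and M: "M \<ge> 0"
  shows "path_mass M n \<le> M * low_deg_mass K M n + 4 * C\<^sup>2 / K"
proof -
  note gd = goodD[OF g]
  have "path_mass M n \<le> (\<Sum>u\<in>{1..n}. p n ^ 3 * (real (deg (low M n) u))\<^sup>2)"
    unfolding sum_low_deg_sq[OF g] using gd(2) edge_mass_bounds(1)[OF g, of M] by simp
  also have "\<dots> \<le> (\<Sum>u\<in>{1..n}. M * (sdeg n u * of_bool (sdeg n u \<le> M) * wt K n u) + (2 * C / K) * (sdeg n u * p n))"
  proof (rule sum_mono)
    fix u assume u: "u \<in> {1..n}"
    define d where "d = sdeg n u * of_bool (sdeg n u \<le> M)"
    have d: "0 \<le> d" "d \<le> M" "d \<le> sdeg n u" using sdeg_nonneg[OF g, of u] M by (auto simp: d_def)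
    have "real (deg (low M n) u) * p n \<le> d"
      using deg_low_edges[OF gd(4), of "M / p n" u] gd(2)
      unfolding low_def d_def sdeg_def by (auto simp: field_simps)
    then have "(real (deg (low M n) u) * p n)\<^sup>2 \<le> d\<^sup>2" using gd(2) by (intro power_mono) auto
    then have "p n * (real (deg (low M n) u) * p n)\<^sup>2 \<le> p n * d\<^sup>2" using gd(2) by (intro mult_left_mono) auto
    also have "p n * d\<^sup>2 = d * (d * wt K n u) + d * (d * (p n - wt K n u))"
      by (simp add: power2_eq_square algebra_simps)
    also have "\<dots> \<le> M * (d * wt K n u) + (2 * C / K) * (sdeg n u * p n)"
    proof (intro add_mono mult_right_mono)
      show "d * (d * (p n - wt K n u)) \<le> (2 * C / K) * (sdeg n u * p n)"
      proof (cases "wt K n u < p n")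
        case True
        then show ?thesis
          using sdeg_le_of_large_index[OF g u True K] d wt_bounds[OF g, of K u] C_pos K sdeg_nonneg[OF g, of u]
          by (intro mult_mono) auto
      next
        case False
        then have "wt K n u = p n" using wt_bounds[OF g, of K u] by simp
        then show ?thesis using C_pos K sdeg_nonneg[OF g, of u] gd(2) by simp
      qed
    qed (use d wt_bounds[OF g, of K u] in auto)
    finally show "p n ^ 3 * (real (deg (low M n) u))\<^sup>2 \<le>
        M * (sdeg n u * of_bool (sdeg n u \<le> M) * wt K n u) + (2 * C / K) * (sdeg n u * p n)"
      by (simp add: d_def power2_eq_square power3_eq_cube mult_ac)
  qed
  also have "\<dots> = M * low_deg_mass K M n + (2 * C / K) * (\<Sum>u\<in>{1..n}. sdeg n u * p n)"
    unfolding low_deg_mass_def by (simp only: sum.distrib sum_distrib_left)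
  also have "\<dots> \<le> M * low_deg_mass K M n + (2 * C / K) * (2 * C)"
    using sum_sdeg_le[OF g] C_pos K by (intro add_left_mono mult_left_mono) auto
  also have "\<dots> = M * low_deg_mass K M n + 4 * C\<^sup>2 / K" by (simp add: power2_eq_square)
  finally show ?thesis .
qed

text \<open>A low-degree vertex loses under truncation only its neighbours of high degree, and those
  are few by \<open>card_high_sdeg\<close>.\<close>

lemma deg_le_low_deg:
  assumes g: "good n" and M: "M > 0" and u: "sdeg n u \<le> M"
  shows "sdeg n u \<le> real (deg (low M n) u) * p n + 2 * C / M"
proof -
  note gd = goodD[OF g]
  have fin: "finite {v. {u, v} \<in> E n}"
  proof (rule finite_subset)
    show "{v. {u, v} \<in> E n} \<subseteq> {1..n}" using simple_graph_edge(1)[OF gd(4)] by blast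
  qed simp
  have "deg (E n) u \<le> card ({v. {u, v} \<in> low M n} \<union> {v \<in> {1..n}. sdeg n v > M})"
    unfolding deg_def
  proof (intro card_mono)
    have "{v. {u, v} \<in> low M n} \<subseteq> {v. {u, v} \<in> E n}" by (auto simp: low_edge_iff[OF g])
    then show "finite ({v. {u, v} \<in> low M n} \<union> {v \<in> {1..n}. sdeg n v > M})"
      using finite_subset[OF _ fin] by simp
    show "{v. {u, v} \<in> E n} \<subseteq> {v. {u, v} \<in> low M n} \<union> {v \<in> {1..n}. sdeg n v > M}"
    proof
      fix v assume "v \<in> {v. {u, v} \<in> E n}"
      then have v: "{u, v} \<in> E n" by simp
      then have "v \<in> {1..n}" using simple_graph_edge(1)[OF gd(4)] by blast
      then show "v \<in> {v. {u, v} \<in> low M n} \<union> {v \<in> {1..n}. sdeg n v > M}"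
        using v u by (cases "sdeg n v \<le> M") (auto simp: low_edge_iff[OF g])
    qed
  qed
  also have "\<dots> \<le> deg (low M n) u + card {v \<in> {1..n}. sdeg n v > M}"
    unfolding deg_def by (rule card_Un_le)
  finally have "real (deg (E n) u) \<le> real (deg (low M n) u) + real (card {v \<in> {1..n}. sdeg n v > M})"
    by (simp flip: of_nat_add)
  then have "sdeg n u \<le> (real (deg (low M n) u) + real (card {v \<in> {1..n}. sdeg n v > M})) * p n"
    unfolding sdeg_def using gd(2) by (intro mult_right_mono) auto
  also have "\<dots> \<le> real (deg (low M n) u) * p n + 2 * C / M"
    using card_high_sdeg[OF g M] by (simp add: algebra_simps)
  finally show ?thesis .
qed

text \<open>With \<open>x\<close> the scaled degree in the truncated graph,
  \<open>x \<le> \<eta> + x\<^sup>2 / \<eta>\<close> trades degrees for squared degrees. The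
  constant part is weighted by cells of total length at most \<open>K\<close>, the square part sums
  to the path mass. Here \<open>M\<close> may be taken much larger than \<open>M'\<close>, which
  makes \<open>2 * C / M\<close> small.\<close>

lemma low_deg_mass_le:
  assumes g: "good n" and K: "K \<ge> 0" and M: "M > 0" "M' \<le> M" and \<eta>: "\<eta> > 0"
  shows "low_deg_mass K M' n \<le> K * (\<eta> + 2 * C / M) + (path_mass M n + 2 * p n * edge_mass M n) / \<eta>"
proof -
  note gd = goodD[OF g]
  have "low_deg_mass K M' n \<le> (\<Sum>u\<in>{1..n}. (\<eta> + 2 * C / M) * wt K n u + p n ^ 3 * (real (deg (low M n) u))\<^sup>2 / \<eta>)"
    unfolding low_deg_mass_def
  proof (rule sum_mono)
    fix u
    define x where "x = real (deg (low M n) u) * p n"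
    have "0 \<le> (x - \<eta>)\<^sup>2" "0 \<le> x\<^sup>2" "0 \<le> \<eta>\<^sup>2" by simp_all
    then have "x * \<eta> \<le> \<eta> * \<eta> + x\<^sup>2" unfolding power2_diff power2_eq_square[of \<eta>] by linarith
    then have x: "x \<le> \<eta> + x\<^sup>2 / \<eta>" using \<eta> by (simp add: field_simps)
    have "sdeg n u * of_bool (sdeg n u \<le> M') \<le> \<eta> + 2 * C / M + x\<^sup>2 / \<eta>"
    proof (cases "sdeg n u \<le> M'")
      case True
      then show ?thesis using deg_le_low_deg[OF g M(1), of u] M(2) x by (simp add: x_def)
    next
      case False
      then show ?thesis using \<eta> C_pos M by simp
    qed
    then have "sdeg n u * of_bool (sdeg n u \<le> M') * wt K n u \<le> (\<eta> + 2 * C / M + x\<^sup>2 / \<eta>) * wt K n u"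
      using wt_bounds[OF g] by (intro mult_right_mono) auto
    also have "\<dots> = (\<eta> + 2 * C / M) * wt K n u + (x\<^sup>2 / \<eta>) * wt K n u" by (simp add: distrib_right)
    also have "\<dots> \<le> (\<eta> + 2 * C / M) * wt K n u + (x\<^sup>2 / \<eta>) * p n"
      using wt_bounds[OF g] \<eta> by (intro add_left_mono mult_left_mono) auto
    also have "(x\<^sup>2 / \<eta>) * p n = p n ^ 3 * (real (deg (low M n) u))\<^sup>2 / \<eta>"
      by (simp add: x_def power2_eq_square power3_eq_cube mult_ac)
    finally show "sdeg n u * of_bool (sdeg n u \<le> M') * wt K n u \<le>
      (\<eta> + 2 * C / M) * wt K n u + p n ^ 3 * (real (deg (low M n) u))\<^sup>2 / \<eta>" .
  qed
  also have "\<dots> = (\<eta> + 2 * C / M) * (\<Sum>u\<in>{1..n}. wt K n u) + (path_mass M n + 2 * p n * edge_mass M n) / \<eta>"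
    unfolding sum_low_deg_sq[OF g, symmetric] by (simp only: sum.distrib sum_distrib_left sum_divide_distrib)
  also have "\<dots> \<le> (\<eta> + 2 * C / M) * K + (path_mass M n + 2 * p n * edge_mass M n) / \<eta>"
    using sum_wt_le[OF g K] \<eta> C_pos M by (intro add_right_mono mult_left_mono) auto
  finally show ?thesis by (simp add: mult.commute)
qed

lemma low_deg_mass_nonneg: "good n \<Longrightarrow> 0 \<le> low_deg_mass K M n"
  unfolding low_deg_mass_def using sdeg_nonneg wt_bounds by (intro sum_nonneg mult_nonneg_nonneg) auto

end

section \<open>Passing to the limit in the comparison of masses\<close>

context ordered_bernoulli_graphs
begin

text \<open>The comparison of the two truncations only asks for \<open>2 * C \<le> K * M\<close>. So
  \<open>M\<close> can be frozen while \<open>K\<close> grows in one direction, and \<open>K\<close>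
  frozen while \<open>M\<close> grows in the other, with \<open>low_deg_mass K M\<close> as the
  vanishing error.\<close>

lemma masses_iff_graphon_masses:
  "nested_lim edge_mass l \<and> (\<forall>M. path_mass M \<longlonglongrightarrow> 0) \<longleftrightarrow>
    nested_lim high_index_mass l \<and> (\<exists>K0>0. \<exists>M0>0. \<forall>K\<ge>K0. \<forall>M\<ge>M0. low_deg_mass K M \<longlonglongrightarrow> 0)"
proof (intro iffI conjI; elim conjE)
  assume e: "nested_lim edge_mass l" and d: "\<forall>M. path_mass M \<longlonglongrightarrow> 0"
  have J: "low_deg_mass K M \<longlonglongrightarrow> 0" if K: "K > 0" and M: "M > 0" for K M
  proof (rule tendstoI)
    fix \<epsilon> :: real assume \<epsilon>: "\<epsilon> > 0"
    \<comment> \<open>This \<open>\<eta>\<close> and the cut-off \<open>M'\<close> below each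
      contribute at most \<open>\<epsilon> / 4\<close> to the part that does not vanish with
      \<open>n\<close>. Enlarging \<open>M\<close> to \<open>M'\<close> is harmless because the path
      mass vanishes at every cut-off.\<close>
    define \<eta> where "\<eta> = \<epsilon> / (4 * K)"
    have \<eta>: "\<eta> > 0" "K * \<eta> = \<epsilon> / 4" using \<epsilon> K by (auto simp: \<eta>_def)
    define M' where "M' = max M (8 * K * C / \<epsilon>)"
    have M': "M' > 0" "M \<le> M'" "8 * K * C / \<epsilon> \<le> M'" using M by (auto simp: M'_def)
    have "K * (2 * C / M') \<le> \<epsilon> / 4"
      using M' \<epsilon> by (simp add: field_simps)
    then have const: "K * (\<eta> + 2 * C / M') \<le> \<epsilon> / 2" using \<eta>(2) by (simp add: distrib_left)
    have "(\<lambda>n. (path_mass M' n + 2 * p n * C) / \<eta>) \<longlonglongrightarrow> (0 + 2 * 0 * C) / \<eta>"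
      using d \<eta>(1) by (intro tendsto_intros p_lim) auto
    then have "\<forall>\<^sub>F n in sequentially. (path_mass M' n + 2 * p n * C) / \<eta> < \<epsilon> / 2"
      using \<epsilon> by (intro order_tendstoD(2)) auto
    with eventually_good show "\<forall>\<^sub>F n in sequentially. dist (low_deg_mass K M n) 0 < \<epsilon>"
    proof eventually_elim
      case (elim n)
      have "(path_mass M' n + 2 * p n * edge_mass M' n) / \<eta> \<le> (path_mass M' n + 2 * p n * C) / \<eta>"
        using edge_mass_bounds[OF elim(1)] goodD(2)[OF elim(1)] \<eta>
        by (intro divide_right_mono add_left_mono mult_left_mono) auto
      then have "low_deg_mass K M n < \<epsilon>"
        using low_deg_mass_le[OF elim(1) _ M'(1,2) \<eta>(1), of K] K const elim(2) by linarith
      then show ?case using low_deg_mass_nonneg[OF elim(1)] by (simp add: dist_real_def)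
    qed
  qed
  then show "\<exists>K0>0. \<exists>M0>0. \<forall>K\<ge>K0. \<forall>M\<ge>M0. low_deg_mass K M \<longlonglongrightarrow> 0"
    by (intro exI[of _ 1] conjI allI impI) auto
  show "nested_lim high_index_mass l"
    unfolding nested_lim_def
  proof (intro allI impI)
    fix \<epsilon> :: real assume "\<epsilon> > 0"
    then have \<epsilon>2: "\<epsilon> / 2 > 0" by simp
    from eventually_happens'[OF trivial_limit_at_top_linorder eventually_conj[OF
      e[unfolded nested_lim_def, rule_format, OF \<epsilon>2] eventually_gt_at_top[of 0]]]
    obtain M where M: "\<forall>\<^sub>F n in sequentially. \<bar>edge_mass M n - l\<bar> < \<epsilon> / 2" "M > 0" by blast
    show "\<forall>\<^sub>F K in at_top. \<forall>\<^sub>F n in sequentially. \<bar>high_index_mass K n - l\<bar> < \<epsilon>"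
      using eventually_ge_at_top[of "2 * C / M"] eventually_gt_at_top[of 0]
    proof eventually_elim
      case (elim K)
      then have KM: "2 * C \<le> K * M" using M(2) by (simp add: field_simps)
      have "\<forall>\<^sub>F n in sequentially. low_deg_mass K M n < \<epsilon> / 2"
        using order_tendstoD(2)[OF J[OF elim(2) M(2)] \<epsilon>2] .
      with M(1) eventually_good show ?case
      proof eventually_elim
        case (elim n)
        show ?case
          using edge_mass_high_index_mass[OF elim(2) \<open>0 < K\<close> KM] elim(1,3) by linarith
      qed
    qed
  qed
next
  assume h: "nested_lim high_index_mass l"
    and "\<exists>K0>0. \<exists>M0>0. \<forall>K\<ge>K0. \<forall>M\<ge>M0. low_deg_mass K M \<longlonglongrightarrow> 0"
  then obtain K0 M0 where KM0: "K0 > 0" "M0 > 0"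
    and J: "\<And>K M. K \<ge> K0 \<Longrightarrow> M \<ge> M0 \<Longrightarrow> low_deg_mass K M \<longlonglongrightarrow> 0" by auto
  show "nested_lim edge_mass l"
    unfolding nested_lim_def
  proof (intro allI impI)
    fix \<epsilon> :: real assume "\<epsilon> > 0"
    then have \<epsilon>2: "\<epsilon> / 2 > 0" by simp
    from eventually_happens'[OF trivial_limit_at_top_linorder eventually_conj[OF
      h[unfolded nested_lim_def, rule_format, OF \<epsilon>2] eventually_conj[OF eventually_ge_at_top[of K0] eventually_ge_at_top[of "2 * C / M0"]]]]
    obtain K where K: "\<forall>\<^sub>F n in sequentially. \<bar>high_index_mass K n - l\<bar> < \<epsilon> / 2" "K \<ge> K0" "2 * C / M0 \<le> K" by blast
    then have K_pos: "K > 0" using KM0 by linarith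
    show "\<forall>\<^sub>F M in at_top. \<forall>\<^sub>F n in sequentially. \<bar>edge_mass M n - l\<bar> < \<epsilon>"
      using eventually_ge_at_top[of M0]
    proof eventually_elim
      case (elim M)
      have "2 * C \<le> K * M0" using K(3) KM0 by (simp add: field_simps)
      also have "\<dots> \<le> K * M" using K_pos elim by simp
      finally have KM: "2 * C \<le> K * M" .
      have "\<forall>\<^sub>F n in sequentially. low_deg_mass K M n < \<epsilon> / 2"
        using order_tendstoD(2)[OF J[OF K(2) elim] \<epsilon>2] .
      with K(1) eventually_good show ?case
      proof eventually_elim
        case (elim n)
        show ?case
          using edge_mass_high_index_mass[OF elim(2) K_pos KM] elim(1,3) by linarith
      qed
    qed
  qed
  show "\<forall>M. path_mass M \<longlonglongrightarrow> 0"
  proof (intro allI tendstoI)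
    fix M \<epsilon> :: real assume \<epsilon>: "\<epsilon> > 0"
    \<comment> \<open>Monotonicity of the path mass reduces small \<open>M\<close> to a cut-off
      covered by the hypothesis; \<open>K\<close> is then taken so large that the index tail
      \<open>4 * C\<^sup>2 / K\<close> is at most \<open>\<epsilon> / 2\<close>.\<close>
    define M' where "M' = max M M0"
    have M': "M' \<ge> M0" "M \<le> M'" "M' \<ge> 0" using KM0 by (auto simp: M'_def)
    define K where "K = max K0 (8 * C\<^sup>2 / \<epsilon>)"
    have K: "K \<ge> K0" "K > 0" "8 * C\<^sup>2 / \<epsilon> \<le> K" using KM0 by (auto simp: K_def)
    have c: "4 * C\<^sup>2 / K \<le> \<epsilon> / 2" using K \<epsilon> by (simp add: field_simps)
    have "(\<lambda>n. M' * low_deg_mass K M' n) \<longlonglongrightarrow> M' * 0"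
      by (intro tendsto_mult_left J K M')
    then have "\<forall>\<^sub>F n in sequentially. M' * low_deg_mass K M' n < \<epsilon> / 2"
      using \<epsilon> by (intro order_tendstoD(2)) auto
    with eventually_good show "\<forall>\<^sub>F n in sequentially. dist (path_mass M n) 0 < \<epsilon>"
    proof eventually_elim
      case (elim n)
      have "path_mass M n < \<epsilon>"
        using path_mass_mono[OF elim(1) M'(2)] path_mass_le_low_deg_mass[OF elim(1) K(2) M'(3)] c elim(2) by linarith
      then show ?case using path_mass_nonneg[OF elim(1)] by (simp add: dist_real_def)
    qed
  qed
qed

lemma corner_mass_tendsto:
  assumes K: "K > 0" and J: "\<And>M. M \<ge> M0 \<Longrightarrow> low_deg_mass K M \<longlonglongrightarrow> 0"
  shows "corner_mass K \<longlonglongrightarrow> 0"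
proof (rule tendstoI)
  fix \<epsilon> :: real assume \<epsilon>: "\<epsilon> > 0"
  define M where "M = max (max M0 1) (4 * K * C / \<epsilon>)"
  have M: "M \<ge> M0" "M > 0" "4 * K * C / \<epsilon> \<le> M" by (auto simp: M_def)
  have c: "K * (2 * C / M) \<le> \<epsilon> / 2" using M \<epsilon> by (simp add: field_simps)
  have "\<forall>\<^sub>F n in sequentially. low_deg_mass K M n < \<epsilon> / 2"
    using \<epsilon> by (intro order_tendstoD(2)[OF J[OF M(1)]]) simp
  with eventually_good show "\<forall>\<^sub>F n in sequentially. dist (corner_mass K n) 0 < \<epsilon>"
  proof eventually_elim
    case (elim n)
    have "0 \<le> corner_mass K n"
      unfolding corner_mass_def using wt_bounds[OF elim(1)] adj_nonneg by (intro sum_nonneg mult_nonneg_nonneg) auto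
    moreover have "corner_mass K n < \<epsilon>"
      using corner_mass_le[OF elim(1) _ M(2), of K] K c elim(2) by linarith
    ultimately show ?case by (simp add: dist_real_def)
  qed
qed

end

section \<open>Transfer from random variables to finite expectations\<close>

context prob_space
begin

lemma borel_measurable_active:
  assumes V: "finite V" and meas: "\<And>u. u \<in> V \<Longrightarrow> X u \<in> borel_measurable M"
  shows "(\<lambda>\<omega>. g {u \<in> V. X u \<omega> = (1::real)} :: real) \<in> borel_measurable M"
proof -
  have "(\<lambda>\<omega>. {u \<in> V. X u \<omega> = 1}) \<in> measurable M (count_space (Pow V))"
  proof (subst measurable_count_space_eq2[OF finite_Pow_iff[THEN iffD2, OF V]], intro conjI ballI)
    fix S assume S: "S \<in> Pow V"
    have [measurable]: "{\<omega> \<in> space M. X u \<omega> = 1} \<in> sets M" if "u \<in> V" for u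
      using meas[OF that] by measurable
    have "(\<lambda>\<omega>. {u \<in> V. X u \<omega> = 1}) -` {S} \<inter> space M =
        {\<omega> \<in> space M. \<forall>u\<in>V. (\<omega> \<in> {\<omega> \<in> space M. X u \<omega> = 1}) = (u \<in> S)}"
      using S by auto
    also have "\<dots> \<in> sets M" using V by measurable
    finally show "(\<lambda>\<omega>. {u \<in> V. X u \<omega> = 1}) -` {S} \<inter> space M \<in> sets M" .
  qed auto
  then show ?thesis by (rule measurable_compose) simp
qed

text \<open>A variable with Bernoulli law takes the values 0 and 1 only almost surely, so
  \<open>Y\<close> is identified with a function of the active set just on those outcomes;
  measurability of both sides then equates the integrals.\<close>

lemma expectation_eq_bern_exp:
  assumes V: "finite V" "V \<noteq> {}"
    and indep: "indep_vars (\<lambda>_. borel) X V"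
    and law: "\<And>u. u \<in> V \<Longrightarrow> distr M borel (X u) = bernoulli_law q"
    and q: "0 \<le> q" "q \<le> 1"
    and Y: "Y \<in> borel_measurable M"
    and Yg: "\<And>\<omega>. \<forall>u\<in>V. X u \<omega> \<in> {0, 1} \<Longrightarrow> Y \<omega> = g {u \<in> V. X u \<omega> = 1}"
  shows "expectation Y = bern_exp q V g"
proof -
  have meas: "X u \<in> borel_measurable M" if "u \<in> V" for u
    using indep that unfolding indep_vars_def2 by auto
  have "AE \<omega> in M. \<forall>u\<in>V. X u \<omega> \<in> {0, 1}"
    by (rule bernoulli_AE[OF V(1) _ law q]) (use meas in auto)
  then have "AE \<omega> in M. Y \<omega> = g {u \<in> V. X u \<omega> = 1}"
    by eventually_elim (rule Yg)
  then have "expectation Y = expectation (\<lambda>\<omega>. g {u \<in> V. X u \<omega> = 1})"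
    by (intro integral_cong_AE Y borel_measurable_active V(1) meas)
  also have "\<dots> = bern_exp q V g" by (rule bernoulli_active_expectation[OF V indep law q])
  finally show ?thesis .
qed

end

section \<open>The theorem\<close>

theorem mainTheorem4:
  fixes P :: "nat \<Rightarrow> 'a measure"
    and X :: "nat \<Rightarrow> nat \<Rightarrow> 'a \<Rightarrow> real"
    and p r :: "nat \<Rightarrow> real"
    and E :: "nat \<Rightarrow> nat set set"
    and T :: "nat \<Rightarrow> 'a \<Rightarrow> real"
    and TM :: "real \<Rightarrow> nat \<Rightarrow> 'a \<Rightarrow> real"
    and W :: "nat \<Rightarrow> real \<Rightarrow> real \<Rightarrow> real"
    and l :: real
  assumes p: "\<And>n. n \<ge> 1 \<Longrightarrow> 0 < p n \<and> p n < 1"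
    and p_lim: "p \<longlonglongrightarrow> 0"
    and r: "\<And>n. r n = 1 / p n"
    and prob: "\<And>n. n \<ge> 1 \<Longrightarrow> prob_space (P n)"
    and indep: "\<And>n. n \<ge> 1 \<Longrightarrow> prob_space.indep_vars (P n) (\<lambda>_. borel) (X n) {1..n}"
    and bern: "\<And>n u. n \<ge> 1 \<Longrightarrow> u \<in> {1..n} \<Longrightarrow> distr (P n) borel (X n u) = bernoulli_law (p n)"
    and graph: "\<And>n. n \<ge> 1 \<Longrightarrow> simple_graph n (E n)"
    and ordered: "\<And>n. n \<ge> 1 \<Longrightarrow> degree_ordered n (E n)"
    and T: "\<And>n. T n = edge_count_stat n (E n) (X n)"
    and TM: "\<And>M n. TM M n = trunc_edge_stat (r n) (E n) M (X n)"
    and W: "\<And>n. W n = graphon n (r n) (E n)"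
    and mean: "(\<lambda>n. prob_space.expectation (P n) (T n)) \<in> \<Theta>(\<lambda>_. 1)"
    and l: "l \<ge> 0"
  defines "a \<equiv> weak_conv_m (\<lambda>n. distr (P n) borel (T n)) (poisson_law l)"
    and "b \<equiv> double_lim (\<lambda>M n. prob_space.expectation (P n) (TM M n)) l \<and>
             double_lim (\<lambda>M n. prob_space.variance (P n) (TM M n)) l"
    and "c \<equiv> double_lim (\<lambda>K n. 1 / 2 * (LINT y:{K..}|lborel. LINT x:{K..}|lborel. W n x y)) l \<and>
             (\<exists>K0>0. \<forall>K\<ge>K0. (\<lambda>n. cut_norm K (W n)) \<longlonglongrightarrow> 0) \<and>
             (\<exists>K0>0. \<exists>M0>0. \<forall>K\<ge>K0. \<forall>M\<ge>M0.
                (\<lambda>n. LINT x:{0..K}|lborel.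
                   graphon_deg (W n) x * of_bool (graphon_deg (W n) x \<le> M)) \<longlonglongrightarrow> 0)"
  shows "(a \<longleftrightarrow> b) \<and> (b \<longleftrightarrow> c)"
proof -
  have meas: "X n u \<in> borel_measurable (P n)" if "n \<ge> 1" "u \<in> {1..n}" for n u
    using indep[OF that(1)] that(2) unfolding prob_space.indep_vars_def2[OF prob[OF that(1)]] by blast
  have expect: "prob_space.expectation (P n) Y = bern_exp (p n) {1..n} g"
    if n: "n \<ge> 1" and "Y \<in> borel_measurable (P n)"
      "\<And>\<omega>. \<forall>u\<in>{1..n}. X n u \<omega> \<in> {0, 1} \<Longrightarrow> Y \<omega> = g {u \<in> {1..n}. X n u \<omega> = 1}" for n Y g
    using that p[OF n] by (intro prob_space.expectation_eq_bern_exp[OF prob[OF n] _ _ indep[OF n] bern[OF n]]) auto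
  have T_meas: "T n \<in> borel_measurable (P n)" if n: "n \<ge> 1" for n
    unfolding T edge_count_stat_def
    by (intro borel_measurable_times borel_measurable_sum borel_measurable_const meas[OF n])
  have TM_meas: "TM M n \<in> borel_measurable (P n)" if n: "n \<ge> 1" for M n
    unfolding TM trunc_edge_stat_def[abs_def] trunc_var_def
  proof (intro borel_measurable_times borel_measurable_sum borel_measurable_prod borel_measurable_const meas[OF n])
    show "u \<in> {1..n}" if "e \<in> E n" "u \<in> e" for e u
      using simple_graph_edge(1)[OF graph[OF n] that(1)] that(2) by blast
  qed
  have mean_eq: "prob_space.expectation (P n) (T n) = (p n)\<^sup>2 * card (E n)" if n: "n \<ge> 1" for n
  proof -
    have "prob_space.expectation (P n) (T n) = bern_exp (p n) {1..n} (\<lambda>S. real (edges_in (E n) S))"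
      by (rule expect[OF n T_meas[OF n]], unfold T, rule edge_count_stat_eq[OF graph[OF n]])
    then show ?thesis by (simp only: bern_exp_edges_in[OF graph[OF n]])
  qed
  \<comment> \<open>The constant of the upper bound in \<open>\<Theta>(1)\<close> serves as the edge
    bound of the locale, since the mean is \<open>(p n)\<^sup>2 * card (E n)\<close>.\<close>
  obtain C where C: "C > 0" "\<forall>\<^sub>F n in sequentially. norm (prob_space.expectation (P n) (T n)) \<le> C * norm (1::real)"
    using bigthetaD1[OF mean] by (elim landau_o.bigE)
  interpret ordered_bernoulli_graphs p E C
  proof unfold_locales
    show "\<forall>\<^sub>F n in sequentially. (p n)\<^sup>2 * card (E n) \<le> C"
      using C(2) eventually_ge_at_top[of 1] by eventually_elim (simp add: mean_eq)
  qed (use p p_lim graph ordered C(1) in auto)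
  have low_eq: "low_edges (E n) (M * r n) = low M n" for M n
    by (simp add: low_def r)

  have a_iff: "a \<longleftrightarrow> (\<forall>k. (\<lambda>n. count_prob n k) \<longlonglongrightarrow> poisson_weight l k)"
    unfolding a_def
  proof (rule weak_conv_poisson_iff[OF l])
    fix n :: nat and x :: real assume n: "n \<ge> 1"
    interpret Pn: prob_space "P n" by (rule prob[OF n])
    have [measurable]: "T n \<in> borel_measurable (P n)" by (rule T_meas[OF n])
    have "cdf (distr (P n) borel (T n)) x = Pn.prob {\<omega> \<in> space (P n). T n \<omega> \<le> x}"
      unfolding cdf_def2 by (subst measure_distr) (auto intro!: arg_cong[of _ _ Pn.prob])
    also have "\<dots> = Pn.expectation (indicator {\<omega> \<in> space (P n). T n \<omega> \<le> x})"
      by (simp add: Int_absorb2 subset_eq)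
    also have "\<dots> = Pn.expectation (\<lambda>\<omega>. of_bool (T n \<omega> \<le> x))"
      by (intro Bochner_Integration.integral_cong) (auto simp: indicator_def)
    also have "\<dots> = bern_exp (p n) {1..n} (\<lambda>S. of_bool (real (edges_in (E n) S) \<le> x))"
    proof (rule expect[OF n])
      show "(\<lambda>\<omega>. of_bool (T n \<omega> \<le> x) :: real) \<in> borel_measurable (P n)" unfolding of_bool_def by measurable
    qed (simp only: T edge_count_stat_eq[OF graph[OF n]])
    also have "\<dots> = bern_exp (p n) {1..n} (\<lambda>S. \<Sum>k | real k \<le> x. of_bool (edges_in (E n) S = k))"
      using finite_real_le[of x] by (intro bern_exp_cong) (simp add: of_bool_def)
    also have "\<dots> = (\<Sum>k | real k \<le> x. count_prob n k)" unfolding bern_exp_sum count_prob_def ..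
    finally show "cdf (distr (P n) borel (T n)) x = (\<Sum>k | real k \<le> x. count_prob n k)" .
  qed

  have TM_eq: "TM M n \<omega> = real (edges_in (low M n) {u \<in> {1..n}. X n u \<omega> = 1})"
    if "n \<ge> 1" "\<forall>u\<in>{1..n}. X n u \<omega> \<in> {0, 1}" for M n \<omega>
    using trunc_edge_stat_eq[where X = "X n", OF graph[OF that(1)] that(2)] by (simp only: TM low_eq)
  have m1: "prob_space.expectation (P n) (TM M n) = moment 1 M n" if n: "n \<ge> 1" for M n
    unfolding moment_def
    by (rule expect[OF n TM_meas[OF n]]) (simp only: TM_eq[OF n] power_one_right)
  have var: "prob_space.variance (P n) (TM M n) = moment 2 M n - (moment 1 M n)\<^sup>2" if n: "n \<ge> 1" for M n
  proof -
    define m where "m = moment 1 M n"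
    have "prob_space.variance (P n) (TM M n) = bern_exp (p n) {1..n} (\<lambda>S. (real (edges_in (low M n) S) - m)\<^sup>2)"
    proof (rule expect[OF n])
      show "(\<lambda>\<omega>. (TM M n \<omega> - prob_space.expectation (P n) (TM M n))\<^sup>2) \<in> borel_measurable (P n)"
        using TM_meas[OF n] by measurable
    qed (simp only: m1[OF n] m_def TM_eq[OF n])
    also have "\<dots> = bern_exp (p n) {1..n} (\<lambda>S. real (edges_in (low M n) S) ^ 2 - (2 * m) * real (edges_in (low M n) S) ^ 1 + m\<^sup>2)"
      by (intro bern_exp_cong) (simp add: power2_diff)
    also have "\<dots> = moment 2 M n - (2 * m) * m + m\<^sup>2"
      unfolding bern_exp_add bern_exp_diff bern_exp_cmult by (simp add: bern_exp_const moment_def m_def)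
    finally show ?thesis by (simp add: m_def power2_eq_square)
  qed
  have b_iff: "b \<longleftrightarrow> nested_lim (moment 1) l \<and> nested_lim (\<lambda>M n. moment 2 M n - (moment 1 M n)\<^sup>2) l"
    unfolding b_def double_lim_iff_nested_lim
    by (intro conj_cong nested_lim_cong always_eventually allI eventually_mono[OF eventually_ge_at_top[of 1]] m1 var)

  have rg: "r n > 0" "1 / r n = p n" if "n \<ge> 1" for n using p[OF that] by (auto simp: r)
  have c1: "1 / 2 * (LINT y:{K..}|lborel. LINT x:{K..}|lborel. W n x y) = high_index_mass K n" if "n \<ge> 1" "K \<ge> 0" for n K
    unfolding W graphon_integral_high[OF graph[OF that(1)] rg(1)[OF that(1)] that(2)] high_index_mass_def wt_def rg(2)[OF that(1)]
    unfolding r ..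
  have c3: "(LINT x:{0..K}|lborel. graphon_deg (W n) x * of_bool (graphon_deg (W n) x \<le> M)) = low_deg_mass K M n"
    if "n \<ge> 1" "K \<ge> 0" for n K M
    unfolding W graphon_deg_integral_low[OF graph[OF that(1)] rg(1)[OF that(1)] that(2)] low_deg_mass_def sdeg_def wt_def
    by (simp add: r)
  have c2: "0 \<le> cut_norm K (W n)" "cut_norm K (W n) \<le> corner_mass K n" if "n \<ge> 1" "K \<ge> 0" for n K
    using cut_norm_graphon_bounds[OF graph[OF that(1)] rg(1)[OF that(1)] that(2)]
    unfolding W corner_mass_def wt_def r by auto
  have c1_iff: "double_lim (\<lambda>K n. 1 / 2 * (LINT y:{K..}|lborel. LINT x:{K..}|lborel. W n x y)) l \<longleftrightarrow>
      nested_lim high_index_mass l"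
    unfolding double_lim_iff_nested_lim
  proof (rule nested_lim_cong)
    show "\<forall>\<^sub>F K in at_top. \<forall>\<^sub>F n in sequentially.
        1 / 2 * (LINT y:{K..}|lborel. LINT x:{K..}|lborel. W n x y) = high_index_mass K n"
      using eventually_ge_at_top[of 0]
    proof eventually_elim
      case (elim K)
      show ?case using eventually_ge_at_top[of 1] by eventually_elim (rule c1[OF _ elim])
    qed
  qed
  have c3_iff: "(\<lambda>n. LINT x:{0..K}|lborel. graphon_deg (W n) x * of_bool (graphon_deg (W n) x \<le> M)) \<longlonglongrightarrow> 0
      \<longleftrightarrow> low_deg_mass K M \<longlonglongrightarrow> 0" if "K \<ge> 0" for K M
    by (rule tendsto_cong) (use eventually_ge_at_top[of 1] in eventually_elim, rule c3[OF _ that])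
  have c2_if: "(\<lambda>n. cut_norm K (W n)) \<longlonglongrightarrow> 0" if "K \<ge> 0" "corner_mass K \<longlonglongrightarrow> 0" for K
  proof (rule tendsto_sandwich[OF _ _ tendsto_const that(2)])
    show "\<forall>\<^sub>F n in sequentially. 0 \<le> cut_norm K (W n)" "\<forall>\<^sub>F n in sequentially. cut_norm K (W n) \<le> corner_mass K n"
      by (rule eventually_mono[OF eventually_ge_at_top[of 1]], erule c2[OF _ that(1)])+
  qed
  let ?J = "\<exists>K0>0. \<exists>M0>0. \<forall>K\<ge>K0. \<forall>M\<ge>M0. low_deg_mass K M \<longlonglongrightarrow> 0"
  have J_iff: "(\<exists>K0>0. \<exists>M0>0. \<forall>K\<ge>K0. \<forall>M\<ge>M0.
      (\<lambda>n. LINT x:{0..K}|lborel. graphon_deg (W n) x * of_bool (graphon_deg (W n) x \<le> M)) \<longlonglongrightarrow> 0) \<longleftrightarrow> ?J"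
    by (intro iff_exI conj_cong iff_allI imp_cong refl c3_iff) linarith
  have cut: "\<exists>K0>0. \<forall>K\<ge>K0. (\<lambda>n. cut_norm K (W n)) \<longlonglongrightarrow> 0" if ?J
  proof -
    from that obtain K0 M0 where K0: "K0 > 0" and J: "\<And>K M. K \<ge> K0 \<Longrightarrow> M \<ge> M0 \<Longrightarrow> low_deg_mass K M \<longlonglongrightarrow> 0"
      by blast
    have "(\<lambda>n. cut_norm K (W n)) \<longlonglongrightarrow> 0" if K: "K \<ge> K0" for K
      using K0 K by (intro c2_if corner_mass_tendsto[OF _ J]) auto
    then show ?thesis using K0 by blast
  qed
  have c_iff: "c \<longleftrightarrow> nested_lim edge_mass l \<and> (\<forall>M. path_mass M \<longlonglongrightarrow> 0)"
    unfolding c_def c1_iff J_iff masses_iff_graphon_masses using cut by blast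
  show ?thesis
    using a_iff b_iff c_iff count_prob_poisson_iff_moments[OF l] moments_iff_masses[of l] by blast
qed

end
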